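(* Let $\mathbb{F}=\mathbb{Z}_3$ and $\beta^{m,n}_d=\dim_{\mathbb{Z}_3}\tilde{H}_d(\mathsf{M}_{m,n};\mathbb{Z}_3)$. Suppose $m\le n\le 2m-5$, $m+n\equiv 1\pmod 3$, $(m,n)\neq(5,5)$, and $d=\nu_{m,n}$. Then \[ \beta^{m,n}_d= \beta^{m-1,n-2}_{d-1}+(n-2)\beta^{m-1,n-1}_{d-1}+2\binom{m-1}{2}\beta^{m-3,n-2}_{d-2}, \] i.e. the inequality $\beta^{m,n}_d\le \beta^{m-1,n-2}_{d-1}+(n-2)\beta^{m-1,n-1}_{d-1}+2\binom{m-1}{2}\beta^{m-3,n-2}_{d-2}$ (valid for $m\ge3$, $n\ge2$) is sharp.
   Context: $\mathsf{M}_{m,n}$ denotes the chessboard complex: the simplicial complex whose faces are the matchings in the complete bipartite graph $K_{m,n}$ (defined for all $m,n\ge0$, with $\mathsf{M}_{m,n}\cong\mathsf{M}_{n,m}$). For $1\le m\le n$, $\nu_{m,n}=\min\{m-1,\lceil\frac{m+n-4}{3}\rceil\}$. $\tilde H$ denotes reduced simplicial homology. *)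

theory Defs
  imports "Jordan_Normal_Form.VS_Connect" "HOL-Algebra.AbelCoset"
begin

text \<open>
  Reduced simplicial homology of an abstract simplicial complex \<open>K\<close> (a downward closed family of
  finite sets, with the empty set among the faces) over a field \<open>'k\<close>. Degrees are integers, and the
  empty face has dimension \<open>-1\<close>. A chain is identified with its coefficient function on faces.
\<close>

definition faces_of_dim :: "'v set set \<Rightarrow> int \<Rightarrow> 'v set set" where
  "faces_of_dim K d = {\<sigma> \<in> K. finite \<sigma> \<and> int (card \<sigma>) = d + 1}"

definition chain_space :: "'v set set \<Rightarrow> int \<Rightarrow> ('k::field, 'v set \<Rightarrow> 'k) module" where
  "chain_space K d =
    \<lparr>carrier = {c. finite {\<sigma>. c \<sigma> \<noteq> 0} \<and> {\<sigma>. c \<sigma> \<noteq> 0} \<subseteq> faces_of_dim K d},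
     mult = undefined, one = undefined,
     zero = (\<lambda>\<sigma>. 0), add = (\<lambda>c c' \<sigma>. c \<sigma> + c' \<sigma>),
     smult = (\<lambda>a c \<sigma>. a * c \<sigma>)\<rparr>"

text \<open>
  The linear extension of
  \<open>\<sigma> \<mapsto> (\<Sum>x\<in>\<sigma>. (-1) ^ card {y \<in> \<sigma>. y \<prec> x} [\<sigma> - {x}])\<close>, where \<open>lt\<close> is a strict total order
  \<open>\<prec>\<close> on the vertices, used to orient the faces (the homology does not depend on its choice, up
  to isomorphism). A vertex is mapped to the empty face, so the homology below is reduced.
\<close>

definition boundary :: "('v \<Rightarrow> 'v \<Rightarrow> bool) \<Rightarrow> ('v set \<Rightarrow> 'k::field) \<Rightarrow> 'v set \<Rightarrow> 'k" where
  "boundary lt c \<tau> =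
    (\<Sum>\<sigma> | c \<sigma> \<noteq> 0. \<Sum>x\<in>\<sigma>.
       if \<sigma> - {x} = \<tau> then (- 1) ^ card {y \<in> \<sigma>. lt y x} * c \<sigma> else 0)"

definition cycles ::
    "('v \<Rightarrow> 'v \<Rightarrow> bool) \<Rightarrow> 'v set set \<Rightarrow> int \<Rightarrow> ('v set \<Rightarrow> 'k::field) set" where
  "cycles lt K d = {c \<in> carrier (chain_space K d). boundary lt c = (\<lambda>\<tau>. 0)}"

definition boundaries ::
    "('v \<Rightarrow> 'v \<Rightarrow> bool) \<Rightarrow> 'v set set \<Rightarrow> int \<Rightarrow> ('v set \<Rightarrow> 'k::field) set" where
  "boundaries lt K d = boundary lt ` carrier (chain_space K (d + 1))"

text \<open>
  The quotient of a module by a submodule \<open>N\<close>. The union in the scalar multiplication is over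
  equal cosets; scaling a coset elementwise would be wrong for the scalar \<open>0\<close>.
\<close>

definition quotient_module :: "('k, 'a, 'm) module_scheme \<Rightarrow> 'a set \<Rightarrow> ('k, 'a set) module" where
  "quotient_module M N =
    \<lparr>carrier = a_rcosets\<^bsub>M\<^esub> N, mult = undefined, one = undefined,
     zero = N, add = (\<lambda>X Y. X <+>\<^bsub>M\<^esub> Y),
     smult = (\<lambda>a X. \<Union>x\<in>X. N +>\<^bsub>M\<^esub> (a \<odot>\<^bsub>M\<^esub> x))\<rparr>"

definition reduced_homology ::
    "('v \<Rightarrow> 'v \<Rightarrow> bool) \<Rightarrow> 'v set set \<Rightarrow> int \<Rightarrow> ('k::field, ('v set \<Rightarrow> 'k) set) module" where
  "reduced_homology lt K d =
    quotient_module ((chain_space K d)\<lparr>carrier := cycles lt K d\<rparr>) (boundaries lt K d)"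

text \<open>
  The edges of \<open>K\<^sub>m\<^sub>,\<^sub>n\<close> are the pairs \<open>(i, j)\<close> with \<open>i\<close> in the part of size \<open>m\<close> and \<open>j\<close> in the
  part of size \<open>n\<close>; the two parts are understood to be disjoint copies of intervals.
\<close>

definition complete_bipartite_edges :: "nat \<Rightarrow> nat \<Rightarrow> (nat \<times> nat) set" where
  "complete_bipartite_edges m n = {1..m} \<times> {1..n}"

definition matching :: "(nat \<times> nat) set \<Rightarrow> bool" where
  "matching M \<longleftrightarrow> (\<forall>e\<in>M. \<forall>f\<in>M. e \<noteq> f \<longrightarrow> fst e \<noteq> fst f \<and> snd e \<noteq> snd f)"

definition chessboard_complex :: "nat \<Rightarrow> nat \<Rightarrow> (nat \<times> nat) set set" where
  "chessboard_complex m n = {M. M \<subseteq> complete_bipartite_edges m n \<and> matching M}"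

definition lex_less :: "nat \<times> nat \<Rightarrow> nat \<times> nat \<Rightarrow> bool" where
  "lex_less e f \<longleftrightarrow> fst e < fst f \<or> fst e = fst f \<and> snd e < snd f"

definition nu :: "nat \<Rightarrow> nat \<Rightarrow> int" where
  "nu m n = min (int m - 1) \<lceil>(real m + real n - 4) / 3\<rceil>"

text \<open>The type \<open>finite_3\<close> is the field with three elements.\<close>

definition betti :: "nat \<Rightarrow> nat \<Rightarrow> int \<Rightarrow> nat" where
  "betti m n d =
    vectorspace.dim (class_ring :: Enum.finite_3 ring)
      (reduced_homology lex_less (chessboard_complex m n) d)"

end

theory Submission
  imports Defs "HOL-Library.Function_Algebras" "HOL-Library.Product_Lexorder" "HOL-Library.Nat_Bijection"
begin

text \<open>
  Put \<open>k = d + 1\<close>, so that \<open>m + n = 3 k + 1\<close> and \<open>m, n \<ge> k + 2\<close>. The last two Betti numbers on the right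
  vanish by connectivity; the other one and the Betti number on the left are both 1.

  Connectivity: a cycle can be pushed off a vertex \<open>q\<close> when the links of the edges at \<open>q\<close> are
  acyclic, and a cycle that avoids two adjacent vertices is a boundary.

  Upper bound: the homology is generated by joins of cycles of a board of size \<open>m - 1\<close> by \<open>n - 2\<close> with
  a path \<open>pb - pq\<close>, where \<open>b\<close> and \<open>q\<close> can be fixed in advance; this reduces the claim to the 5 by 5
  board, where a relation modulo 3 in the torus of the 4 by 3 board applies.

  Lower bound: the board is a subcomplex of the matching complex of a complete graph on \<open>3 k + 1\<close>
  vertices. On the latter there is, by induction on \<open>k\<close>, a functional on homology that is
  antisymmetric in the vertices and takes the values \<open>\<plusminus>1\<close> on iterated joins of such paths. In degree
  0 on four vertices it sends the three perfect matchings to 0, 1 and 2 modulo 3.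
\<close>


section \<open>Exterior algebra\<close>

text \<open>The identity becomes 1 = 1 + 0 + 0. The case (5,5) is excluded because there the first
  term on the right is the first Betti number of the torus of the 4 by 3 board, which is 2, whereas
  the left side is still 1. For the same reason the induction for the upper bound cannot go down to
  that torus: the 5 by 5 board is the smallest one with \<open>k + 2\<close> vertices on each side,
  and there two generators collapse to one.

  The lower bound leaves the chessboard because rows and columns play different roles there. In a
  complete graph all vertices are alike, so the functionals obtained by deleting \<open>x\<close>
  and by deleting \<open>y\<close> can be required to agree up to sign. This requirement is exactly
  what makes the recursion for the functional well defined: it kills boundaries, and it allows the
  two auxiliary vertices in the recursion to be changed.

  Characteristic 3 enters at two independent places: in the upper bound through a multiple of 3 in
  the torus, and in the lower bound through 1 + 1 = -1 when an auxiliary vertex is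
  exchanged.\<close>

lemma sum_fun_apply: "(\<Sum>x\<in>A. f x) y = (\<Sum>x\<in>A. f x y)"
  by (induction A rule: infinite_finite_induct) auto

lemmas pointwise = plus_fun_apply zero_fun_apply minus_apply uminus_apply

text \<open>
  Induction and calculation leave eta-expanded functions behind; rewriting them pointwise would
  hide them from the algebraic rules below.
\<close>

declare pointwise [simp del]

definition scale :: "'k::comm_ring_1 \<Rightarrow> ('a \<Rightarrow> 'k) \<Rightarrow> 'a \<Rightarrow> 'k" where
  "scale a c = (\<lambda>x. a * c x)"

locale exterior_algebra =
  fixes E :: "'e::linorder set"
  assumes finite_E: "finite E"
begin

text \<open>Intersecting with the finite set \<open>E\<close> keeps the count finite for every
  \<open>\<tau>\<close>, so the sign rules below hold for all sets and not only for finite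
  ones.\<close>

definition sg :: "'e \<Rightarrow> 'e set \<Rightarrow> 'k::comm_ring_1" where
  "sg e \<tau> = (- 1) ^ card {y \<in> \<tau> \<inter> E. y < e}"

text \<open>Exterior multiplication from the left, where a set stands for the product of its
  elements in increasing order; \<open>contract\<close> is the dual interior product.\<close>

definition wedge :: "'e \<Rightarrow> ('e set \<Rightarrow> 'k::comm_ring_1) \<Rightarrow> 'e set \<Rightarrow> 'k" where
  "wedge e c = (\<lambda>\<tau>. if e \<in> \<tau> then sg e \<tau> * c (\<tau> - {e}) else 0)"

definition contract :: "'e \<Rightarrow> ('e set \<Rightarrow> 'k::comm_ring_1) \<Rightarrow> 'e set \<Rightarrow> 'k" where
  "contract e c = (\<lambda>\<tau>. if e \<in> \<tau> then 0 else sg e \<tau> * c (insert e \<tau>))"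

text \<open>Contraction with the functional that takes the value 1 on every \<open>e\<close>. It is
  the simplicial boundary, defined before any complex is chosen, so that all complexes on labels
  from \<open>E\<close> share it.\<close>

definition bd :: "('e set \<Rightarrow> 'k::comm_ring_1) \<Rightarrow> 'e set \<Rightarrow> 'k" where
  "bd c = (\<Sum>e\<in>E. contract e c)"

lemma sg_insert_self [simp]: "sg e (insert e \<tau>) = sg e \<tau>"
  unfolding sg_def by (rule arg_cong[where f = "\<lambda>A. (- 1) ^ card A"]) auto

lemma sg_remove_self [simp]: "sg e (\<tau> - {e}) = sg e \<tau>"
  unfolding sg_def by (rule arg_cong[where f = "\<lambda>A. (- 1) ^ card A"]) auto

lemma sg_sg [simp]: "sg e \<tau> * sg e \<tau> = 1"
  by (simp add: sg_def)

lemma sg_sg_mult [simp]: "sg e \<tau> * (sg e \<tau> * a) = a"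
proof -
  have "sg e \<tau> * (sg e \<tau> * a) = (sg e \<tau> * sg e \<tau>) * a" by (simp only: mult.assoc)
  then show ?thesis by (simp only: sg_sg mult_1)
qed

lemma sg_insert:
  assumes "f \<in> E" "f \<notin> \<tau>"
  shows "sg e (insert f \<tau>) = (if f < e then - sg e \<tau> else sg e \<tau>)"
proof -
  have "{y \<in> insert f \<tau> \<inter> E. y < e} =
      (if f < e then insert f {y \<in> \<tau> \<inter> E. y < e} else {y \<in> \<tau> \<inter> E. y < e})"
    using assms by auto
  moreover have "finite {y \<in> \<tau> \<inter> E. y < e}" using finite_E by auto
  ultimately show ?thesis using assms by (simp add: sg_def)
qed

lemma wedge_add [simp]: "wedge e (c + d) = wedge e c + wedge e d"
  by (rule ext) (simp add: wedge_def pointwise distrib_left)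

lemma contract_add [simp]: "contract e (c + d) = contract e c + contract e d"
  by (rule ext) (simp add: contract_def pointwise distrib_left)

lemma wedge_minus [simp]: "wedge e (- c) = - wedge e c"
  by (rule ext) (simp add: wedge_def pointwise)

lemma contract_minus [simp]: "contract e (- c) = - contract e c"
  by (rule ext) (simp add: contract_def pointwise)

lemma wedge_diff [simp]: "wedge e (c - d) = wedge e c - wedge e d"
  by (rule ext) (simp add: wedge_def pointwise right_diff_distrib)

lemma contract_diff [simp]: "contract e (c - d) = contract e c - contract e d"
  by (rule ext) (simp add: contract_def pointwise right_diff_distrib)

lemma wedge_zero [simp]: "wedge e 0 = 0"
  by (rule ext) (simp add: wedge_def pointwise)

lemma contract_zero [simp]: "contract e 0 = 0"
  by (rule ext) (simp add: contract_def pointwise)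

lemma wedge_scale [simp]: "wedge e (scale a c) = scale a (wedge e c)"
  by (rule ext) (simp add: wedge_def pointwise scale_def mult.left_commute)

lemma contract_scale [simp]: "contract e (scale a c) = scale a (contract e c)"
  by (rule ext) (simp add: contract_def pointwise scale_def mult.left_commute)

lemma wedge_sum [simp]: "wedge e (\<Sum>x\<in>A. c x) = (\<Sum>x\<in>A. wedge e (c x))"
  by (induction A rule: infinite_finite_induct) simp_all

lemma contract_sum [simp]: "contract e (\<Sum>x\<in>A. c x) = (\<Sum>x\<in>A. contract e (c x))"
  by (induction A rule: infinite_finite_induct) simp_all

lemma wedge_wedge_self [simp]: "wedge e (wedge e c) = 0"
  by (rule ext) (simp add: wedge_def pointwise)

lemma contract_contract_self [simp]: "contract e (contract e c) = 0"
  by (rule ext) (simp add: contract_def pointwise)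

lemma wedge_insert: "e \<notin> \<tau> \<Longrightarrow> wedge e c (insert e \<tau>) = sg e \<tau> * c \<tau>"
  and wedge_notin: "e \<notin> \<tau> \<Longrightarrow> wedge e c \<tau> = 0"
  by (simp_all add: wedge_def)

lemma contract_notin: "e \<notin> \<tau> \<Longrightarrow> contract e c \<tau> = sg e \<tau> * c (insert e \<tau>)"
  by (simp add: contract_def)

lemma wedge_anticommute:
  assumes "e \<in> E" "f \<in> E"
  shows "wedge e (wedge f c) = - wedge f (wedge e c)"
proof (cases "e = f")
  case False
  show ?thesis
  proof
    fix \<tau>
    show "wedge e (wedge f c) \<tau> = (- wedge f (wedge e c)) \<tau>"
    proof (cases "e \<in> \<tau> \<and> f \<in> \<tau>")
      case True
      define \<upsilon> where "\<upsilon> = \<tau> - {e, f}"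
      then have \<upsilon>: "\<tau> = insert e (insert f \<upsilon>)" "e \<notin> \<upsilon>" "f \<notin> \<upsilon>"
        using True by auto
      have "wedge e (wedge f c) \<tau> = sg e (insert f \<upsilon>) * (sg f \<upsilon> * c \<upsilon>)"
        using \<upsilon> False by (simp add: wedge_insert)
      moreover have "wedge f (wedge e c) \<tau> = sg f (insert e \<upsilon>) * (sg e \<upsilon> * c \<upsilon>)"
        unfolding \<upsilon>(1) insert_commute[of e f] using \<upsilon>(2,3) False by (simp add: wedge_insert)
      ultimately show ?thesis using \<upsilon> False assms
        by (cases e f rule: linorder_cases) (simp_all add: sg_insert pointwise mult.left_commute)
    qed (auto simp: wedge_def pointwise)
  qed
qed simp

lemma contract_anticommute:
  assumes "e \<in> E" "f \<in> E"
  shows "contract e (contract f c) = - contract f (contract e c)"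
proof (cases "e = f")
  case False
  show ?thesis
  proof
    fix \<tau>
    show "contract e (contract f c) \<tau> = (- contract f (contract e c)) \<tau>"
    proof (cases "e \<in> \<tau> \<or> f \<in> \<tau>")
      case notin: False
      have "contract e (contract f c) \<tau> = sg e \<tau> * (sg f (insert e \<tau>) * c (insert f (insert e \<tau>)))"
        using notin False by (simp add: contract_notin)
      moreover have "contract f (contract e c) \<tau> = sg f \<tau> * (sg e (insert f \<tau>) * c (insert f (insert e \<tau>)))"
        unfolding insert_commute[of f e] using notin False by (simp add: contract_notin)
      ultimately show ?thesis using notin False assms
        by (cases e f rule: linorder_cases) (simp_all add: sg_insert pointwise mult.left_commute)
    qed (auto simp: contract_def pointwise)
  qed
qed simp

text \<open>This and \<open>contract_wedge\<close> are the Clifford relations between exterior and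
  interior multiplication.\<close>

lemma contract_wedge_self: "contract e (wedge e c) = c - wedge e (contract e c)"
proof
  fix \<tau>
  show "contract e (wedge e c) \<tau> = (c - wedge e (contract e c)) \<tau>"
    by (cases "e \<in> \<tau>") (simp_all add: contract_def wedge_def pointwise insert_absorb)
qed

lemma contract_wedge:
  assumes "e \<in> E" "f \<in> E" "e \<noteq> f"
  shows "contract e (wedge f c) = - wedge f (contract e c)"
proof
  fix \<tau>
  show "contract e (wedge f c) \<tau> = (- wedge f (contract e c)) \<tau>"
  proof (cases "e \<notin> \<tau> \<and> f \<in> \<tau>")
    case True
    define \<upsilon> where "\<upsilon> = \<tau> - {f}"
    then have \<upsilon>: "\<tau> = insert f \<upsilon>" "f \<notin> \<upsilon>" "e \<notin> \<upsilon>"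
      using True by auto
    have "contract e (wedge f c) \<tau> = sg e (insert f \<upsilon>) * (sg f (insert e \<upsilon>) * c (insert e \<upsilon>))"
      using \<upsilon> assms(3) by (simp add: contract_notin insert_commute[of e f] wedge_insert)
    moreover have "wedge f (contract e c) \<tau> = sg f \<upsilon> * (sg e \<upsilon> * c (insert e \<upsilon>))"
      using \<upsilon> by (simp add: contract_notin wedge_insert)
    ultimately show ?thesis using \<upsilon> assms
      by (cases e f rule: linorder_cases) (simp_all add: sg_insert pointwise mult.left_commute)
  qed (use assms(3) in \<open>auto simp: contract_def wedge_def pointwise\<close>)
qed

lemma bd_add [simp]: "bd (c + d) = bd c + bd d"
  and bd_minus [simp]: "bd (- c) = - bd c"
  and bd_diff [simp]: "bd (c - d) = bd c - bd d"
  and bd_zero [simp]: "bd 0 = 0"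
  by (simp_all add: bd_def sum.distrib sum_negf sum_subtractf)

lemma scale_sum: "scale a (\<Sum>x\<in>A. c x) = (\<Sum>x\<in>A. scale a (c x))"
  by (rule ext) (simp add: scale_def sum_fun_apply sum_distrib_left)

lemma bd_scale [simp]: "bd (scale a c) = scale a (bd c)"
  by (simp add: bd_def scale_sum)

lemma bd_sum [simp]: "bd (\<Sum>x\<in>A. c x) = (\<Sum>x\<in>A. bd (c x))"
  by (induction A rule: infinite_finite_induct) simp_all

text \<open>The antiderivation rule, with the boundary of \<open>e\<close> equal to 1. For a cycle
  \<open>c\<close> it says that \<open>wedge e c\<close> is the cone over \<open>c\<close>, which is
  the source of every filling below.\<close>

lemma bd_wedge:
  assumes "e \<in> E"
  shows "bd (wedge e c) = c - wedge e (bd c)"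
proof -
  have "bd (wedge e c) = contract e (wedge e c) + (\<Sum>f\<in>E - {e}. contract f (wedge e c))"
    unfolding bd_def using assms finite_E by (simp add: sum.remove)
  also have "(\<Sum>f\<in>E - {e}. contract f (wedge e c)) = - wedge e (\<Sum>f\<in>E - {e}. contract f c)"
  proof -
    have "(\<Sum>f\<in>E - {e}. contract f (wedge e c)) = (\<Sum>f\<in>E - {e}. - wedge e (contract f c))"
      using assms by (intro sum.cong contract_wedge) auto
    then show ?thesis by (simp add: sum_negf)
  qed
  also have "(\<Sum>f\<in>E - {e}. contract f c) = bd c - contract e c"
    unfolding bd_def using assms finite_E by (simp add: sum_diff1)
  finally show ?thesis by (simp add: contract_wedge_self)
qed

text \<open>Contraction by an edge is the passage to its link; since it commutes with the boundary
  up to sign, it takes cycles to cycles.\<close>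

lemma bd_contract:
  assumes "e \<in> E"
  shows "bd (contract e c) = - contract e (bd c)"
proof -
  have "bd (contract e c) = (\<Sum>f\<in>E. - contract e (contract f c))"
    unfolding bd_def using assms by (intro sum.cong contract_anticommute) auto
  then show ?thesis by (simp add: bd_def sum_negf)
qed

end

section \<open>Chains of matchings\<close>

text \<open>
  Edges are represented by labels \<open>ed x y\<close>, so that chessboard complexes, whose edges are pairs of
  numbers, are literally subcomplexes of the matching complex of a complete graph.
\<close>

locale edge_labelling = exterior_algebra E for E :: "'e::linorder set" +
  fixes U :: "'v set" and ed :: "'v \<Rightarrow> 'v \<Rightarrow> 'e"
  assumes finite_U: "finite U"
    and ed_commute: "ed x y = ed y x"
    and ed_in_E: "x \<in> U \<Longrightarrow> y \<in> U \<Longrightarrow> x \<noteq> y \<Longrightarrow> ed x y \<in> E"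
    and ed_eqD: "\<lbrakk>ed x y = ed x' y'; x \<in> U; y \<in> U; x' \<in> U; y' \<in> U; x \<noteq> y; x' \<noteq> y'\<rbrakk>
      \<Longrightarrow> {x, y} = {x', y'}"

text \<open>Adjacency is kept apart from the labels: the complete graph and the board have the same
  \<open>E\<close>, \<open>bd\<close>, \<open>wedge\<close> and \<open>contract\<close>, and differ
  only in which sets count as faces.\<close>

locale matching_chains = edge_labelling E U ed
  for E :: "'e::linorder set" and U :: "'v set" and ed :: "'v \<Rightarrow> 'v \<Rightarrow> 'e" +
  fixes adj :: "'v \<Rightarrow> 'v \<Rightarrow> bool"
  assumes adj_sym: "adj x y \<Longrightarrow> adj y x"
    and adj_irrefl: "adj x y \<Longrightarrow> x \<noteq> y"
begin

text \<open>Parametrized by a vertex set, because links and sub-boards are again of this form; all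
  inductions run over vertex sets instead of pairs of sizes.\<close>

definition faces :: "'v set \<Rightarrow> 'e set set" where
  "faces V = {\<sigma>. (\<forall>e\<in>\<sigma>. \<exists>x\<in>V. \<exists>y\<in>V. adj x y \<and> e = ed x y) \<and>
    (\<forall>x\<in>V. \<forall>y\<in>V. \<forall>z\<in>V. adj x y \<longrightarrow> adj x z \<longrightarrow> ed x y \<in> \<sigma> \<longrightarrow> ed x z \<in> \<sigma> \<longrightarrow> y = z)}"

text \<open>The index \<open>k\<close> counts edges, so these are the chains of dimension \<open>k - 1\<close>.\<close>

definition chains :: "'v set \<Rightarrow> int \<Rightarrow> ('e set \<Rightarrow> 'k::comm_ring_1) set" where
  "chains V k = {c. \<forall>\<sigma>. c \<sigma> \<noteq> 0 \<longrightarrow> \<sigma> \<in> faces V \<and> int (card \<sigma>) = k}"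

definition cyc :: "'v set \<Rightarrow> int \<Rightarrow> ('e set \<Rightarrow> 'k::comm_ring_1) set" where
  "cyc V k = {c \<in> chains V k. bd c = 0}"

definition bnd :: "'v set \<Rightarrow> int \<Rightarrow> ('e set \<Rightarrow> 'k::comm_ring_1) set" where
  "bnd V k = bd ` chains V (k + 1)"

lemma facesI:
  assumes "\<And>e. e \<in> \<sigma> \<Longrightarrow> \<exists>x\<in>V. \<exists>y\<in>V. adj x y \<and> e = ed x y"
    and "\<And>x y z. \<lbrakk>x \<in> V; y \<in> V; z \<in> V; adj x y; adj x z; ed x y \<in> \<sigma>; ed x z \<in> \<sigma>\<rbrakk> \<Longrightarrow> y = z"
  shows "\<sigma> \<in> faces V"
  using assms unfolding faces_def by simp

lemma faces_edgeE:
  assumes "\<sigma> \<in> faces V" "e \<in> \<sigma>"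
  obtains x y where "x \<in> V" "y \<in> V" "adj x y" "e = ed x y"
  using assms unfolding faces_def by auto

lemma faces_unique:
  "\<lbrakk>\<sigma> \<in> faces V; x \<in> V; y \<in> V; z \<in> V; adj x y; adj x z; ed x y \<in> \<sigma>; ed x z \<in> \<sigma>\<rbrakk> \<Longrightarrow> y = z"
  unfolding faces_def by simp

lemma faces_subset_E:
  assumes "\<sigma> \<in> faces V" "V \<subseteq> U"
  shows "\<sigma> \<subseteq> E"
proof
  fix e assume "e \<in> \<sigma>"
  with assms(1) obtain x y where "x \<in> V" "y \<in> V" "adj x y" "e = ed x y"
    by (rule faces_edgeE)
  then show "e \<in> E" using assms(2) ed_in_E[of x y] adj_irrefl[of x y] by auto
qed

lemma faces_finite: "\<sigma> \<in> faces V \<Longrightarrow> V \<subseteq> U \<Longrightarrow> finite \<sigma>"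
  by (rule finite_subset[OF faces_subset_E finite_E])

lemma faces_subset:
  assumes "\<sigma> \<in> faces V" "\<tau> \<subseteq> \<sigma>"
  shows "\<tau> \<in> faces V"
proof (rule facesI)
  show "\<exists>x\<in>V. \<exists>y\<in>V. adj x y \<and> e = ed x y" if "e \<in> \<tau>" for e
    by (rule faces_edgeE[OF assms(1), of e]) (use that assms(2) in auto)
  show "y = z" if "x \<in> V" "y \<in> V" "z \<in> V" "adj x y" "adj x z" "ed x y \<in> \<tau>" "ed x z \<in> \<tau>" for x y z
    using faces_unique[OF assms(1) that(1-5)] that(6,7) assms(2) by auto
qed

lemma ed_face_ends:
  assumes "\<sigma> \<in> faces V" "V \<subseteq> U" "ed x y \<in> \<sigma>" "x \<in> U" "y \<in> U" "x \<noteq> y"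
  shows "x \<in> V" "y \<in> V" "adj x y"
proof -
  obtain u v where *: "u \<in> V" "v \<in> V" "adj u v" "ed x y = ed u v"
    using faces_edgeE[OF assms(1,3)] by blast
  have "{x, y} = {u, v}"
    by (rule ed_eqD[OF *(4)]) (use * assms(2-6) adj_irrefl[of u v] in auto)
  then show "x \<in> V" "y \<in> V" "adj x y"
    using * adj_sym[of u v] by (auto simp: doubleton_eq_iff)
qed

lemma faces_mono:
  assumes "\<sigma> \<in> faces W" "W \<subseteq> V" "V \<subseteq> U"
  shows "\<sigma> \<in> faces V"
proof (rule facesI)
  show "\<exists>x\<in>V. \<exists>y\<in>V. adj x y \<and> e = ed x y" if "e \<in> \<sigma>" for e
    by (rule faces_edgeE[OF assms(1) that]) (use assms(2) in auto)
  fix x y z assume that: "x \<in> V" "y \<in> V" "z \<in> V" "adj x y" "adj x z" "ed x y \<in> \<sigma>" "ed x z \<in> \<sigma>"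
  have U: "W \<subseteq> U" "x \<in> U" "y \<in> U" "z \<in> U" "x \<noteq> y" "x \<noteq> z"
    using that assms(2,3) adj_irrefl[of x y] adj_irrefl[of x z] by auto
  have "x \<in> W" "y \<in> W" "z \<in> W"
    using ed_face_ends[OF assms(1) U(1) that(6)] ed_face_ends[OF assms(1) U(1) that(7)] U by simp_all
  then show "y = z" using that(4-) by (rule faces_unique[OF assms(1)])
qed

text \<open>With \<open>faces_remove\<close>: the link of the edge \<open>xy\<close> is the matching
  complex on the other vertices. This is why the inductions close up.\<close>

lemma faces_insert:
  assumes "\<sigma> \<in> faces (V - {x, y})" "x \<in> V" "y \<in> V" "adj x y" "V \<subseteq> U"
  shows "insert (ed x y) \<sigma> \<in> faces V"
proof (rule facesI)
  show "\<exists>u\<in>V. \<exists>v\<in>V. adj u v \<and> e = ed u v" if "e \<in> insert (ed x y) \<sigma>" for e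
  proof (cases "e = ed x y")
    case False
    then have "e \<in> \<sigma>" using that by simp
    then show ?thesis by (rule faces_edgeE[OF assms(1)]) auto
  qed (use assms in auto)
  fix u v w assume uvw: "u \<in> V" "v \<in> V" "w \<in> V" "adj u v" "adj u w"
    "ed u v \<in> insert (ed x y) \<sigma>" "ed u w \<in> insert (ed x y) \<sigma>"
  have ends: "u \<noteq> x \<and> u \<noteq> y \<and> a \<noteq> x \<and> a \<noteq> y" if "ed u a \<in> \<sigma>" "a \<in> V" "adj u a" for a
  proof -
    have "u \<in> U" "a \<in> U" "u \<noteq> a" "V - {x, y} \<subseteq> U"
      using that uvw(1) assms(5) adj_irrefl[of u a] by auto
    then show ?thesis using ed_face_ends[OF assms(1) _ that(1)] by simp
  qed
  have eq: "{u, a} = {x, y}" if "ed u a = ed x y" "a \<in> V" "adj u a" for a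
    by (rule ed_eqD[OF that(1)])
      (use that uvw(1) assms(2-5) adj_irrefl[of u a] adj_irrefl[of x y] in auto)
  show "v = w"
  proof (cases "ed u v = ed x y")
    case True
    then have uv: "{u, v} = {x, y}" using eq[of v] uvw by simp
    then have "ed u w = ed x y" using ends[of w] uvw by (auto simp: doubleton_eq_iff)
    then have "{u, w} = {x, y}" using eq[of w] uvw by simp
    then show ?thesis using uv by (auto simp: doubleton_eq_iff)
  next
    case False
    then have 1: "ed u v \<in> \<sigma>" using uvw(6) by simp
    then have "u \<noteq> x \<and> u \<noteq> y" using ends[of v] uvw by simp
    then have "ed u w \<noteq> ed x y" using eq[of w] uvw by (auto simp: doubleton_eq_iff)
    then have 2: "ed u w \<in> \<sigma>" using uvw(7) by simp
    have "u \<in> V - {x, y}" "v \<in> V - {x, y}" "w \<in> V - {x, y}"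
      using ends[OF 1] ends[OF 2] uvw by auto
    then show ?thesis using uvw(4,5) 1 2 by (rule faces_unique[OF assms(1)])
  qed
qed

lemma faces_remove:
  assumes "insert (ed x y) \<sigma> \<in> faces V" "ed x y \<notin> \<sigma>" "x \<in> U" "y \<in> U" "x \<noteq> y" "V \<subseteq> U"
  shows "\<sigma> \<in> faces (V - {x, y})"
proof (rule facesI)
  have xy: "x \<in> V" "y \<in> V" "adj x y" "adj y x" "ed y x = ed x y"
    using ed_face_ends[OF assms(1,6), of x y] assms adj_sym ed_commute by auto
  have unique: "a = b" if "ed z a \<in> \<sigma>" "a \<in> V" "z \<in> V" "b \<in> V" "adj z a" "adj z b" "ed z b = ed x y"
    for a b z
    by (rule faces_unique[OF assms(1) that(3,2,4,5,6)]) (use that in auto)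
  show "\<exists>u\<in>V - {x, y}. \<exists>v\<in>V - {x, y}. adj u v \<and> e = ed u v" if e: "e \<in> \<sigma>" for e
  proof -
    obtain u v where uv: "u \<in> V" "v \<in> V" "adj u v" "e = ed u v"
      by (rule faces_edgeE[OF assms(1), of e]) (use e in auto)
    have ne: "ed u v \<noteq> ed x y" "ed u v \<in> \<sigma>" "ed v u \<in> \<sigma>" "adj v u" "ed v u \<noteq> ed x y"
      using e assms(2) uv(4) ed_commute[of u v] adj_sym[OF uv(3)] by auto
    have "u \<noteq> x" using unique[of x v y] uv(1-3) xy ne by auto
    moreover have "u \<noteq> y" using unique[of y v x] uv(1-3) xy ne by auto
    moreover have "v \<noteq> x" using unique[of x u y] uv(1-3) xy ne by auto
    moreover have "v \<noteq> y" using unique[of y u x] uv(1-3) xy ne by auto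
    ultimately show ?thesis using uv by auto
  qed
  show "v = w" if "u \<in> V - {x, y}" "v \<in> V - {x, y}" "w \<in> V - {x, y}" "adj u v" "adj u w"
    "ed u v \<in> \<sigma>" "ed u w \<in> \<sigma>" for u v w
    by (rule faces_unique[OF assms(1), of u]) (use that in auto)
qed

lemma faces_avoid:
  assumes "\<sigma> \<in> faces V" "\<And>a. a \<in> V \<Longrightarrow> adj p a \<Longrightarrow> ed p a \<notin> \<sigma>"
  shows "\<sigma> \<in> faces (V - {p})"
proof (rule facesI)
  show "\<exists>u\<in>V - {p}. \<exists>v\<in>V - {p}. adj u v \<and> e = ed u v" if e: "e \<in> \<sigma>" for e
  proof -
    obtain u v where uv: "u \<in> V" "v \<in> V" "adj u v" "e = ed u v"
      by (rule faces_edgeE[OF assms(1) e])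
    then have "u \<noteq> p" "v \<noteq> p"
      using assms(2)[of v] assms(2)[of u] e adj_sym[of u v] ed_commute[of u v] by auto
    then show ?thesis using uv by auto
  qed
  show "v = w" if "u \<in> V - {p}" "v \<in> V - {p}" "w \<in> V - {p}" "adj u v" "adj u w"
    "ed u v \<in> \<sigma>" "ed u w \<in> \<sigma>" for u v w
    by (rule faces_unique[OF assms(1), of u]) (use that in auto)
qed

lemma chainsI: "(\<And>\<sigma>. c \<sigma> \<noteq> 0 \<Longrightarrow> \<sigma> \<in> faces V \<and> int (card \<sigma>) = k) \<Longrightarrow> c \<in> chains V k"
  by (simp add: chains_def)

lemma chainsD: "c \<in> chains V k \<Longrightarrow> c \<sigma> \<noteq> 0 \<Longrightarrow> \<sigma> \<in> faces V \<and> int (card \<sigma>) = k"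
  by (simp add: chains_def)

lemma chains_zero [simp]: "0 \<in> chains V k"
  by (simp add: chains_def pointwise)

lemma chains_add [intro]:
  assumes "c \<in> chains V k" "d \<in> chains V k"
  shows "c + d \<in> chains V k"
proof (rule chainsI)
  fix \<sigma> assume "(c + d) \<sigma> \<noteq> 0"
  then have "c \<sigma> \<noteq> 0 \<or> d \<sigma> \<noteq> 0" by (auto simp: pointwise)
  then show "\<sigma> \<in> faces V \<and> int (card \<sigma>) = k" using assms by (auto dest: chainsD)
qed

lemma chains_minus [intro]: "c \<in> chains V k \<Longrightarrow> - c \<in> chains V k"
  unfolding chains_def by (simp add: pointwise)

lemma chains_diff [intro]: "c \<in> chains V k \<Longrightarrow> d \<in> chains V k \<Longrightarrow> c - d \<in> chains V k"
  using chains_add[of c V k "- d"] chains_minus[of d V k] by simp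

lemma chains_scale [intro]: "c \<in> chains V k \<Longrightarrow> scale a c \<in> chains V k"
  by (rule chainsI) (auto simp: scale_def dest!: chainsD[of c V k] split: if_splits)

lemma chains_sum [intro]: "(\<And>x. x \<in> A \<Longrightarrow> f x \<in> chains V k) \<Longrightarrow> (\<Sum>x\<in>A. f x) \<in> chains V k"
  by (induction A rule: infinite_finite_induct) auto

lemma chains_mono: "c \<in> chains W k \<Longrightarrow> W \<subseteq> V \<Longrightarrow> V \<subseteq> U \<Longrightarrow> c \<in> chains V k"
  unfolding chains_def using faces_mono by blast

lemma chains_neg: "k < 0 \<Longrightarrow> chains V k = {0}"
  by (fastforce simp: chains_def pointwise)

lemma contract_nonzeroD: "contract e c \<sigma> \<noteq> 0 \<Longrightarrow> e \<notin> \<sigma> \<and> c (insert e \<sigma>) \<noteq> 0"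
  by (auto simp: contract_def split: if_splits)

lemma wedge_nonzeroD: "wedge e c \<sigma> \<noteq> 0 \<Longrightarrow> e \<in> \<sigma> \<and> c (\<sigma> - {e}) \<noteq> 0"
  by (auto simp: wedge_def split: if_splits)

lemma contract_chains:
  assumes "c \<in> chains V k" "x \<in> U" "y \<in> U" "x \<noteq> y" "V \<subseteq> U"
  shows "contract (ed x y) c \<in> chains (V - {x, y}) (k - 1)"
proof (rule chainsI)
  fix \<sigma> assume "contract (ed x y) c \<sigma> \<noteq> 0"
  then have *: "ed x y \<notin> \<sigma>" "c (insert (ed x y) \<sigma>) \<noteq> 0" by (auto dest: contract_nonzeroD)
  then have **: "insert (ed x y) \<sigma> \<in> faces V" "int (card (insert (ed x y) \<sigma>)) = k"
    using chainsD[OF assms(1)] by blast+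
  then have "finite \<sigma>" using faces_finite[OF **(1) assms(5)] by simp
  then show "\<sigma> \<in> faces (V - {x, y}) \<and> int (card \<sigma>) = k - 1"
    using faces_remove[OF **(1) *(1) assms(2-5)] **(2) *(1) by auto
qed

lemma contract_eq_0:
  assumes "c \<in> chains V k" "x \<in> U" "y \<in> U" "x \<noteq> y" "V \<subseteq> U" "x \<notin> V \<or> y \<notin> V \<or> \<not> adj x y"
  shows "contract (ed x y) c = 0"
proof (rule ext, rule ccontr)
  fix \<sigma>
  assume "contract (ed x y) c \<sigma> \<noteq> 0 \<sigma>"
  then have "c (insert (ed x y) \<sigma>) \<noteq> 0" by (auto simp: pointwise dest: contract_nonzeroD)
  then have "insert (ed x y) \<sigma> \<in> faces V" using chainsD[OF assms(1)] by blast
  from ed_face_ends[OF this assms(5), of x y] show False using assms(2-6) by auto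
qed

lemma bd_chains:
  assumes "c \<in> chains V k" "V \<subseteq> U"
  shows "bd c \<in> chains V (k - 1)"
  unfolding bd_def
proof (intro chains_sum chainsI)
  fix e \<sigma> assume "contract e c \<sigma> \<noteq> 0"
  then have *: "e \<notin> \<sigma>" "c (insert e \<sigma>) \<noteq> 0" by (auto dest: contract_nonzeroD)
  then have **: "insert e \<sigma> \<in> faces V" "int (card (insert e \<sigma>)) = k"
    using chainsD[OF assms(1)] by blast+
  then have "finite \<sigma>" using faces_finite[OF **(1) assms(2)] by simp
  then show "\<sigma> \<in> faces V \<and> int (card \<sigma>) = k - 1"
    using faces_subset[OF **(1), of \<sigma>] **(2) *(1) by auto
qed

lemma wedge_chains:
  assumes "c \<in> chains (V - {x, y}) k" "x \<in> V" "y \<in> V" "adj x y" "V \<subseteq> U"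
  shows "wedge (ed x y) c \<in> chains V (k + 1)"
proof (rule chainsI)
  fix \<sigma> assume "wedge (ed x y) c \<sigma> \<noteq> 0"
  then have *: "ed x y \<in> \<sigma>" "c (\<sigma> - {ed x y}) \<noteq> 0" by (auto dest: wedge_nonzeroD)
  then have **: "\<sigma> - {ed x y} \<in> faces (V - {x, y})" "int (card (\<sigma> - {ed x y})) = k"
    using chainsD[OF assms(1)] by blast+
  have fin: "finite (\<sigma> - {ed x y})" using faces_finite[OF **(1)] assms(5) by auto
  have "card \<sigma> = Suc (card (\<sigma> - {ed x y}))"
    using fin *(1) card.remove[of \<sigma> "ed x y"] by simp
  then show "\<sigma> \<in> faces V \<and> int (card \<sigma>) = k + 1"
    using faces_insert[OF **(1) assms(2-5)] **(2) *(1) by (simp add: insert_absorb)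
qed

lemma wedge_contract_chains:
  assumes "c \<in> chains V k"
  shows "wedge e (contract e c) \<in> chains V k"
proof (rule chainsI)
  fix \<sigma> assume "wedge e (contract e c) \<sigma> \<noteq> 0"
  then have "e \<in> \<sigma>" "contract e c (\<sigma> - {e}) \<noteq> 0" by (auto dest: wedge_nonzeroD)
  then have "e \<in> \<sigma>" "c (insert e (\<sigma> - {e})) \<noteq> 0" using contract_nonzeroD by blast+
  then show "\<sigma> \<in> faces V \<and> int (card \<sigma>) = k"
    using chainsD[OF assms, of \<sigma>] by (simp add: insert_absorb)
qed

lemma chains_avoid:
  assumes "c \<in> chains V k" "\<And>a. a \<in> V \<Longrightarrow> adj p a \<Longrightarrow> contract (ed p a) c = 0"
  shows "c \<in> chains (V - {p}) k"
proof (rule chainsI)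
  fix \<sigma> assume nz: "c \<sigma> \<noteq> 0"
  have "\<sigma> \<in> faces (V - {p})"
  proof (rule faces_avoid)
    show "\<sigma> \<in> faces V" using chainsD[OF assms(1) nz] by simp
    fix a assume a: "a \<in> V" "adj p a"
    show "ed p a \<notin> \<sigma>"
    proof
      assume "ed p a \<in> \<sigma>"
      then have "contract (ed p a) c (\<sigma> - {ed p a}) = sg (ed p a) \<sigma> * c \<sigma>"
        by (simp add: contract_def insert_absorb)
      then have "sg (ed p a) \<sigma> * c \<sigma> = 0" using assms(2)[OF a] by (simp add: pointwise)
      then have "sg (ed p a) \<sigma> * (sg (ed p a) \<sigma> * c \<sigma>) = 0" by simp
      then show False using nz by simp
    qed
  qed
  then show "\<sigma> \<in> faces (V - {p}) \<and> int (card \<sigma>) = k" using chainsD[OF assms(1) nz] by simp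
qed

end

section \<open>Homology\<close>

context exterior_algebra
begin

text \<open>Induction over subsets \<open>F\<close> of \<open>E\<close>: the two mixed sums that a
  new element contributes cancel. Cancelling in the full double sum by symmetry would only give that
  it equals its own negative, which is too weak over a general ring.\<close>

lemma bd_bd [simp]: "bd (bd c) = 0"
proof -
  have "(\<Sum>e\<in>F. contract e (\<Sum>f\<in>F. contract f c)) = 0" if "F \<subseteq> E" for F
    using finite_subset[OF that finite_E] that
  proof (induction F)
    case (insert x F)
    have "(\<Sum>e\<in>F. contract e (contract x c)) = - contract x (\<Sum>f\<in>F. contract f c)"
    proof -
      have "(\<Sum>e\<in>F. contract e (contract x c)) = (\<Sum>e\<in>F. - contract x (contract e c))"
        using insert.prems by (intro sum.cong contract_anticommute) auto
      then show ?thesis by (simp add: sum_negf)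
    qed
    then show ?case using insert by (simp add: sum.distrib)
  qed simp
  then show ?thesis by (simp add: bd_def)
qed

end

context matching_chains
begin

lemma cycI: "c \<in> chains V k \<Longrightarrow> bd c = 0 \<Longrightarrow> c \<in> cyc V k"
  and cyc_chains: "c \<in> cyc V k \<Longrightarrow> c \<in> chains V k"
  and bd_cyc: "c \<in> cyc V k \<Longrightarrow> bd c = 0"
  by (simp_all add: cyc_def)

lemma cyc_zero [simp]: "0 \<in> cyc V k"
  by (simp add: cyc_def)

lemma cyc_add [intro]: "c \<in> cyc V k \<Longrightarrow> d \<in> cyc V k \<Longrightarrow> c + d \<in> cyc V k"
  by (auto simp: cyc_def)

lemma cyc_minus [intro]: "c \<in> cyc V k \<Longrightarrow> - c \<in> cyc V k"
  by (auto simp: cyc_def)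

lemma cyc_diff [intro]: "c \<in> cyc V k \<Longrightarrow> d \<in> cyc V k \<Longrightarrow> c - d \<in> cyc V k"
  by (auto simp: cyc_def)

lemma scale_zero [simp]: "scale a 0 = 0"
  by (simp add: scale_def fun_eq_iff pointwise)

lemma cyc_scale [intro]: "c \<in> cyc V k \<Longrightarrow> scale a c \<in> cyc V k"
  by (auto simp: cyc_def)

lemma cyc_sum [intro]: "(\<And>x. x \<in> A \<Longrightarrow> f x \<in> cyc V k) \<Longrightarrow> (\<Sum>x\<in>A. f x) \<in> cyc V k"
  by (induction A rule: infinite_finite_induct) auto

lemma cyc_mono: "c \<in> cyc W k \<Longrightarrow> W \<subseteq> V \<Longrightarrow> V \<subseteq> U \<Longrightarrow> c \<in> cyc V k"
  using chains_mono by (auto simp: cyc_def)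

lemma bndI: "c \<in> chains V (k + 1) \<Longrightarrow> bd c \<in> bnd V k"
  by (simp add: bnd_def)

lemma bndE:
  assumes "c \<in> bnd V k"
  obtains b where "b \<in> chains V (k + 1)" "c = bd b"
  using assms by (auto simp: bnd_def)

lemma bnd_zero [simp]: "0 \<in> bnd V k"
  using bndI[of 0 V k] by simp

lemma bnd_add [intro]: "c \<in> bnd V k \<Longrightarrow> d \<in> bnd V k \<Longrightarrow> c + d \<in> bnd V k"
  by (auto elim!: bndE simp flip: bd_add intro!: bndI)

lemma bnd_minus [intro]: "c \<in> bnd V k \<Longrightarrow> - c \<in> bnd V k"
  by (auto elim!: bndE simp flip: bd_minus intro!: bndI)

lemma bnd_diff [intro]: "c \<in> bnd V k \<Longrightarrow> d \<in> bnd V k \<Longrightarrow> c - d \<in> bnd V k"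
  by (auto elim!: bndE simp flip: bd_diff intro!: bndI)

lemma bnd_scale [intro]: "c \<in> bnd V k \<Longrightarrow> scale a c \<in> bnd V k"
  by (auto elim!: bndE simp flip: bd_scale intro!: bndI)

lemma bnd_sum [intro]: "(\<And>x. x \<in> A \<Longrightarrow> f x \<in> bnd V k) \<Longrightarrow> (\<Sum>x\<in>A. f x) \<in> bnd V k"
  by (induction A rule: infinite_finite_induct) auto

lemma bnd_mono: "c \<in> bnd W k \<Longrightarrow> W \<subseteq> V \<Longrightarrow> V \<subseteq> U \<Longrightarrow> c \<in> bnd V k"
  by (auto elim!: bndE intro!: bndI intro: chains_mono)

lemma bnd_cyc: "c \<in> bnd V k \<Longrightarrow> V \<subseteq> U \<Longrightarrow> c \<in> cyc V k"
  using bd_chains[of _ V "k + 1"] by (auto elim!: bndE intro!: cycI)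

lemma bnd_trans: "a - b \<in> bnd V k \<Longrightarrow> b - c \<in> bnd V k \<Longrightarrow> a - c \<in> bnd V k"
  using bnd_add[of "a - b" V k "b - c"] by simp

lemma bnd_sym: "a - b \<in> bnd V k \<Longrightarrow> b - a \<in> bnd V k"
  using bnd_minus[of "a - b" V k] by simp

section \<open>Decomposition of a chain at a vertex\<close>

lemma ed_distinct:
  "\<lbrakk>ed p a = ed p b; p \<in> U; a \<in> U; b \<in> U; p \<noteq> a; p \<noteq> b\<rbrakk> \<Longrightarrow> a = b"
  using ed_eqD[of p a p b] by (auto simp: doubleton_eq_iff)

lemma contract_cyc:
  assumes "c \<in> cyc V k" "x \<in> U" "y \<in> U" "x \<noteq> y" "V \<subseteq> U"
  shows "contract (ed x y) c \<in> cyc (V - {x, y}) (k - 1)"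
  using assms contract_chains[of c V k x y] by (auto simp: cyc_def bd_contract ed_in_E)

lemma bd_wedge_ed: "x \<in> U \<Longrightarrow> y \<in> U \<Longrightarrow> x \<noteq> y \<Longrightarrow> bd (wedge (ed x y) c) = c - wedge (ed x y) (bd c)"
  by (rule bd_wedge) (rule ed_in_E)

text \<open>Two edges at \<open>p\<close> never lie in a common matching, so contraction by one of
  them annihilates the terms of the others and the coefficients can be read off.\<close>

lemma contract_star:
  assumes "p \<in> V" "V \<subseteq> U" "b \<in> V" "adj p b"
    and X: "\<And>a. a \<in> V \<Longrightarrow> adj p a \<Longrightarrow> X a \<in> chains (V - {p, a}) j"
  shows "contract (ed p b) (\<Sum>a | a \<in> V \<and> adj p a. wedge (ed p a) (X a)) = X b"
proof -
  have U: "p \<in> U" "a \<in> U" "p \<noteq> a" if "a \<in> V" "adj p a" for a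
    using that assms(1,2) adj_irrefl[of p a] by auto
  have 0: "contract (ed p b) (X a) = 0" if "a \<in> V" "adj p a" for a
    by (rule contract_eq_0[OF X[OF that]]) (use U[OF that] U[OF assms(3,4)] assms(2) in auto)
  have "contract (ed p b) (wedge (ed p a) (X a)) = (if a = b then X b else 0)"
    if a: "a \<in> V" "adj p a" for a
  proof (cases "a = b")
    case True
    then show ?thesis using 0[OF assms(3,4)] by (simp add: contract_wedge_self)
  next
    case False
    then have "ed p b \<noteq> ed p a"
      using ed_distinct[of p b a] U[OF a] U[OF assms(3,4)] by auto
    then show ?thesis using False 0[OF a] U[OF a] U[OF assms(3,4)]
      by (simp add: contract_wedge ed_in_E)
  qed
  then have "contract (ed p b) (\<Sum>a | a \<in> V \<and> adj p a. wedge (ed p a) (X a))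
      = (\<Sum>a | a \<in> V \<and> adj p a. if a = b then X b else 0)"
    unfolding contract_sum by (intro sum.cong) auto
  also have "\<dots> = X b"
    using finite_subset[OF assms(2) finite_U] assms(3,4) by (simp add: sum.delta)
  finally show ?thesis .
qed

text \<open>A matching has at most one edge at \<open>p\<close>; splitting off the part with such an
  edge leaves a chain that avoids \<open>p\<close>.\<close>

lemma chains_minus_star:
  assumes "c \<in> chains V k" "p \<in> V" "V \<subseteq> U"
  shows "c - (\<Sum>a | a \<in> V \<and> adj p a. wedge (ed p a) (contract (ed p a) c)) \<in> chains (V - {p}) k"
proof (rule chains_avoid)
  show "c - (\<Sum>a | a \<in> V \<and> adj p a. wedge (ed p a) (contract (ed p a) c)) \<in> chains V k"
    using assms(1) by (intro chains_diff chains_sum wedge_contract_chains)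
  have "contract (ed p a) c \<in> chains (V - {p, a}) (k - 1)" if "a \<in> V" "adj p a" for a
    by (rule contract_chains[OF assms(1)]) (use that assms(2,3) adj_irrefl[of p a] in auto)
  then show "contract (ed p b) (c - (\<Sum>a | a \<in> V \<and> adj p a. wedge (ed p a) (contract (ed p a) c))) = 0"
    if "b \<in> V" "adj p b" for b
    using contract_star[OF assms(2,3) that, of "\<lambda>a. contract (ed p a) c" "k - 1"]
    by (simp only: contract_diff diff_self)
qed

text \<open>If \<open>w a\<close> fills the contraction of \<open>c\<close> by \<open>pa\<close>,
  then the boundary of the sum of all \<open>wedge (ed p a) (w a)\<close> cancels precisely the part
  of \<open>c\<close> that uses \<open>p\<close>.\<close>

lemma push_off:
  fixes c :: "'e set \<Rightarrow> 'k::comm_ring_1"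
  assumes V: "V \<subseteq> U" and p: "p \<in> V" and c: "c \<in> cyc V k"
    and exact: "\<And>a. a \<in> V \<Longrightarrow> adj p a
      \<Longrightarrow> cyc (V - {p, a}) (k - 1) \<subseteq> (bnd (V - {p, a}) (k - 1) :: ('e set \<Rightarrow> 'k) set)"
  obtains c' where "c' \<in> cyc (V - {p}) k" "c - c' \<in> bnd V k"
proof -
  have "\<exists>w. w \<in> chains (V - {p, a}) k \<and> bd w = contract (ed p a) c" if a: "a \<in> V" "adj p a" for a
  proof -
    have "contract (ed p a) c \<in> cyc (V - {p, a}) (k - 1)"
      by (rule contract_cyc[OF c]) (use a V p adj_irrefl[of p a] in auto)
    with exact[OF a] have "contract (ed p a) c \<in> bnd (V - {p, a}) (k - 1)" by blast
    then show ?thesis by (auto elim!: bndE)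
  qed
  then obtain w where w: "\<And>a. a \<in> V \<Longrightarrow> adj p a \<Longrightarrow> w a \<in> chains (V - {p, a}) k"
    "\<And>a. a \<in> V \<Longrightarrow> adj p a \<Longrightarrow> bd (w a) = contract (ed p a) c"
    by metis
  define b where "b = (\<Sum>a | a \<in> V \<and> adj p a. wedge (ed p a) (w a))"
  have b: "b \<in> chains V (k + 1)"
    unfolding b_def by (intro chains_sum wedge_chains) (use w V p in auto)
  have "bd b = (\<Sum>a | a \<in> V \<and> adj p a. w a - wedge (ed p a) (contract (ed p a) c))"
    unfolding b_def bd_sum
  proof (rule sum.cong)
    fix a assume a: "a \<in> {a. a \<in> V \<and> adj p a}"
    then show "bd (wedge (ed p a) (w a)) = w a - wedge (ed p a) (contract (ed p a) c)"
      using bd_wedge_ed[of p a "w a"] w(2)[of a] V p adj_irrefl[of p a] by auto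
  qed simp
  then have eq: "c + bd b = (c - (\<Sum>a | a \<in> V \<and> adj p a. wedge (ed p a) (contract (ed p a) c)))
      + (\<Sum>a | a \<in> V \<and> adj p a. w a)"
    by (simp add: sum_subtractf)
  have "(\<Sum>a | a \<in> V \<and> adj p a. w a) \<in> chains (V - {p}) k"
  proof (rule chains_sum)
    fix a assume "a \<in> {a. a \<in> V \<and> adj p a}"
    then show "w a \<in> chains (V - {p}) k" using chains_mono[OF w(1)[of a], of "V - {p}"] V by auto
  qed
  with chains_minus_star[OF cyc_chains[OF c] p V] have "c + bd b \<in> chains (V - {p}) k"
    unfolding eq by (rule chains_add)
  then have "c + bd b \<in> cyc (V - {p}) k"
    using bd_cyc[OF c] by (intro cycI) simp_all
  moreover have "c - (c + bd b) \<in> bnd V k"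
    using bnd_minus[OF bndI[OF b]] by simp
  ultimately show ?thesis by (rule that)
qed

lemma cone_bnd:
  assumes "z \<in> cyc (V - {p, q}) k" "p \<in> V" "q \<in> V" "adj p q" "V \<subseteq> U"
  shows "z \<in> bnd V k"
proof -
  have "bd (wedge (ed p q) z) = z"
    using bd_wedge_ed[of p q z] bd_cyc[OF assms(1)] assms adj_irrefl[of p q] by auto
  then show ?thesis using bndI[OF wedge_chains[OF cyc_chains[OF assms(1)] assms(2-5)]] by simp
qed

text \<open>Push a cycle off \<open>q\<close> and then off \<open>p\<close>; what is left is filled
  by the cone over the edge \<open>pq\<close>. The second round takes place without
  \<open>q\<close>, so its links lack three vertices, and this is the origin of the slope 3 in the
  connectivity bounds.\<close>

lemma exact_step:
  assumes V: "V \<subseteq> U" and pq: "p \<in> V" "q \<in> V" "adj p q"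
    and exact1: "\<And>a. a \<in> V \<Longrightarrow> adj q a
      \<Longrightarrow> cyc (V - {q, a}) (k - 1) \<subseteq> (bnd (V - {q, a}) (k - 1) :: ('e set \<Rightarrow> 'k::comm_ring_1) set)"
    and exact2: "\<And>b. b \<in> V - {q} \<Longrightarrow> adj p b
      \<Longrightarrow> cyc (V - {q} - {p, b}) (k - 1) \<subseteq> (bnd (V - {q} - {p, b}) (k - 1) :: ('e set \<Rightarrow> 'k) set)"
  shows "cyc V k \<subseteq> (bnd V k :: ('e set \<Rightarrow> 'k) set)"
proof
  fix c :: "'e set \<Rightarrow> 'k" assume c: "c \<in> cyc V k"
  obtain c' where c': "c' \<in> cyc (V - {q}) k" "c - c' \<in> bnd V k"
    by (rule push_off[OF V pq(2) c exact1])
  have Vq: "V - {q} \<subseteq> U" "p \<in> V - {q}" using V pq adj_irrefl[of p q] by auto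
  obtain c'' where c'': "c'' \<in> cyc (V - {q} - {p}) k" "c' - c'' \<in> bnd (V - {q}) k"
    by (rule push_off[OF Vq c'(1) exact2])
  have "V - {q} - {p} = V - {p, q}" by auto
  with c''(1) have "c'' \<in> bnd V k" using cone_bnd[OF _ pq V] by metis
  moreover have "c' - c'' \<in> bnd V k" using bnd_mono[OF c''(2)] V by auto
  ultimately have "(c - c') + ((c' - c'') + c'') \<in> bnd V k" using c'(2) by (intro bnd_add)
  then show "c \<in> bnd V k" by simp
qed

text \<open>Disjoint edges \<open>xy\<close> and \<open>uv\<close> span a segment of the complex;
  its join with \<open>z\<close> has the difference as boundary.\<close>

lemma disjoint_edges_homologous:
  assumes "z \<in> cyc (V - {x, y, u, v}) k" "{x, y, u, v} \<subseteq> V" "V \<subseteq> U" "adj x y" "adj u v"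
    "{x, y} \<inter> {u, v} = {}"
  shows "wedge (ed x y) z - wedge (ed u v) z \<in> bnd V (k + 1)"
proof -
  have ne: "x \<noteq> y" "u \<noteq> v" "x \<in> U" "y \<in> U" "u \<in> U" "v \<in> U"
    using assms adj_irrefl[of x y] adj_irrefl[of u v] by auto
  have eq: "V - {u, v} - {x, y} = V - {x, y, u, v}" by auto
  have "wedge (ed x y) z \<in> chains (V - {u, v}) (k + 1)"
    by (rule wedge_chains) (use assms cyc_chains[OF assms(1)] eq in auto)
  then have "wedge (ed u v) (wedge (ed x y) z) \<in> chains V (k + 1 + 1)"
    by (rule wedge_chains) (use assms in auto)
  moreover have "bd (wedge (ed u v) (wedge (ed x y) z)) = wedge (ed x y) z - wedge (ed u v) z"
    using ne bd_cyc[OF assms(1)] by (simp add: bd_wedge_ed)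
  ultimately show ?thesis using bndI by metis
qed

text \<open>
  The difference of the two edges of the path \<open>h p q\<close>, joined with \<open>z\<close>.
\<close>

definition cherry :: "'v \<Rightarrow> 'v \<Rightarrow> 'v \<Rightarrow> ('e set \<Rightarrow> 'k::comm_ring_1) \<Rightarrow> 'e set \<Rightarrow> 'k" where
  "cherry p h q z = wedge (ed p h) z - wedge (ed p q) z"

lemma cherry_zero [simp]: "cherry p h q 0 = 0"
  and cherry_add: "cherry p h q (z + z') = cherry p h q z + cherry p h q z'"
  and cherry_diff: "cherry p h q (z - z') = cherry p h q z - cherry p h q z'"
  and cherry_scale: "cherry p h q (scale a z) = scale a (cherry p h q z)"
  by (simp_all add: cherry_def) (simp add: scale_def fun_eq_iff pointwise right_diff_distrib)

lemma cherry_chains: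
  assumes "z \<in> chains (V - {p, h, q}) k" "p \<in> V" "h \<in> V" "q \<in> V" "adj p h" "adj p q" "V \<subseteq> U"
  shows "cherry p h q z \<in> chains V (k + 1)"
proof -
  have "z \<in> chains (V - {p, h}) k" "z \<in> chains (V - {p, q}) k"
    by (rule chains_mono[OF assms(1)]; use assms(7) in auto)+
  then show ?thesis unfolding cherry_def by (intro chains_diff wedge_chains) (use assms in auto)
qed

lemma bd_cherry:
  assumes "p \<in> U" "h \<in> U" "q \<in> U" "adj p h" "adj p q"
  shows "bd (cherry p h q z) = - cherry p h q (bd z)"
  using assms adj_irrefl[of p h] adj_irrefl[of p q] by (simp add: cherry_def bd_wedge_ed)

lemma cherry_cyc:
  assumes "z \<in> cyc (V - {p, h, q}) k" "p \<in> V" "h \<in> V" "q \<in> V" "adj p h" "adj p q" "V \<subseteq> U"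
  shows "cherry p h q z \<in> cyc V (k + 1)"
proof (rule cycI)
  show "cherry p h q z \<in> chains V (k + 1)" by (rule cherry_chains[OF cyc_chains[OF assms(1)] assms(2-)])
  show "bd (cherry p h q z) = 0"
    using bd_cherry[of p h q z] bd_cyc[OF assms(1)] assms by (auto simp: subset_iff)
qed

lemma cherry_bnd:
  assumes "z \<in> bnd (V - {p, h, q}) k" "p \<in> V" "h \<in> V" "q \<in> V" "adj p h" "adj p q" "V \<subseteq> U"
  shows "cherry p h q z \<in> bnd V (k + 1)"
proof -
  obtain w where w: "w \<in> chains (V - {p, h, q}) (k + 1)" "z = bd w"
    using assms(1) by (rule bndE)
  have "cherry p h q z = - bd (cherry p h q w)"
    using bd_cherry[of p h q w] w(2) assms by (auto simp: subset_iff)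
  then show ?thesis using bnd_minus[OF bndI[OF cherry_chains[OF w(1) assms(2-)]]] by simp
qed

text \<open>Write \<open>c\<close> as its star at \<open>p\<close> plus a rest \<open>r\<close>.
  Since \<open>c\<close> is a cycle, the boundary of \<open>r\<close> is minus the sum of the
  contractions of \<open>c\<close>, so the cone over \<open>r\<close> with the edge
  \<open>pq\<close> trades \<open>r\<close> for the \<open>pq\<close>-halves of the
  cherries.\<close>

lemma expand_off:
  assumes c: "c \<in> cyc (V - {q}) k" and V: "V \<subseteq> U" and pq: "p \<in> V" "q \<in> V" "adj p q"
  shows "c - (\<Sum>h | h \<in> V - {q} \<and> adj p h. cherry p h q (contract (ed p h) c)) \<in> bnd V k"
proof -
  define r where "r = c - (\<Sum>h | h \<in> V - {q} \<and> adj p h. wedge (ed p h) (contract (ed p h) c))"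
  define s where "s = (\<Sum>h | h \<in> V - {q} \<and> adj p h. contract (ed p h) c)"
  have ne: "p \<noteq> q" using adj_irrefl[OF pq(3)] .
  have "r \<in> chains (V - {q} - {p}) k"
    unfolding r_def by (rule chains_minus_star[OF cyc_chains[OF c]]) (use V pq ne in auto)
  moreover have "V - {q} - {p} = V - {p, q}" by auto
  ultimately have r: "wedge (ed p q) r \<in> chains V (k + 1)"
    using wedge_chains[of r V p q k] V pq by simp
  have "bd r = - s"
  proof -
    have "bd (\<Sum>h | h \<in> V - {q} \<and> adj p h. wedge (ed p h) (contract (ed p h) c)) = s"
      unfolding s_def bd_sum
    proof (rule sum.cong)
      fix h assume h: "h \<in> {h. h \<in> V - {q} \<and> adj p h}"
      then have U: "p \<in> U" "h \<in> U" "p \<noteq> h" using V pq adj_irrefl[of p h] by auto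
      then show "bd (wedge (ed p h) (contract (ed p h) c)) = contract (ed p h) c"
        using bd_cyc[OF c] by (simp add: bd_wedge_ed bd_contract ed_in_E)
    qed simp
    then show ?thesis unfolding r_def using bd_cyc[OF c] by simp
  qed
  then have "bd (wedge (ed p q) r) = r + wedge (ed p q) s"
    using bd_wedge_ed[of p q r] V pq ne by auto
  also have "\<dots> = c - (\<Sum>h | h \<in> V - {q} \<and> adj p h. cherry p h q (contract (ed p h) c))"
    unfolding r_def s_def cherry_def by (simp add: sum_subtractf)
  finally show ?thesis using bndI[OF r] by simp
qed

lemma expand:
  fixes c :: "'e set \<Rightarrow> 'k::comm_ring_1"
  assumes V: "V \<subseteq> U" and pq: "p \<in> V" "q \<in> V" "adj p q" and c: "c \<in> cyc V k"
    and exact: "\<And>a. a \<in> V \<Longrightarrow> adj q a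
      \<Longrightarrow> cyc (V - {q, a}) (k - 1) \<subseteq> (bnd (V - {q, a}) (k - 1) :: ('e set \<Rightarrow> 'k) set)"
  shows "\<exists>z. (\<forall>h. h \<in> V - {q} \<longrightarrow> adj p h \<longrightarrow> z h \<in> cyc (V - {p, h, q}) (k - 1)) \<and>
    c - (\<Sum>h | h \<in> V - {q} \<and> adj p h. cherry p h q (z h)) \<in> bnd V k"
proof -
  obtain c' where c': "c' \<in> cyc (V - {q}) k" "c - c' \<in> bnd V k"
    by (rule push_off[OF V pq(2) c exact])
  show ?thesis
  proof (intro exI conjI allI impI)
    fix h assume h: "h \<in> V - {q}" "adj p h"
    have "V - {q} - {p, h} = V - {p, h, q}" by auto
    then show "contract (ed p h) c' \<in> cyc (V - {p, h, q}) (k - 1)"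
      using contract_cyc[OF c'(1), of p h] h V pq adj_irrefl[of p h] by auto
  next
    show "c - (\<Sum>h | h \<in> V - {q} \<and> adj p h. cherry p h q (contract (ed p h) c')) \<in> bnd V k"
      by (rule bnd_trans[OF c'(2) expand_off[OF c'(1) V pq]])
  qed
qed

end

section \<open>Connectivity\<close>

text \<open>The unit of the exterior algebra, that is, the empty face in degree
  \<open>k = 0\<close>. Iterated joins of paths are built on it.\<close>

definition one_chain :: "'e set \<Rightarrow> 'k::comm_ring_1" where
  "one_chain \<sigma> = (if \<sigma> = {} then 1 else 0)"

lemma (in exterior_algebra) bd_one_chain [simp]: "bd one_chain = 0"
  by (simp add: bd_def contract_def one_chain_def fun_eq_iff pointwise sum_fun_apply cong: if_cong)

context matching_chains
begin

lemma faces_empty: "{} \<in> faces V"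
  by (simp add: faces_def)

lemma one_cyc: "one_chain \<in> cyc V 0"
proof (rule cycI)
  show "one_chain \<in> chains V 0"
    by (rule chainsI) (simp add: one_chain_def faces_empty split: if_splits)
qed simp

lemma chains_0_eq:
  assumes "c \<in> chains V 0" "V \<subseteq> U"
  shows "c = scale (c {}) one_chain"
proof
  fix \<sigma>
  show "c \<sigma> = scale (c {}) one_chain \<sigma>"
  proof (cases "c \<sigma> = 0 \<or> \<sigma> = {}")
    case False
    then have "\<sigma> \<in> faces V" "card \<sigma> = 0" using chainsD[OF assms(1), of \<sigma>] by auto
    then show ?thesis using faces_finite[OF _ assms(2), of \<sigma>] False by auto
  qed (auto simp: scale_def one_chain_def)
qed

lemma cyc_neg: "c \<in> cyc V k \<Longrightarrow> k < 0 \<Longrightarrow> c = 0"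
  using chains_neg cyc_chains by blast

lemma exact_neg: "k < 0 \<Longrightarrow> cyc V k \<subseteq> bnd V k"
  by (auto dest: cyc_neg)

lemma chains_no_edges:
  assumes "c \<in> chains V k" "0 < k" "\<And>x y. x \<in> V \<Longrightarrow> y \<in> V \<Longrightarrow> \<not> adj x y"
  shows "c = 0"
proof (rule ccontr)
  assume "c \<noteq> 0"
  then obtain \<sigma> where "c \<sigma> \<noteq> 0" by (auto simp: fun_eq_iff pointwise)
  then have \<sigma>: "\<sigma> \<in> faces V" "int (card \<sigma>) = k" using chainsD[OF assms(1)] by auto
  then have "\<sigma> \<noteq> {}" using assms(2) by auto
  then obtain e where "e \<in> \<sigma>" by auto
  then show False using faces_edgeE[OF \<sigma>(1)] assms(3) by blast
qed

lemma cherry_sum: "cherry p h q (\<Sum>x\<in>A. z x) = (\<Sum>x\<in>A. cherry p h q (z x))"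
  by (simp add: cherry_def sum_subtractf)

lemma cherry_swap: "cherry p q h z = - cherry p h q z"
  by (simp add: cherry_def)

text \<open>The paths \<open>h - p - q\<close> and \<open>p - q - a\<close> share the edge
  \<open>pq\<close>, and the remaining edges \<open>ph\<close> and \<open>qa\<close> are disjoint.
  The centre of a path can thus be moved once \<open>z\<close> avoids \<open>a\<close>.\<close>

lemma cherry_switch:
  assumes "z \<in> cyc (V - {p, h, q, a}) k" "{p, h, q, a} \<subseteq> V" "V \<subseteq> U"
    "adj p h" "adj q a" "{p, h} \<inter> {q, a} = {}"
  shows "cherry p h q z - cherry q a p z \<in> bnd V (k + 1)"
  using disjoint_edges_homologous[OF assms] by (simp add: cherry_def ed_commute[of q p])

end

locale complete_matchings = matching_chains E U ed "(\<noteq>)"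
  for E :: "'e::linorder set" and U :: "'v set" and ed :: "'v \<Rightarrow> 'v \<Rightarrow> 'e"
begin

text \<open>The links in \<open>exact_step\<close> lose two or three vertices while \<open>k\<close>
  drops by one, so three vertices per degree suffice.\<close>

theorem exact_complete:
  assumes "V \<subseteq> U" "3 * k + 2 \<le> int (card V)"
  shows "cyc V k \<subseteq> (bnd V k :: ('e set \<Rightarrow> 'k::comm_ring_1) set)"
  using assms
\<comment> \<open>The shift by one puts negative \<open>k\<close>, where there are no chains, into
  the base case; \<open>k = 0\<close> is already an instance of the general step.\<close>
proof (induction "nat (k + 1)" arbitrary: k V)
  case 0
  then show ?case by (intro exact_neg) simp
next
  case (Suc n)
  then have k: "k \<ge> 0" "n = nat (k - 1 + 1)" by auto
  have finV: "finite V" using Suc.prems(1) finite_U finite_subset by blast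
  have "card V \<ge> 2" using Suc.prems(2) k by linarith
  then obtain p q where pq: "p \<in> V" "q \<in> V" "p \<noteq> q"
    using card_le_Suc0_iff_eq[OF finV] by fastforce
  show ?case
  proof (rule exact_step[OF Suc.prems(1) pq])
    fix a assume "a \<in> V" "q \<noteq> a"
    then have "card (V - {q, a}) = card V - 2" using pq finV by (simp add: card_Diff_subset)
    then show "cyc (V - {q, a}) (k - 1) \<subseteq> (bnd (V - {q, a}) (k - 1) :: ('e set \<Rightarrow> 'k) set)"
      using Suc.prems by (intro Suc.hyps(1) k) auto
  next
    fix b assume b: "b \<in> V - {q}" "p \<noteq> b"
    have "V - {q} - {p, b} = V - {q, p, b}" by auto
    moreover have "card (V - {q, p, b}) = card V - 3"
      using b pq finV by (auto simp: card_Diff_subset)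
    ultimately show "cyc (V - {q} - {p, b}) (k - 1)
        \<subseteq> (bnd (V - {q} - {p, b}) (k - 1) :: ('e set \<Rightarrow> 'k) set)"
      using Suc.prems by (intro Suc.hyps(1) k) auto
  qed
qed

end

locale bipartite_matchings = matching_chains E U ed "\<lambda>x y. P x = (\<not> P y)"
  for E :: "'e::linorder set" and U :: "'v set" and ed :: "'v \<Rightarrow> 'v \<Rightarrow> 'e" and P :: "'v \<Rightarrow> bool"
begin

text \<open>The side is an argument, so that proofs can treat sides \<open>s\<close> and
  \<open>\<not> s\<close> and decide by size which of them is the side of the rows.\<close>

definition cnt :: "bool \<Rightarrow> 'v set \<Rightarrow> int" where
  "cnt s V = int (card {x \<in> V. P x = s})"

lemma cnt_Diff:
  assumes "X \<subseteq> V" "V \<subseteq> U"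
  shows "cnt s (V - X) = cnt s V - cnt s X"
proof -
  have fin: "finite {y \<in> X. P y = s}" "finite {y \<in> V. P y = s}"
    using finite_subset[OF assms(2) finite_U] finite_subset[OF assms(1)] by auto
  have "{y \<in> V - X. P y = s} = {y \<in> V. P y = s} - {y \<in> X. P y = s}" by auto
  moreover have "card {y \<in> X. P y = s} \<le> card {y \<in> V. P y = s}"
    using assms(1) fin by (intro card_mono) auto
  moreover have "{y \<in> X. P y = s} \<subseteq> {y \<in> V. P y = s}" using assms(1) by auto
  ultimately show ?thesis
    using card_Diff_subset[OF fin(1), of "{y \<in> V. P y = s}"] by (simp add: cnt_def of_nat_diff)
qed

lemma cnt_empty [simp]: "cnt s {} = 0"
  by (simp add: cnt_def)

lemma cnt_insert [simp]:
  assumes "finite X" "x \<notin> X"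
  shows "cnt s (insert x X) = cnt s X + (if P x = s then 1 else 0)"
proof -
  have "{y \<in> insert x X. P y = s} = (if P x = s then insert x {y \<in> X. P y = s} else {y \<in> X. P y = s})"
    by auto
  then show ?thesis using assms by (simp add: cnt_def)
qed

lemma cnt_pos_ex: "0 < cnt s V \<Longrightarrow> \<exists>x\<in>V. P x = s"
  unfolding cnt_def by (metis (mono_tags, lifting) card_eq_0_iff empty_Collect_eq less_irrefl of_nat_0)

theorem exact_bipartite:
  assumes "V \<subseteq> U" "k + 1 \<le> cnt True V" "k + 1 \<le> cnt False V" "3 * k + 2 \<le> cnt True V + cnt False V"
  shows "cyc V k \<subseteq> (bnd V k :: ('e set \<Rightarrow> 'k::comm_ring_1) set)"
  using assms
proof (induction "nat (k + 1)" arbitrary: k V)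
  case 0
  then show ?case by (intro exact_neg) simp
next
  case (Suc n)
  then have k: "k \<ge> 0" "n = nat (k - 1 + 1)" by auto
  \<comment> \<open>The second round of \<open>exact_step\<close> deletes \<open>q\<close> and
    \<open>b\<close> from the side \<open>\<not> s\<close>, which must be able to lose two vertices.
    For \<open>k \<ge> 1\<close> one side is large enough: otherwise the total would be at most 2 k
    + 2, less than 3 k + 2.\<close>
  obtain s where s: "k \<ge> 1 \<Longrightarrow> k + 2 \<le> cnt (\<not> s) V"
  proof (cases "k \<ge> 1 \<longrightarrow> k + 2 \<le> cnt False V")
    case True
    then show ?thesis by (intro that[of True]) simp
  next
    case False
    then show ?thesis using Suc.prems by (intro that[of False]) simp
  qed
  have sizes: "k + 1 \<le> cnt s V" "k + 1 \<le> cnt (\<not> s) V" "3 * k + 2 \<le> cnt s V + cnt (\<not> s) V"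
    using Suc.prems by (cases s; simp)+
  obtain p q where pq: "p \<in> V" "P p = s" "q \<in> V" "P q = (\<not> s)"
    using cnt_pos_ex[of s V] cnt_pos_ex[of "\<not> s" V] sizes k by auto
  have IH: "cyc W (k - 1) \<subseteq> (bnd W (k - 1) :: ('e set \<Rightarrow> 'k) set)"
    if "W \<subseteq> U" "k \<le> cnt s W" "k \<le> cnt (\<not> s) W" "3 * k - 1 \<le> cnt s W + cnt (\<not> s) W" for W
    by (rule Suc.hyps(1)[OF k(2) that(1)]) (use that in \<open>cases s; simp\<close>)+
  show ?case
  proof (rule exact_step[OF Suc.prems(1) pq(1,3)])
    show "P p = (\<not> P q)" using pq by simp
    fix a assume a: "a \<in> V" "P q = (\<not> P a)"
    then have "q \<noteq> a" "{q, a} \<subseteq> V" using pq by auto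
    then have "cnt t (V - {q, a}) = cnt t V - 1" for t
      using a by (simp add: cnt_Diff[OF _ Suc.prems(1)])
    then show "cyc (V - {q, a}) (k - 1) \<subseteq> (bnd (V - {q, a}) (k - 1) :: ('e set \<Rightarrow> 'k) set)"
      using Suc.prems sizes by (intro IH) auto
  next
    fix b assume b: "b \<in> V - {q}" "P p = (\<not> P b)"
    show "cyc (V - {q} - {p, b}) (k - 1) \<subseteq> (bnd (V - {q} - {p, b}) (k - 1) :: ('e set \<Rightarrow> 'k) set)"
    proof (cases "k = 0")
      case True
      then show ?thesis by (intro exact_neg) simp
    next
      case False
      have *: "V - {q} - {p, b} = V - {q, p, b}" "q \<noteq> p" "q \<noteq> b" "p \<noteq> b" "{q, p, b} \<subseteq> V"
        using b pq by auto
      have "cnt t (V - {q} - {p, b}) = cnt t V - (if t = s then 1 else 2)" for t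
        unfolding *(1) using * b pq by (simp add: cnt_Diff[OF _ Suc.prems(1)])
      then show ?thesis using Suc.prems sizes s False k by (intro IH) auto
    qed
  qed
qed

end

section \<open>Upper bound\<close>

context bipartite_matchings
begin

text \<open>Choose a second vertex \<open>a\<close> on the side of \<open>p\<close>. The path
  \<open>h - p - q\<close> is switched to \<open>p - q - a\<close>, and that one to
  \<open>b - p - q\<close>. Each switch needs a factor that avoids the new end, which is why
  \<open>z\<close> is pushed off \<open>a\<close> and afterwards off \<open>b\<close>.\<close>

lemma cherry_move:
  fixes z :: "'e set \<Rightarrow> 'k::comm_ring_1"
  assumes V: "V \<subseteq> U" and pq: "{p, h, b, q} \<subseteq> V" "P p = s" "P h = (\<not> s)" "P b = (\<not> s)" "P q = (\<not> s)"
    "h \<noteq> q" "b \<noteq> q"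
    and z: "z \<in> cyc (V - {p, h, q}) (k - 1)"
    and sizes: "k + 2 \<le> cnt s V" "k + 2 \<le> cnt (\<not> s) V" "3 * k + 1 \<le> cnt s V + cnt (\<not> s) V"
    and k: "0 \<le> k"
  obtains z' where "z' \<in> cyc (V - {p, b, q}) (k - 1)" "cherry p h q z - cherry p b q z' \<in> bnd V k"
proof -
  have exact: "cyc W (k - 2) \<subseteq> (bnd W (k - 2) :: ('e set \<Rightarrow> 'k) set)"
    if "W \<subseteq> U" "k - 1 \<le> cnt s W" "k - 1 \<le> cnt (\<not> s) W" "3 * k - 4 \<le> cnt s W + cnt (\<not> s) W" for W
    by (rule exact_bipartite[OF that(1)]) (use that in \<open>cases s; simp\<close>)+
  have ne: "p \<noteq> h" "p \<noteq> b" "p \<noteq> q" using pq by auto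
  have "0 < cnt s (V - {p})" using cnt_Diff[OF _ V, of "{p}" s] pq sizes k by simp
  then obtain a where a: "a \<in> V" "a \<noteq> p" "P a = s" using cnt_pos_ex by blast
  then have ne': "a \<noteq> h" "a \<noteq> b" "a \<noteq> q" using pq by auto
  have sz1: "cnt t (V - {p, h, q}) = cnt t V - (if t = s then 1 else 2)" for t
    using pq ne by (simp add: cnt_Diff[OF _ V])
  have sz2: "cnt t (V - {q, a, p}) = cnt t V - (if t = s then 2 else 1)" for t
    using pq ne ne' a by (simp add: cnt_Diff[OF _ V])
  have sz: "cnt t (W - {x, y}) = cnt t W - 1" if "W \<subseteq> U" "x \<in> W" "y \<in> W" "P x = (\<not> P y)" for W x y t
  proof -
    have "x \<noteq> y" using that(4) by auto
    then show ?thesis using that by (simp add: cnt_Diff)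
  qed
  have k2: "k - 1 - 1 = k - 2" by simp
  have sub: "V - {p, h, q} \<subseteq> U" "V - {q, a, p} \<subseteq> U" using V by auto
  obtain z1 where z1: "z1 \<in> cyc (V - {p, h, q} - {a}) (k - 1)" "z - z1 \<in> bnd (V - {p, h, q}) (k - 1)"
  proof (rule push_off[OF sub(1) _ z])
    show "a \<in> V - {p, h, q}" using a pq by auto
    fix x assume x: "x \<in> V - {p, h, q}" "P a = (\<not> P x)"
    show "cyc (V - {p, h, q} - {a, x}) (k - 1 - 1)
        \<subseteq> (bnd (V - {p, h, q} - {a, x}) (k - 1 - 1) :: ('e set \<Rightarrow> 'k) set)"
      unfolding k2 using sz[of "V - {p, h, q}" a x] sz1 x a ne ne' pq sizes sub by (intro exact) auto
  qed
  have z1': "z1 \<in> cyc (V - {q, a, p}) (k - 1)" "z1 \<in> cyc (V - {p, h, q, a}) (k - 1)"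
    by (rule cyc_mono[OF z1(1)]; use V in auto)+
  obtain z2 where z2: "z2 \<in> cyc (V - {q, a, p} - {b}) (k - 1)" "z1 - z2 \<in> bnd (V - {q, a, p}) (k - 1)"
  proof (rule push_off[OF sub(2) _ z1'(1)])
    show "b \<in> V - {q, a, p}" using a pq by auto
    fix x assume x: "x \<in> V - {q, a, p}" "P b = (\<not> P x)"
    show "cyc (V - {q, a, p} - {b, x}) (k - 1 - 1)
        \<subseteq> (bnd (V - {q, a, p} - {b, x}) (k - 1 - 1) :: ('e set \<Rightarrow> 'k) set)"
      unfolding k2 using sz[of "V - {q, a, p}" b x] sz2 x a ne ne' pq sizes sub by (intro exact) auto
  qed
  have z2': "z2 \<in> cyc (V - {p, b, q}) (k - 1)" "z2 \<in> cyc (V - {p, b, q, a}) (k - 1)"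
    by (rule cyc_mono[OF z2(1)]; use V in auto)+
  have "cherry p h q z - cherry p h q z1 \<in> bnd V (k - 1 + 1)"
    unfolding cherry_diff[symmetric] by (rule cherry_bnd[OF z1(2)]) (use V pq in auto)
  moreover have "cherry p h q z1 - cherry q a p z1 \<in> bnd V (k - 1 + 1)"
    by (rule cherry_switch[OF z1'(2)]) (use V pq a in auto)
  moreover have "cherry q a p z1 - cherry q a p z2 \<in> bnd V (k - 1 + 1)"
    unfolding cherry_diff[symmetric] by (rule cherry_bnd[OF z2(2)]) (use V pq a in auto)
  moreover have "cherry q a p z2 - cherry p b q z2 \<in> bnd V (k - 1 + 1)"
    by (rule bnd_sym, rule cherry_switch[OF z2'(2)]) (use V pq a in auto)
  ultimately have "cherry p h q z - cherry p b q z2 \<in> bnd V (k - 1 + 1)"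
    by (rule bnd_trans[OF bnd_trans[OF bnd_trans]])
  then show ?thesis using that[OF z2'(1)] by simp
qed

text \<open>Expansion at \<open>p\<close> gives one path for every neighbour \<open>h\<close>;
  moving all of them to the same \<open>b\<close> merges the sum into a single join.\<close>

lemma cherry_generates:
  fixes c :: "'e set \<Rightarrow> 'k::comm_ring_1"
  assumes V: "V \<subseteq> U" and pq: "{p, b, q} \<subseteq> V" "P p = s" "P b = (\<not> s)" "P q = (\<not> s)" "b \<noteq> q"
    and c: "c \<in> cyc V k"
    and sizes: "k + 2 \<le> cnt s V" "k + 2 \<le> cnt (\<not> s) V" "3 * k + 1 \<le> cnt s V + cnt (\<not> s) V"
    and k: "0 \<le> k"
  obtains z where "z \<in> cyc (V - {p, b, q}) (k - 1)" "c - cherry p b q z \<in> bnd V k"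
proof -
  have exact: "cyc (V - {q, a}) (k - 1) \<subseteq> (bnd (V - {q, a}) (k - 1) :: ('e set \<Rightarrow> 'k) set)"
    if a: "a \<in> V" "P q = (\<not> P a)" for a
  proof -
    have "q \<noteq> a" "{q, a} \<subseteq> V" using a pq by auto
    then have "cnt t (V - {q, a}) = cnt t V - 1" for t
      using a by (simp add: cnt_Diff[OF _ V])
    then show ?thesis using sizes V by (intro exact_bipartite) (cases s; force)+
  qed
  have pq': "p \<in> V" "q \<in> V" "P p = (\<not> P q)" using pq by auto
  obtain z where z: "\<And>h. h \<in> V - {q} \<Longrightarrow> P p = (\<not> P h) \<Longrightarrow> z h \<in> cyc (V - {p, h, q}) (k - 1)"
    "c - (\<Sum>h | h \<in> V - {q} \<and> P p = (\<not> P h). cherry p h q (z h)) \<in> bnd V k"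
    using expand[OF V pq' c exact] by blast
  have "\<exists>z'. z' \<in> cyc (V - {p, b, q}) (k - 1) \<and> cherry p h q (z h) - cherry p b q z' \<in> bnd V k"
    if h: "h \<in> V - {q}" "P p = (\<not> P h)" for h
    by (rule cherry_move[OF V _ _ _ _ _ _ _ z(1)[OF h] sizes k, of b]) (use pq h in auto)
  then obtain z' where z': "\<And>h. h \<in> V - {q} \<Longrightarrow> P p = (\<not> P h) \<Longrightarrow> z' h \<in> cyc (V - {p, b, q}) (k - 1)"
    "\<And>h. h \<in> V - {q} \<Longrightarrow> P p = (\<not> P h) \<Longrightarrow> cherry p h q (z h) - cherry p b q (z' h) \<in> bnd V k"
    by metis
  let ?N = "{h. h \<in> V - {q} \<and> P p = (\<not> P h)}"
  show ?thesis
  proof (rule that)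
    show "(\<Sum>h\<in>?N. z' h) \<in> cyc (V - {p, b, q}) (k - 1)" using z'(1) by (intro cyc_sum) auto
    have "(\<Sum>h\<in>?N. cherry p h q (z h)) - cherry p b q (\<Sum>h\<in>?N. z' h) \<in> bnd V k"
      unfolding cherry_sum sum_subtractf[symmetric] using z'(2) by (intro bnd_sum) auto
    then show "c - cherry p b q (\<Sum>h\<in>?N. z' h) \<in> bnd V k" by (rule bnd_trans[OF z(2)])
  qed
qed

end

lemma scale_add_left: "scale (a + b) c = scale a c + scale b c"
  and scale_diff_left: "scale (a - b) c = scale a c - scale b c"
  and scale_add_right: "scale a (c + d) = scale a c + scale a d"
  and scale_diff_right: "scale a (c - d) = scale a c - scale a d"
  and scale_minus_left: "scale (- a) c = - scale a c"
  and scale_minus_right: "scale a (- c) = - scale a c"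
  by (simp_all add: scale_def fun_eq_iff pointwise distrib_left distrib_right left_diff_distrib right_diff_distrib)

context bipartite_matchings
begin

text \<open>The edges at \<open>x\<close> exclude each other, so the complex consists of three
  isolated points, and its reduced 0-cycles are spanned by differences with the point
  \<open>xl\<close>.\<close>

lemma cyc_star:
  assumes W: "{x, i, j, l} \<subseteq> U" "P x \<noteq> P i" "P i = P j" "P i = P l" "distinct [i, j, l]"
    and z: "z \<in> cyc {x, i, j, l} 1"
  shows "\<exists>\<alpha> \<beta>. z = scale \<alpha> (cherry x i l one_chain) + scale \<beta> (cherry x j l one_chain)"
proof -
  let ?W = "{x, i, j, l}"
  have ne: "x \<noteq> i" "x \<noteq> j" "x \<noteq> l" using W by auto
  have N: "{a. a \<in> ?W \<and> P x = (\<not> P a)} = {i, j, l}" using W by auto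
  define u where "u a = contract (ed x a) z" for a
  have "z - (\<Sum>a\<in>{i, j, l}. wedge (ed x a) (u a)) \<in> chains (?W - {x}) 1"
    using chains_minus_star[OF cyc_chains[OF z], of x] W(1) unfolding N u_def by auto
  then have "z - (\<Sum>a\<in>{i, j, l}. wedge (ed x a) (u a)) = 0"
    by (rule chains_no_edges) (use W in auto)
  then have z_eq: "z = (\<Sum>a\<in>{i, j, l}. wedge (ed x a) (u a))" by simp
  have "u a \<in> chains (?W - {x, a}) (1 - 1)" if "a \<in> {i, j, l}" for a
    unfolding u_def by (rule contract_chains[OF cyc_chains[OF z]]) (use that W ne in auto)
  then have u: "u a = scale (u a {}) one_chain" if "a \<in> {i, j, l}" for a
    using chains_0_eq[of "u a" "?W - {x, a}"] that W(1) by auto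
  have eq: "z = scale (u i {}) (wedge (ed x i) one_chain) + scale (u j {}) (wedge (ed x j) one_chain)
      + scale (u l {}) (wedge (ed x l) one_chain)"
    unfolding z_eq using u[of i] u[of j] u[of l] W(5) wedge_scale
    by (simp add: add.assoc) (metis wedge_scale)
  have "bd z = scale (u i {} + u j {} + u l {}) one_chain"
    unfolding eq using W(1) ne by (simp add: bd_wedge_ed scale_add_left)
  then have "u i {} + u j {} + u l {} = 0"
    using bd_cyc[OF z] by (simp add: scale_def one_chain_def fun_eq_iff pointwise split: if_splits)
  then have "u l {} = - u i {} - u j {}" by (simp add: algebra_simps add_eq_0_iff)
  then have "z = scale (u i {}) (cherry x i l one_chain) + scale (u j {}) (cherry x j l one_chain)"
    unfolding eq cherry_def by (simp add: scale_diff_left scale_diff_right scale_minus_left)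
  then show ?thesis by blast
qed

lemma cherry_one_cyc:
  assumes "{x, i, j} \<subseteq> V" "V \<subseteq> U" "P x \<noteq> P i" "P x \<noteq> P j"
  shows "cherry x i j one_chain \<in> cyc V 1"
  using cherry_cyc[OF one_cyc, of x V i j] assms by auto

text \<open>The spare row \<open>l\<close> lets the path on row \<open>r\<close> be recentred at the
  column \<open>u\<close>, which sets both \<open>x\<close> and \<open>y\<close> free. On the 2 by 2
  board with rows \<open>i\<close>, \<open>j\<close> and columns \<open>x\<close>, \<open>y\<close>,
  the sum \<open>?x + ?y\<close> consists of two differences of disjoint edges, so \<open>x\<close>
  may be replaced by \<open>y\<close> with a change of sign before the path is moved back.\<close>

lemma cherry_rotate:
  assumes V: "V \<subseteq> U" "{r, i, j, l, x, y, u} \<subseteq> V" and rows: "P r = s" "P i = s" "P j = s" "P l = s"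
    and cols: "P x = (\<not> s)" "P y = (\<not> s)" "P u = (\<not> s)"
    and dist: "distinct [r, i, j, l]" "distinct [x, y, u]"
  shows "cherry r y u (cherry x i j one_chain) - cherry r u x (cherry y i j one_chain) \<in> bnd V 2"
proof -
  have ne: "distinct [r, i, j, l, x, y, u]" using dist rows cols by auto
  let ?x = "cherry x i j one_chain" and ?y = "cherry y i j one_chain"
  have cx: "?x \<in> cyc (V - {r, y, u, l}) 1"
    by (rule cherry_one_cyc) (use V dist rows cols ne in auto)
  have cy: "?y \<in> cyc (V - {r, u, x, l}) 1" "?y \<in> cyc (V - {u, l, r}) 1"
    by (rule cherry_one_cyc; use V dist rows cols ne in auto)+
  have 1: "cherry r y u ?x - cherry u l r ?x \<in> bnd V (1 + 1)"
    by (rule cherry_switch[OF cx]) (use V dist rows cols ne in auto)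
  have 3: "cherry u l r ?y - cherry r x u ?y \<in> bnd V (1 + 1)"
  proof (rule bnd_sym, rule cherry_switch)
    show "?y \<in> cyc (V - {r, x, u, l}) 1" using cy(1) by (simp add: insert_commute)
  qed (use V dist rows cols ne in auto)
  have sub: "V - {u, l, r} \<subseteq> U" using V by auto
  have "wedge (ed x i) one_chain - wedge (ed y j) one_chain \<in> bnd (V - {u, l, r}) (0 + 1)"
    by (rule disjoint_edges_homologous[OF one_cyc _ sub]) (use V dist rows cols ne in auto)
  moreover have "wedge (ed y i) one_chain - wedge (ed x j) one_chain \<in> bnd (V - {u, l, r}) (0 + 1)"
    by (rule disjoint_edges_homologous[OF one_cyc _ sub]) (use V dist rows cols ne in auto)
  ultimately have "(wedge (ed x i) one_chain - wedge (ed y j) one_chain)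
      + (wedge (ed y i) one_chain - wedge (ed x j) one_chain) \<in> bnd (V - {u, l, r}) (0 + 1)"
    by (rule bnd_add)
  then have "?x + ?y \<in> bnd (V - {u, l, r}) 1" by (simp add: cherry_def algebra_simps)
  then have 2: "cherry u l r (?x + ?y) \<in> bnd V (1 + 1)"
    by (intro cherry_bnd) (use V dist rows cols ne in \<open>auto simp: insert_commute\<close>)
  have "(cherry r y u ?x - cherry u l r ?x) + cherry u l r (?x + ?y) - (cherry u l r ?y - cherry r x u ?y)
      \<in> bnd V (1 + 1)"
    by (rule bnd_diff[OF bnd_add[OF 1 2] 3])
  then show ?thesis by (simp add: cherry_add cherry_swap[of r u x])
qed

text \<open>
  In the torus of the 4 by 3 board, let \<open>w i c\<close> be the path from \<open>(r1, c')\<close> over \<open>(i, c)\<close> to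
  \<open>(r1, c'')\<close>, where \<open>c, c', c''\<close> are in cyclic order. The hexagon \<open>h\<close> on the rows \<open>r1\<close> and \<open>r2\<close>
  is the sum of the \<open>w r2 c\<close> over all columns. Replacing \<open>r2\<close> by \<open>r3\<close> and \<open>r4\<close> in two of the
  summands gives a hexagon \<open>h'\<close> that bounds four triangles, and \<open>w i c - w j c\<close> does not depend
  on \<open>c\<close> up to homology, so that \<open>h\<close> is homologous to \<open>2 w r2 c3 - w r3 c3 - w r4 c3\<close>.
\<close>

lemma torus_relation:
  assumes char3: "(3::'k::comm_ring_1) = 0"
    and V: "V \<subseteq> U" "{r1, r2, r3, r4, c1, c2, c3} \<subseteq> V"
    and rows: "P r1 = s" "P r2 = s" "P r3 = s" "P r4 = s"
    and cols: "P c1 = (\<not> s)" "P c2 = (\<not> s)" "P c3 = (\<not> s)"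
    and dist: "distinct [r1, r2, r3, r4]" "distinct [c1, c2, c3]"
  obtains h :: "'e set \<Rightarrow> 'k::comm_ring_1" where "h \<in> cyc {r1, r2, c1, c2, c3} 2"
    "cherry r1 c2 c1 (cherry c3 r2 r4 one_chain) + cherry r1 c2 c1 (cherry c3 r3 r4 one_chain) - h \<in> bnd V 2"
proof -
  define R where "R = {r1, r2, r3, r4}"
  define C where "C = {c1, c2, c3}"
  have RC: "r1 \<in> R" "r2 \<in> R" "r3 \<in> R" "r4 \<in> R" "c1 \<in> C" "c2 \<in> C" "c3 \<in> C" "R \<subseteq> V" "C \<subseteq> V"
    using V by (auto simp: R_def C_def)
  have side: "P a = s" "P b = (\<not> s)" if "a \<in> R" "b \<in> C" for a b
    using that rows cols by (auto simp: R_def C_def)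
  have ne: "a \<noteq> b" "a \<in> U" "b \<in> U" if "a \<in> R" "b \<in> C" for a b
    using side[OF that] that RC V by auto
  define e where "e a b = (wedge (ed a b) :: ('e set \<Rightarrow> 'k) \<Rightarrow> _)" for a b
  have e_lin: "e a b (x + y) = e a b x + e a b y" "e a b (x - y) = e a b x - e a b y"
    "e a b (- x) = - e a b x" "e a b 0 = 0" for a b x y
    by (simp_all add: e_def)
  have bd_e: "bd (e a b x) = x - e a b (bd x)" if "a \<in> R" "b \<in> C" for a b x
    unfolding e_def using ne[OF that] by (intro bd_wedge_ed)
  have anti: "e a b (e a' b' x) = - e a' b' (e a b x)"
    if "a \<in> R" "b \<in> C" "a' \<in> R" "b' \<in> C" for a b a' b' x
    unfolding e_def using ne[OF that(1,2)] ne[OF that(3,4)] by (intro wedge_anticommute ed_in_E)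
  have e_chains: "e a b x \<in> chains W (k + 1)"
    if "x \<in> chains (W - {a, b}) k" "a \<in> W" "b \<in> W" "W \<subseteq> V" "a \<in> R" "b \<in> C" for a b x W k
    unfolding e_def by (rule wedge_chains[OF that(1)]) (use that(2-4) side[OF that(5,6)] V in auto)
  have one: "one_chain \<in> chains W 0" for W using one_cyc cyc_chains by blast
  have e1: "e a b one_chain \<in> chains W 1"
    if "a \<in> W" "b \<in> W" "W \<subseteq> V" "a \<in> R" "b \<in> C" for a b W
    using e_chains[OF one that] by simp
  have e2: "e a b (e a' b' one_chain) \<in> chains W 2"
    if "a \<in> W" "b \<in> W" "a' \<in> W" "b' \<in> W" "W \<subseteq> V" "a \<in> R" "b \<in> C" "a' \<in> R" "b' \<in> C"
      "a \<noteq> a'" "b \<noteq> b'" for a b a' b' W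
  proof -
    have "e a' b' one_chain \<in> chains (W - {a, b}) 1"
      by (rule e1) (use that ne[OF that(6,9)] ne[OF that(8,7)] in auto)
    from e_chains[OF this that(1,2,5,6,7)] show ?thesis by simp
  qed
  have e3: "e a b (e a' b' (e a'' b'' one_chain)) \<in> chains V (2 + 1)"
    if "a \<in> R" "b \<in> C" "a' \<in> R" "b' \<in> C" "a'' \<in> R" "b'' \<in> C"
      "a \<noteq> a'" "a \<noteq> a''" "a' \<noteq> a''" "b \<noteq> b'" "b \<noteq> b''" "b' \<noteq> b''" for a b a' b' a'' b''
  proof -
    have "e a' b' (e a'' b'' one_chain) \<in> chains (V - {a, b}) 2"
      by (rule e2) (use that RC ne[OF that(1,4)] ne[OF that(1,6)] ne[OF that(3,2)] ne[OF that(5,2)] in auto)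
    then show ?thesis using that RC by (intro e_chains) auto
  qed
  define w where "w i c c' c'' = e i c (e r1 c' one_chain - e r1 c'' one_chain)" for i c c' c''
  define h where "h = w r2 c1 c2 c3 + w r2 c2 c3 c1 + w r2 c3 c1 c2"
  define h' where "h' = w r2 c1 c2 c3 + w r3 c2 c3 c1 + w r4 c3 c1 c2"
  \<comment> \<open>The triangle on the squares \<open>(r2, c1)\<close>, \<open>(r3, c2)\<close>,
    \<open>(r4, c3)\<close> and the three triangles adjacent to it through row \<open>r1\<close>.
    The shared edges cancel in the boundary and leave the hexagon \<open>h'\<close>.\<close>
  define b where "b = e r1 c3 (e r2 c1 (e r3 c2 one_chain)) + e r1 c1 (e r3 c2 (e r4 c3 one_chain))
      + e r1 c2 (e r4 c3 (e r2 c1 one_chain)) - e r2 c1 (e r3 c2 (e r4 c3 one_chain))"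
  have bd_w: "bd (w i c c' c'') = e r1 c' one_chain - e r1 c'' one_chain"
    if "i \<in> R" "c \<in> C" "c' \<in> C" "c'' \<in> C" for i c c' c''
    unfolding w_def using that RC(1) by (simp add: bd_e e_lin)
  have h: "h \<in> cyc {r1, r2, c1, c2, c3} 2"
  proof (rule cycI)
    show "h \<in> chains {r1, r2, c1, c2, c3} 2"
      unfolding h_def w_def e_lin using RC V dist by (intro chains_add chains_diff e2) auto
    show "bd h = 0" unfolding h_def using RC by (simp add: bd_w)
  qed
  have "b \<in> chains V (2 + 1)"
    unfolding b_def using RC dist by (intro chains_add chains_diff e3) auto
  moreover have "bd b = h'"
    unfolding b_def h'_def w_def using anti[of r3 c2 r1 c3 one_chain] anti[of r4 c3 r1 c1 one_chain]
      anti[of r2 c1 r1 c2 one_chain] anti[of r4 c3 r2 c1 one_chain]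
      anti[of r2 c1 r1 c3 one_chain] anti[of r3 c2 r1 c1 one_chain] anti[of r4 c3 r1 c2 one_chain]
    using RC by (simp add: bd_e e_lin)
  ultimately have h': "h' \<in> bnd V 2" using bndI by blast
  have w_diff: "w i c c' c'' - w j c c' c'' = cherry r1 c'' c' (cherry c i j one_chain)"
    if "i \<in> R" "j \<in> R" "c \<in> C" "c' \<in> C" "c'' \<in> C" for i j c c' c''
    unfolding w_def cherry_def
    using anti[of r1 c' i c one_chain] anti[of r1 c'' i c one_chain] anti[of r1 c' j c one_chain]
      anti[of r1 c'' j c one_chain] that RC(1)
    by (simp add: e_def ed_commute[of c])
  have g1: "(w r2 c2 c3 c1 - w r3 c2 c3 c1) - (w r2 c3 c1 c2 - w r3 c3 c1 c2) \<in> bnd V 2"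
  proof -
    have "cherry r1 c1 c3 (cherry c2 r2 r3 one_chain :: 'e set \<Rightarrow> 'k)
        - cherry r1 c2 c1 (cherry c3 r2 r3 one_chain) \<in> bnd V 2"
      using bnd_minus[OF cherry_rotate[OF V(1), of r1 r2 r3 r4 c2 c3 c1 s]] V rows cols dist
      by (auto simp: cherry_swap[of r1 c1 c3] cherry_swap[of r1 c2 c1])
    then show ?thesis using RC by (simp add: w_diff)
  qed
  have "w r2 c3 c1 c2 - w r4 c3 c1 c2 = cherry r1 c2 c1 (cherry c3 r2 r4 one_chain)"
    "w r3 c3 c1 c2 - w r4 c3 c1 c2 = cherry r1 c2 c1 (cherry c3 r3 r4 one_chain)"
    using RC by (simp_all add: w_diff)
  moreover have "x + x + x = 0" for x :: "'e set \<Rightarrow> 'k"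
  proof -
    have "x + x + x = scale 3 x" by (simp add: scale_def fun_eq_iff pointwise algebra_simps)
    then show ?thesis using char3 by (simp add: scale_def fun_eq_iff pointwise)
  qed
  then have tr: "a + (b + (b + b)) = a" "b + (b + b) = 0" for a b :: "'e set \<Rightarrow> 'k" by (simp_all add: add.assoc)
  \<comment> \<open>Writing \<open>wi\<close> for \<open>w ri c3 c1 c2\<close>: modulo 3, w2 + w3 -
    2 w4 is the negative of 2 w2 - w3 - w4, which explains both the sign of \<open>h\<close> here
    and the two triple sums that make up the difference.\<close>
  have "(w r2 c3 c1 c2 - w r4 c3 c1 c2) + (w r3 c3 c1 c2 - w r4 c3 c1 c2) - (- h)
      = ((w r2 c2 c3 c1 - w r3 c2 c3 c1) - (w r2 c3 c1 c2 - w r3 c3 c1 c2)) + h'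
        + (w r2 c3 c1 c2 + (w r2 c3 c1 c2 + w r2 c3 c1 c2))
        - (w r4 c3 c1 c2 + (w r4 c3 c1 c2 + w r4 c3 c1 c2))"
    unfolding h_def h'_def by (simp add: algebra_simps)
  then have eq: "(w r2 c3 c1 c2 - w r4 c3 c1 c2) + (w r3 c3 c1 c2 - w r4 c3 c1 c2) - (- h)
      = ((w r2 c2 c3 c1 - w r3 c2 c3 c1) - (w r2 c3 c1 c2 - w r3 c3 c1 c2)) + h'"
    by (simp only: tr diff_zero add_0_right)
  have "(w r2 c3 c1 c2 - w r4 c3 c1 c2) + (w r3 c3 c1 c2 - w r4 c3 c1 c2) - (- h) \<in> bnd V 2"
    unfolding eq by (rule bnd_add[OF g1 h'])
  ultimately show ?thesis using that[of "- h"] h by auto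
qed

text \<open>
  The hexagon of the preceding lemma avoids two rows of the 4 by 3 board, so its join with the
  path on row \<open>r5\<close> bounds in the 5 by 5 board. This kills one of the two generators that
  come from the torus.
\<close>

lemma cyclic_base:
  assumes char3: "(3::'k::comm_ring_1) = 0"
    and V: "V \<subseteq> U" "cnt True V = 5" "cnt False V = 5"
  shows "\<exists>g\<in>cyc V 3. \<forall>c\<in>cyc V 3. \<exists>\<alpha>. c - scale \<alpha> g \<in> (bnd V 3 :: ('e set \<Rightarrow> 'k) set)"
proof -
  have finV: "finite V" using finite_subset[OF V(1) finite_U] .
  have card5: "card {x \<in> V. P x = s} = 5" for s using V(2,3) by (cases s) (simp_all add: cnt_def)
  have ex: "\<exists>xs. set xs = {x \<in> V. P x = s} \<and> distinct xs \<and> length xs = 5" for s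
  proof -
    obtain xs where xs: "set xs = {x \<in> V. P x = s}" "distinct xs"
      using finite_distinct_list[of "{x \<in> V. P x = s}"] finV by auto
    then have "length xs = 5" using distinct_card[OF xs(2)] card5 by simp
    then show ?thesis using xs by blast
  qed
  obtain rs where rs: "set rs = {x \<in> V. P x = True}" "distinct rs" "length rs = 5"
    using ex[of True] by blast
  obtain cs where cs: "set cs = {x \<in> V. P x = False}" "distinct cs" "length cs = 5"
    using ex[of False] by blast
  obtain r1 r2 r3 r4 r5 where r: "rs = [r1, r2, r3, r4, r5]"
    using rs(3) by (auto simp: length_Suc_conv numeral_eq_Suc)
  obtain c1 c2 c3 c4 c5 where c: "cs = [c1, c2, c3, c4, c5]"
    using cs(3) by (auto simp: length_Suc_conv numeral_eq_Suc)
  have V_eq: "V = {r1, r2, r3, r4, r5, c1, c2, c3, c4, c5}"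
    using rs(1) cs(1) unfolding r c by auto
  have Pr: "P r1" "P r2" "P r3" "P r4" "P r5" using rs(1) unfolding r by auto
  have Pc: "\<not> P c1" "\<not> P c2" "\<not> P c3" "\<not> P c4" "\<not> P c5" using cs(1) unfolding c by auto
  have dist: "distinct [r1, r2, r3, r4, r5, c1, c2, c3, c4, c5]"
    using rs(2) cs(2) Pr Pc unfolding r c by auto
  have inU: "r1 \<in> U" "r2 \<in> U" "r3 \<in> U" "r4 \<in> U" "r5 \<in> U" "c1 \<in> U" "c2 \<in> U" "c3 \<in> U" "c4 \<in> U" "c5 \<in> U"
    using V(1) unfolding V_eq by auto
  define W where "W = V - {r5, c4, c5}"
  have W_eq: "W = {r1, r2, r3, r4, c1, c2, c3}" unfolding W_def V_eq using dist by auto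
  have W: "W \<subseteq> U" unfolding W_def using V(1) by auto
  define g where "g i = (cherry r1 c2 c1 (cherry c3 i r4 one_chain) :: 'e set \<Rightarrow> 'k)" for i
  define G where "G i = cherry r5 c4 c5 (g i)" for i
  have g_cyc: "g i \<in> cyc W 2" if "i \<in> {r2, r3}" for i
  proof -
    have "cherry c3 i r4 one_chain \<in> (cyc (W - {r1, c2, c1}) 1 :: ('e set \<Rightarrow> 'k) set)"
      by (rule cherry_one_cyc) (use that W Pr Pc dist in \<open>auto simp: W_eq\<close>)
    then have "g i \<in> cyc W (1 + 1)"
      unfolding g_def by (rule cherry_cyc) (use W Pr Pc in \<open>auto simp: W_eq\<close>)
    then show ?thesis by simp
  qed
  have G_cyc: "G i \<in> cyc V 3" if "i \<in> {r2, r3}" for i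
    using cherry_cyc[OF g_cyc[OF that, unfolded W_def]] V(1) Pr Pc unfolding G_def V_eq by auto
  have lift: "cherry r5 c4 c5 x \<in> bnd V 3" if "x \<in> bnd W 2" for x :: "'e set \<Rightarrow> 'k"
    using cherry_bnd[OF that[unfolded W_def]] V(1) Pr Pc unfolding V_eq by auto
  \<comment> \<open>\<open>W\<close> is the 4 by 3 board. The two classes correspond to the two
    independent loops of the torus.\<close>
  have span_W: "\<exists>\<alpha> \<beta>. x - (scale \<alpha> (g r2) + scale \<beta> (g r3)) \<in> bnd W 2" if x: "x \<in> cyc W 2" for x
  proof -
    have exact: "cyc (W - {c1, a}) (2 - 1) \<subseteq> (bnd (W - {c1, a}) (2 - 1) :: ('e set \<Rightarrow> 'k) set)"
      if a: "a \<in> W" "P c1 = (\<not> P a)" for a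
    proof (rule exact_bipartite)
      have "c1 \<noteq> a" "{c1, a} \<subseteq> W" using a by (auto simp: W_eq)
      then have "cnt t (W - {c1, a}) = cnt t W - 1" for t
        using a by (simp add: cnt_Diff[OF _ W])
      moreover have "cnt True W = 4" "cnt False W = 3" unfolding W_eq using dist Pr Pc by auto
      ultimately show "2 - 1 + 1 \<le> cnt True (W - {c1, a})" "2 - 1 + 1 \<le> cnt False (W - {c1, a})"
        "3 * (2 - 1) + 2 \<le> cnt True (W - {c1, a}) + cnt False (W - {c1, a})" by simp_all
    qed (use W in auto)
    have "r1 \<in> W" "c1 \<in> W" "P r1 = (\<not> P c1)" using Pr Pc by (auto simp: W_eq)
    from expand[OF W this x exact] obtain z where
      z: "\<And>h. h \<in> W - {c1} \<Longrightarrow> P r1 = (\<not> P h) \<Longrightarrow> z h \<in> cyc (W - {r1, h, c1}) (2 - 1)"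
      "x - (\<Sum>h | h \<in> W - {c1} \<and> P r1 = (\<not> P h). cherry r1 h c1 (z h)) \<in> bnd W 2"
      by blast
    have N: "{h. h \<in> W - {c1} \<and> P r1 = (\<not> P h)} = {c2, c3}"
      unfolding W_eq using Pr Pc dist by auto
    have zs: "z c2 \<in> cyc {c3, r2, r3, r4} 1" "z c3 \<in> cyc {c2, r2, r3, r4} 1"
    proof -
      have "W - {r1, c2, c1} = {c3, r2, r3, r4}" "W - {r1, c3, c1} = {c2, r2, r3, r4}"
        unfolding W_eq using dist by auto
      then show "z c2 \<in> cyc {c3, r2, r3, r4} 1" "z c3 \<in> cyc {c2, r2, r3, r4} 1"
        using z(1)[of c2] z(1)[of c3] Pr Pc dist by (auto simp: W_eq)
    qed
    obtain \<alpha> \<beta> where z2: "z c2 = scale \<alpha> (cherry c3 r2 r4 one_chain) + scale \<beta> (cherry c3 r3 r4 one_chain)"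
      using cyc_star[OF _ _ _ _ _ zs(1)] inU Pr Pc dist by auto
    obtain \<gamma> \<delta> where z3: "z c3 = scale \<gamma> (cherry c2 r2 r4 one_chain) + scale \<delta> (cherry c2 r3 r4 one_chain)"
      using cyc_star[OF _ _ _ _ _ zs(2)] inU Pr Pc dist by auto
    \<comment> \<open>The paths through \<open>c3\<close> instead of \<open>c2\<close> give nothing
      new: rotating the columns turns them into the negatives of the \<open>g i\<close>. The spare
      row \<open>l\<close> is the one of \<open>r2\<close>, \<open>r3\<close> that differs from
      \<open>i\<close>.\<close>
    have rot: "cherry r1 c3 c1 (cherry c2 i r4 one_chain) + g i \<in> bnd W 2"
      if "(i, l) \<in> {(r2, r3), (r3, r2)}" for i l
      using cherry_rotate[OF W, of r1 i r4 l c2 c3 c1 True] that Pr Pc dist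
      by (auto simp: g_def cherry_swap[of r1 c1 c2] W_eq)
    let ?q = "\<lambda>i. cherry r1 c3 c1 (cherry c2 i r4 one_chain) :: 'e set \<Rightarrow> 'k"
    have "(\<Sum>h | h \<in> W - {c1} \<and> P r1 = (\<not> P h). cherry r1 h c1 (z h))
        = scale \<alpha> (g r2) + scale \<beta> (g r3) + (scale \<gamma> (?q r2) + scale \<delta> (?q r3))"
      unfolding N using dist by (simp add: z2 z3 g_def cherry_add cherry_scale)
    also have "\<dots> = (scale (\<alpha> - \<gamma>) (g r2) + scale (\<beta> - \<delta>) (g r3))
        + (scale \<gamma> (?q r2 + g r2) + scale \<delta> (?q r3 + g r3))"
      by (simp add: scale_diff_left scale_add_right)
    finally have "(\<Sum>h | h \<in> W - {c1} \<and> P r1 = (\<not> P h). cherry r1 h c1 (z h))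
        - (scale (\<alpha> - \<gamma>) (g r2) + scale (\<beta> - \<delta>) (g r3)) \<in> bnd W 2"
      using bnd_add[OF bnd_scale[OF rot[of r2 r3]] bnd_scale[OF rot[of r3 r2]]]
      by (simp only: add_diff_cancel_left' insert_iff simp_thms)
    then show ?thesis using bnd_trans[OF z(2)] by blast
  qed
  have rel: "G r2 + G r3 \<in> bnd V 3"
  proof -
    obtain h where h: "h \<in> cyc {r1, r2, c1, c2, c3} 2" "g r2 + g r3 - h \<in> bnd W 2"
    proof (rule torus_relation[OF char3 W, of r1 r2 r3 r4 c1 c2 c3 True])
      fix h :: "'e set \<Rightarrow> 'k"
      assume "h \<in> cyc {r1, r2, c1, c2, c3} 2"
        "cherry r1 c2 c1 (cherry c3 r2 r4 one_chain) + cherry r1 c2 c1 (cherry c3 r3 r4 one_chain) - h \<in> bnd W 2"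
      then show thesis using that[of h] unfolding g_def by simp
    qed (use Pr Pc dist in \<open>auto simp: W_eq\<close>)
    \<comment> \<open>The cycle \<open>h\<close> leaves \<open>r3\<close> and \<open>r4\<close>
      free. In the sequence \<open>(r5, c4)\<close>, \<open>(r3, c5)\<close>,
      \<open>(r4, c4)\<close>, \<open>(r5, c5)\<close> neighbouring squares are disjoint, so the two
      edges of the path on \<open>r5\<close> become homologous after joining with
      \<open>h\<close>.\<close>
    have edges: "wedge (ed r5 c4) h - wedge (ed r3 c5) h \<in> bnd V (2 + 1)"
      "wedge (ed r3 c5) h - wedge (ed r4 c4) h \<in> bnd V (2 + 1)"
      "wedge (ed r4 c4) h - wedge (ed r5 c5) h \<in> bnd V (2 + 1)"
      by (rule disjoint_edges_homologous[OF cyc_mono[OF h(1)]];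
          use V(1) Pr Pc dist in \<open>auto simp: V_eq\<close>)+
    have "cherry r5 c4 c5 h \<in> bnd V (2 + 1)"
      unfolding cherry_def by (rule bnd_trans[OF bnd_trans[OF edges(1,2)] edges(3)])
    then have "cherry r5 c4 c5 (g r2 + g r3 - h) + cherry r5 c4 c5 h \<in> bnd V 3"
      using lift[OF h(2)] by (intro bnd_add) simp_all
    then show ?thesis by (simp add: G_def cherry_add cherry_diff)
  qed
  show ?thesis
  proof (intro bexI ballI)
    show "G r2 \<in> cyc V 3" by (rule G_cyc) simp
    fix x :: "'e set \<Rightarrow> 'k" assume x: "x \<in> cyc V 3"
    obtain y where y: "y \<in> cyc (V - {r5, c4, c5}) (3 - 1)" "x - cherry r5 c4 c5 y \<in> bnd V 3"
      by (rule cherry_generates[OF V(1), of r5 c4 c5 True x 3])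
        (use V Pr Pc dist x in \<open>auto simp: V_eq\<close>)
    obtain \<alpha> \<beta> where ab: "y - (scale \<alpha> (g r2) + scale \<beta> (g r3)) \<in> bnd W 2"
      using span_W[of y] y(1) unfolding W_def by auto
    have "(x - cherry r5 c4 c5 y) + cherry r5 c4 c5 (y - (scale \<alpha> (g r2) + scale \<beta> (g r3)))
        + scale \<beta> (G r2 + G r3) \<in> bnd V 3"
      by (rule bnd_add[OF bnd_add[OF y(2) lift[OF ab]] bnd_scale[OF rel]])
    moreover have "(x - cherry r5 c4 c5 y) + cherry r5 c4 c5 (y - (scale \<alpha> (g r2) + scale \<beta> (g r3)))
        + scale \<beta> (G r2 + G r3) = x - scale (\<alpha> - \<beta>) (G r2)"
      by (simp add: G_def cherry_add cherry_diff cherry_scale scale_add_right scale_diff_left)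
    ultimately show "\<exists>\<alpha>. x - scale \<alpha> (G r2) \<in> bnd V 3" by auto
  qed
qed

theorem cyclic:
  assumes char3: "(3::'k::comm_ring_1) = 0"
    and "V \<subseteq> U" "k + 2 \<le> cnt True V" "k + 2 \<le> cnt False V" "cnt True V + cnt False V = 3 * k + 1"
  shows "\<exists>g\<in>cyc V k. \<forall>c\<in>cyc V k. \<exists>\<alpha>. c - scale \<alpha> g \<in> (bnd V k :: ('e set \<Rightarrow> 'k) set)"
proof -
  \<comment> \<open>From 2 (k + 2) \<le> 3 k + 1. For \<open>k = 3\<close> equality holds, so the
    base case is the 5 by 5 board.\<close>
  have "k \<ge> 3" using assms by linarith
  then show ?thesis using assms(2-)
  proof (induction k arbitrary: V rule: int_ge_induct)
    case base
    then have "cnt True V = 5" "cnt False V = 5" by linarith+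
    then show ?case using cyclic_base[OF char3] base by blast
  next
    case (step k)
    \<comment> \<open>The side \<open>\<not> s\<close> has to give up two vertices. If both sides
      had exactly \<open>k + 3\<close>, the total would force \<open>k = 2\<close>.\<close>
    obtain s where s: "k + 3 \<le> cnt s V" "k + 4 \<le> cnt (\<not> s) V" "cnt s V + cnt (\<not> s) V = 3 * k + 4"
    proof (cases "k + 4 \<le> cnt False V")
      case True
      then show ?thesis using step.prems by (intro that[of True]) simp_all
    next
      case False
      then show ?thesis using step.prems step.hyps by (intro that[of False]) simp_all
    qed
    obtain p where p: "p \<in> V" "P p = s" using cnt_pos_ex[of s V] s step.hyps by auto
    obtain b where b: "b \<in> V" "P b = (\<not> s)" using cnt_pos_ex[of "\<not> s" V] s step.hyps by auto
    have "0 < cnt (\<not> s) (V - {b})" using cnt_Diff[OF _ step.prems(1), of "{b}"] b s step.hyps by simp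
    then obtain q where q: "q \<in> V" "q \<noteq> b" "P q = (\<not> s)" using cnt_pos_ex by blast
    let ?W = "V - {p, b, q}"
    have "p \<noteq> b" "p \<noteq> q" "b \<noteq> q" using p b q by auto
    then have W: "cnt t ?W = cnt t V - (if t = s then 1 else 2)" for t
      using p b q by (simp add: cnt_Diff[OF _ step.prems(1)])
    have "k + 2 \<le> cnt True ?W" "k + 2 \<le> cnt False ?W" "cnt True ?W + cnt False ?W = 3 * k + 1"
      using W s by (cases s; simp)+
    moreover have "?W \<subseteq> U" using step.prems(1) by auto
    ultimately have "\<exists>g\<in>cyc ?W k. \<forall>c\<in>cyc ?W k. \<exists>\<alpha>. c - scale \<alpha> g \<in> (bnd ?W k :: ('e set \<Rightarrow> 'k) set)"
      by (intro step.IH)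
    then obtain g :: "'e set \<Rightarrow> 'k" where
      g: "g \<in> cyc ?W k" "\<forall>c\<in>cyc ?W k. \<exists>\<alpha>. c - scale \<alpha> g \<in> bnd ?W k"
      by (rule bexE)
    show ?case
    proof (intro bexI ballI)
      show "cherry p b q g \<in> cyc V (k + 1)"
        by (rule cherry_cyc[OF g(1)]) (use p b q step.prems(1) in auto)
      fix c :: "'e set \<Rightarrow> 'k" assume c: "c \<in> cyc V (k + 1)"
      obtain z where z: "z \<in> cyc ?W (k + 1 - 1)" "c - cherry p b q z \<in> bnd V (k + 1)"
        by (rule cherry_generates[OF step.prems(1), of p b q s c "k + 1"])
          (use p b q s c step.hyps in auto)
      obtain \<alpha> where a: "z - scale \<alpha> g \<in> bnd ?W k" using g(2) z(1) by auto
      have "cherry p b q (z - scale \<alpha> g) \<in> bnd V (k + 1)"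
        by (rule cherry_bnd[OF a]) (use p b q step.prems(1) in auto)
      then have "c - scale \<alpha> (cherry p b q g) \<in> bnd V (k + 1)"
        using bnd_add[OF z(2), of "cherry p b q (z - scale \<alpha> g)"]
        by (simp add: cherry_diff cherry_scale)
      then show "\<exists>\<alpha>. c - scale \<alpha> (cherry p b q g) \<in> bnd V (k + 1)" by blast
    qed
  qed
qed

end

section \<open>Lower bound\<close>

context matching_chains
begin

text \<open>The star of \<open>p\<close> in the cycle \<open>c\<close> and the part of
  \<open>c\<close> off \<open>p\<close> have opposite boundaries; the first one is the sum of the
  contractions.\<close>

lemma star_sum_bnd:
  assumes c: "c \<in> cyc V k" and p: "p \<in> V" and V: "V \<subseteq> U"
  shows "(\<Sum>h | h \<in> V \<and> adj p h. contract (ed p h) c) \<in> bnd (V - {p}) (k - 1)"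
proof -
  let ?N = "{h. h \<in> V \<and> adj p h}"
  have "bd (wedge (ed p h) (contract (ed p h) c)) = contract (ed p h) c" if "h \<in> ?N" for h
    using that V p adj_irrefl[of p h] bd_cyc[OF c]
    by (auto simp: bd_wedge_ed bd_contract ed_in_E subset_iff)
  then have "bd (\<Sum>h\<in>?N. wedge (ed p h) (contract (ed p h) c)) = (\<Sum>h\<in>?N. contract (ed p h) c)"
    unfolding bd_sum by (rule sum.cong[OF refl])
  then have eq: "(\<Sum>h\<in>?N. contract (ed p h) c)
      = - bd (c - (\<Sum>h\<in>?N. wedge (ed p h) (contract (ed p h) c)))"
    using bd_cyc[OF c] by simp
  have "c - (\<Sum>h\<in>?N. wedge (ed p h) (contract (ed p h) c)) \<in> chains (V - {p}) (k - 1 + 1)"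
    using chains_minus_star[OF cyc_chains[OF c] p V] by simp
  then show ?thesis by (subst eq) (intro bnd_minus bndI)
qed

end

section \<open>Signs of reorderings of the vertices\<close>

definition pos_sign :: "'v::linorder set \<Rightarrow> 'v \<Rightarrow> 'k::comm_ring_1" where
  "pos_sign V x = (- 1) ^ card {y \<in> V. y < x}"

lemma pos_sign_square [simp]: "pos_sign V x * pos_sign V x = 1"
  by (simp add: pos_sign_def)

lemma pos_sign_remove:
  assumes "finite V" "y \<in> V" "x \<noteq> y"
  shows "pos_sign (V - {y}) x = (if y < x then - pos_sign V x else pos_sign V x)"
proof -
  define W where "W = V - {y}"
  have V: "V = insert y W" "y \<notin> W" "finite W" using assms by (auto simp: W_def)
  have "{z \<in> insert y W. z < x} = (if y < x then insert y {z \<in> W. z < x} else {z \<in> W. z < x})" by auto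
  then show ?thesis using V unfolding V(1) by (simp add: pos_sign_def)
qed

text \<open>Moving two vertices to the front in either order gives results that differ by one
  transposition.\<close>

lemma pos_sign_swap:
  assumes "finite V" "x \<in> V" "y \<in> V" "x \<noteq> y"
  shows "pos_sign V x * pos_sign (V - {x}) y = - (pos_sign V y * pos_sign (V - {y}) x)"
  using assms by (cases x y rule: linorder_cases) (simp_all add: pos_sign_remove mult.commute)

text \<open>The sign of the shuffle that moves \<open>a, b, c\<close> to the front of \<open>V\<close>.\<close>

definition front_sign :: "'v::linorder set \<Rightarrow> 'v \<Rightarrow> 'v \<Rightarrow> 'v \<Rightarrow> 'k::comm_ring_1" where
  "front_sign V a b c = pos_sign V a * pos_sign (V - {a}) b * pos_sign (V - {a, b}) c"

lemma front_sign_swap12: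
  assumes "finite V" "a \<in> V" "b \<in> V" "a \<noteq> b"
  shows "(front_sign V a b c :: 'k::comm_ring_1) = - front_sign V b a c"
proof -
  have "(pos_sign V a * pos_sign (V - {a}) b :: 'k) = - (pos_sign V b * pos_sign (V - {b}) a)"
    by (rule pos_sign_swap[OF assms])
  then show ?thesis by (simp add: front_sign_def insert_commute)
qed

lemma front_sign_swap23:
  assumes "finite V" "b \<in> V" "c \<in> V" "a \<noteq> b" "a \<noteq> c" "b \<noteq> c"
  shows "(front_sign V a b c :: 'k::comm_ring_1) = - front_sign V a c b"
proof -
  have "(pos_sign (V - {a}) b * pos_sign (V - {a} - {b}) c :: 'k)
      = - (pos_sign (V - {a}) c * pos_sign (V - {a} - {c}) b)"
    by (rule pos_sign_swap) (use assms in auto)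
  moreover have "V - {a, b} = V - {a} - {b}" "V - {a, c} = V - {a} - {c}" by auto
  ultimately show ?thesis by (simp add: front_sign_def mult.assoc)
qed

lemma front_sign_square: "front_sign V a b c * front_sign V a b c = 1"
proof -
  have "front_sign V a b c * front_sign V a b c
      = (pos_sign V a * pos_sign V a) * (pos_sign (V - {a}) b * pos_sign (V - {a}) b)
        * (pos_sign (V - {a, b}) c * pos_sign (V - {a, b}) c)"
    by (simp only: front_sign_def mult.assoc mult.left_commute)
  then show ?thesis by simp
qed

locale ordered_matchings = complete_matchings E U ed
  for E :: "'e::linorder set" and U :: "'v::linorder set" and ed :: "'v \<Rightarrow> 'v \<Rightarrow> 'e"

text \<open>
  The functionals \<open>\<phi> V\<close> detect the generator. Coherence is antisymmetry under the transposition
  of \<open>x\<close> and \<open>y\<close>, stated for cycles that meet neither of them.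
\<close>

locale coherent_family = ordered_matchings E U ed
  for E :: "'e::linorder set" and U :: "'v::linorder set" and ed :: "'v \<Rightarrow> 'v \<Rightarrow> 'e" +
  fixes k :: int and \<phi> :: "'v set \<Rightarrow> ('e set \<Rightarrow> 'k::comm_ring_1) \<Rightarrow> 'k"
  assumes char3: "(3::'k) = 0"
    and k_nonneg: "0 \<le> k"
    and add: "\<lbrakk>V \<subseteq> U; int (card V) = 3 * k + 1; c \<in> cyc V k; c' \<in> cyc V k\<rbrakk> \<Longrightarrow> \<phi> V (c + c') = \<phi> V c + \<phi> V c'"
    and vanish: "\<lbrakk>V \<subseteq> U; int (card V) = 3 * k + 1; c \<in> bnd V k\<rbrakk> \<Longrightarrow> \<phi> V c = 0"
    and coherent: "\<lbrakk>V \<subseteq> U; int (card V) = 3 * k + 2; x \<in> V; y \<in> V; x \<noteq> y; z \<in> cyc (V - {x, y}) k\<rbrakk>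
      \<Longrightarrow> pos_sign V x * \<phi> (V - {x}) z + pos_sign V y * \<phi> (V - {y}) z = 0"
begin

lemma finite_sub: "V \<subseteq> U \<Longrightarrow> finite V"
  using finite_U finite_subset by blast

lemma card_minus:
  assumes "V \<subseteq> U" "X \<subseteq> V" "card X = n"
  shows "int (card (V - X)) = int (card V) - int n"
  using assms finite_sub[OF assms(1)] finite_subset[of X V] card_mono[of V X]
  by (simp add: card_Diff_subset of_nat_diff)

lemma phi_zero: "V \<subseteq> U \<Longrightarrow> int (card V) = 3 * k + 1 \<Longrightarrow> \<phi> V 0 = 0"
  by (rule vanish) simp_all

lemma phi_sum:
  assumes "V \<subseteq> U" "int (card V) = 3 * k + 1" "finite A" "\<And>x. x \<in> A \<Longrightarrow> f x \<in> cyc V k"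
  shows "\<phi> V (\<Sum>x\<in>A. f x) = (\<Sum>x\<in>A. \<phi> V (f x))"
  using assms(3,4)
proof (induction A)
  case (insert x A)
  then have "(\<Sum>x\<in>A. f x) \<in> cyc V k" by (intro cyc_sum) auto
  then show ?case using insert by (simp add: add[OF assms(1,2)])
qed (simp add: assms phi_zero)

lemma phi_cong:
  assumes "V \<subseteq> U" "int (card V) = 3 * k + 1" "c \<in> cyc V k" "c' \<in> cyc V k" "c - c' \<in> bnd V k"
  shows "\<phi> V c = \<phi> V c'"
proof -
  have "\<phi> V ((c - c') + c') = \<phi> V (c - c') + \<phi> V c'"
    by (rule add[OF assms(1,2)]) (use assms in auto)
  then show ?thesis using vanish[OF assms(1,2,5)] by simp
qed

text \<open>
  The functional of the next degree, for cycles that avoid \<open>q\<close>: such a cycle is homologous to the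
  sum of the \<open>cherry p h q (contract (ed p h) c)\<close>.
\<close>

definition next_off :: "'v set \<Rightarrow> 'v \<Rightarrow> 'v \<Rightarrow> ('e set \<Rightarrow> 'k) \<Rightarrow> 'k" where
  "next_off W p q c = pos_sign W q * pos_sign (W - {q}) p *
    (\<Sum>h\<in>W - {p, q}. pos_sign (W - {p, q}) h * \<phi> (W - {p, h, q}) (contract (ed p h) c))"

lemma contract_cyc':
  assumes "c \<in> cyc (W - {q}) (k + 1)" "W \<subseteq> U" "p \<in> W" "h \<in> W - {p, q}" "p \<noteq> q"
  shows "contract (ed p h) c \<in> cyc (W - {p, h, q}) k"
proof -
  have "W - {q} - {p, h} = W - {p, h, q}" by auto
  then show ?thesis using contract_cyc[OF assms(1), of p h] assms by auto
qed

lemma next_off_add: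
  assumes "W \<subseteq> U" "int (card W) = 3 * k + 4" "p \<in> W" "q \<in> W" "p \<noteq> q"
    and "c \<in> cyc (W - {q}) (k + 1)" "c' \<in> cyc (W - {q}) (k + 1)"
  shows "next_off W p q (c + c') = next_off W p q c + next_off W p q c'"
proof -
  have "\<phi> (W - {p, h, q}) (contract (ed p h) (c + c'))
      = \<phi> (W - {p, h, q}) (contract (ed p h) c) + \<phi> (W - {p, h, q}) (contract (ed p h) c')"
    if h: "h \<in> W - {p, q}" for h
    unfolding contract_add
  proof (rule add)
    show "int (card (W - {p, h, q})) = 3 * k + 1"
      using card_minus[OF assms(1), of "{p, h, q}" 3] h assms by auto
    show "contract (ed p h) c \<in> cyc (W - {p, h, q}) k"
      by (rule contract_cyc'[OF assms(6,1,3) h assms(5)])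
    show "contract (ed p h) c' \<in> cyc (W - {p, h, q}) k"
      by (rule contract_cyc'[OF assms(7,1,3) h assms(5)])
  qed (use assms(1) in auto)
  then show ?thesis
    unfolding next_off_def by (simp add: distrib_left sum.distrib)
qed

text \<open>Let \<open>c\<close> be the boundary of \<open>b\<close>. Since \<open>c\<close> avoids
  \<open>q\<close>, the parts \<open>bx x\<close> of \<open>b\<close> at the edges \<open>qx\<close>
  are cycles, and \<open>c\<close> is their sum plus the boundary of a chain off \<open>q\<close>.
  The value is therefore a double sum over pairs \<open>h\<close>, \<open>x\<close>. Coherence
  replaces the deletion of \<open>h\<close> by that of \<open>x\<close>, at the price of a sign; for
  fixed \<open>x\<close> the sum over \<open>h\<close> then vanishes, because the contractions of
  \<open>bx x\<close> around \<open>p\<close> add up to a boundary.\<close>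

lemma next_off_bnd:
  assumes W: "W \<subseteq> U" "int (card W) = 3 * k + 4" and pq: "p \<in> W" "q \<in> W" "p \<noteq> q"
    and c: "c \<in> cyc (W - {q}) (k + 1)" "c \<in> bnd W (k + 1)"
  shows "next_off W p q c = 0"
proof -
  obtain b where b: "b \<in> chains W (k + 2)" "c = bd b"
    using c(2) by (rule bndE) (simp add: add.assoc)
  define V where "V = W - {p, q}"
  have V: "V \<subseteq> U" "int (card V) = 3 * k + 2" "finite V"
    using card_minus[OF W(1), of "{p, q}" 2] W pq finite_sub[of V] by (auto simp: V_def)
  have inU: "x \<in> U" if "x \<in> W" for x using that W by auto
  define bx where "bx x = contract (ed q x) b" for x
  have bx: "bx x \<in> cyc (W - {q, x}) (k + 1)" if x: "x \<in> W - {q}" for x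
  proof (rule cycI)
    have xU: "x \<in> U" "q \<in> U" "q \<noteq> x" using x inU pq by auto
    have "contract (ed q x) b \<in> chains (W - {q, x}) (k + 2 - 1)"
      by (rule contract_chains[OF b(1)]) (use xU W in auto)
    moreover have "k + 2 - 1 = k + 1" by simp
    ultimately show "bx x \<in> chains (W - {q, x}) (k + 1)" unfolding bx_def by (simp only:)
    have "contract (ed q x) c = 0"
      by (rule contract_eq_0[OF cyc_chains[OF c(1)]]) (use xU W in auto)
    then show "bd (bx x) = 0" using xU by (simp add: bx_def bd_contract ed_in_E flip: b(2))
  qed
  define b0 where "b0 = b - (\<Sum>x | x \<in> W \<and> q \<noteq> x. wedge (ed q x) (bx x))"
  have b0: "b0 \<in> chains (W - {q}) (k + 2)"
    unfolding b0_def bx_def by (rule chains_minus_star[OF b(1) pq(2) W(1)])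
  have N: "{x. x \<in> W \<and> q \<noteq> x} = W - {q}" by auto
  have "bd (\<Sum>x\<in>W - {q}. wedge (ed q x) (bx x)) = (\<Sum>x\<in>W - {q}. bx x)"
    unfolding bd_sum
  proof (rule sum.cong[OF refl])
    fix x assume x: "x \<in> W - {q}"
    then have "x \<in> U" "q \<in> U" "q \<noteq> x" using inU pq by auto
    then show "bd (wedge (ed q x) (bx x)) = bx x" using bd_cyc[OF bx[OF x]] by (simp add: bd_wedge_ed)
  qed
  then have c_eq: "c = bd b0 + (\<Sum>x\<in>W - {q}. bx x)"
    unfolding b(2) b0_def N by simp
  have mem: "contract (ed p h) (bx x) \<in> cyc (V - {h, x}) k" if "h \<in> V" "x \<in> V" "h \<noteq> x" for h x
  proof -
    have "W - {q, x} - {p, h} = V - {h, x}" unfolding V_def by auto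
    moreover have "contract (ed p h) (bx x) \<in> cyc (W - {q, x} - {p, h}) (k + 1 - 1)"
      by (rule contract_cyc[OF bx]) (use that inU pq W in \<open>auto simp: V_def\<close>)
    ultimately show ?thesis by simp
  qed
  have Vh: "V - {h} \<subseteq> U" "int (card (V - {h})) = 3 * k + 1" "W - {p, h, q} = V - {h}" if "h \<in> V" for h
    using card_minus[OF V(1), of "{h}" 1] that V by (auto simp: V_def)
  have step1: "\<phi> (V - {h}) (contract (ed p h) c) = (\<Sum>x\<in>V - {h}. \<phi> (V - {h}) (contract (ed p h) (bx x)))"
    if h: "h \<in> V" for h
  proof -
    have hU: "p \<in> U" "h \<in> U" "p \<noteq> h" using h inU pq by (auto simp: V_def)
    have sum_eq: "(\<Sum>x\<in>W - {q}. contract (ed p h) (bx x)) = (\<Sum>x\<in>V - {h}. contract (ed p h) (bx x))"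
    proof (rule sum.mono_neutral_right)
      show "\<forall>x\<in>W - {q} - (V - {h}). contract (ed p h) (bx x) = 0"
      proof
        fix x assume x: "x \<in> W - {q} - (V - {h})"
        then have "x = p \<or> x = h" "x \<in> W - {q}" by (auto simp: V_def)
        then show "contract (ed p h) (bx x) = 0"
          by (intro contract_eq_0[OF cyc_chains[OF bx]]) (use hU W in auto)
      qed
    qed (use finite_sub[OF W(1)] in \<open>auto simp: V_def\<close>)
    have "contract (ed p h) b0 \<in> chains (W - {q} - {p, h}) (k + 2 - 1)"
      by (rule contract_chains[OF b0]) (use hU W in auto)
    moreover have "W - {q} - {p, h} = V - {h}" "k + 2 - 1 = k + 1" by (auto simp: V_def)
    ultimately have "contract (ed p h) b0 \<in> chains (V - {h}) (k + 1)" by (simp only:)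
    then have bnd: "- bd (contract (ed p h) b0) \<in> bnd (V - {h}) k" by (intro bnd_minus bndI)
    have mem': "contract (ed p h) (bx x) \<in> cyc (V - {h}) k" if "x \<in> V - {h}" for x
      by (rule cyc_mono[OF mem[of h x]]) (use that h V in auto)
    have "contract (ed p h) c = - bd (contract (ed p h) b0) + (\<Sum>x\<in>V - {h}. contract (ed p h) (bx x))"
      unfolding c_eq using hU by (simp add: bd_contract ed_in_E sum_eq)
    then have "\<phi> (V - {h}) (contract (ed p h) c)
        = \<phi> (V - {h}) (- bd (contract (ed p h) b0)) + \<phi> (V - {h}) (\<Sum>x\<in>V - {h}. contract (ed p h) (bx x))"
      using add[OF Vh(1,2)[OF h] bnd_cyc[OF bnd Vh(1)[OF h]] cyc_sum[of "V - {h}" _ "V - {h}" k, OF mem']]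
      by simp
    also have "\<phi> (V - {h}) (- bd (contract (ed p h) b0)) = 0"
      by (rule vanish[OF Vh(1,2)[OF h] bnd])
    finally have "\<phi> (V - {h}) (contract (ed p h) c) = \<phi> (V - {h}) (\<Sum>x\<in>V - {h}. contract (ed p h) (bx x))"
      by simp
    then show ?thesis using phi_sum[OF Vh(1,2)[OF h], of "V - {h}" "\<lambda>x. contract (ed p h) (bx x)"] mem' V(3) by simp
  qed
  have step2: "(\<Sum>h\<in>V - {x}. \<phi> (V - {x}) (contract (ed p h) (bx x))) = 0" if x: "x \<in> V" for x
  proof -
    have x': "x \<in> W - {q}" "p \<in> W - {q, x}" "W - {q, x} \<subseteq> U" using x pq W by (auto simp: V_def)
    have eq: "{h. h \<in> W - {q, x} \<and> p \<noteq> h} = V - {x}" "W - {q, x} - {p} = V - {x}" by (auto simp: V_def)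
    have "(\<Sum>h\<in>V - {x}. contract (ed p h) (bx x)) \<in> bnd (V - {x}) k"
      using star_sum_bnd[OF bx[OF x'(1)] x'(2,3)] unfolding eq by simp
    then have "\<phi> (V - {x}) (\<Sum>h\<in>V - {x}. contract (ed p h) (bx x)) = 0"
      by (rule vanish[OF Vh(1,2)[OF x]])
    moreover have "contract (ed p h) (bx x) \<in> cyc (V - {x}) k" if "h \<in> V - {x}" for h
      by (rule cyc_mono[OF mem[of h x]]) (use that x V in auto)
    ultimately show ?thesis
      using phi_sum[OF Vh(1,2)[OF x], of "V - {x}" "\<lambda>h. contract (ed p h) (bx x)"] V(3) by simp
  qed
  have "(\<Sum>h\<in>V. pos_sign V h * \<phi> (V - {h}) (contract (ed p h) c))
      = (\<Sum>h\<in>V. \<Sum>x\<in>V - {h}. pos_sign V h * \<phi> (V - {h}) (contract (ed p h) (bx x)))"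
    by (simp add: step1 sum_distrib_left)
  also have "\<dots> = (\<Sum>h\<in>V. \<Sum>x\<in>V - {h}. - (pos_sign V x * \<phi> (V - {x}) (contract (ed p h) (bx x))))"
  proof (intro sum.cong refl)
    fix h x assume hx: "h \<in> V" "x \<in> V - {h}"
    then have "h \<noteq> x" by auto
    with hx show "pos_sign V h * \<phi> (V - {h}) (contract (ed p h) (bx x))
        = - (pos_sign V x * \<phi> (V - {x}) (contract (ed p h) (bx x)))"
      using coherent[OF V(1,2) hx(1), of x "contract (ed p h) (bx x)"] mem[of h x]
      by (simp add: eq_neg_iff_add_eq_0)
  qed
  also have "\<dots> = (\<Sum>x\<in>V. \<Sum>h\<in>V - {x}. - (pos_sign V x * \<phi> (V - {x}) (contract (ed p h) (bx x))))"
  proof -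
    define f where "f h x = - (pos_sign V x * \<phi> (V - {x}) (contract (ed p h) (bx x)))" for h x
    have "(\<Sum>h\<in>V. \<Sum>x\<in>V - {h}. f h x) = (\<Sum>h\<in>V. \<Sum>x\<in>V. if h = x then 0 else f h x)"
      by (intro sum.cong refl sum.mono_neutral_cong_left) (use V(3) in auto)
    also have "\<dots> = (\<Sum>x\<in>V. \<Sum>h\<in>V. if h = x then 0 else f h x)" by (rule sum.swap)
    also have "\<dots> = (\<Sum>x\<in>V. \<Sum>h\<in>V - {x}. f h x)"
      by (intro sum.cong refl sum.mono_neutral_cong_right) (use V(3) in auto)
    finally show ?thesis unfolding f_def .
  qed
  also have "\<dots> = 0"
    using step2 by (simp add: sum_negf flip: sum_distrib_left)
  finally have "(\<Sum>h\<in>V. pos_sign V h * \<phi> (V - {h}) (contract (ed p h) c)) = 0" .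
  moreover have "(\<Sum>h\<in>V. pos_sign V h * \<phi> (W - {p, h, q}) (contract (ed p h) c))
      = (\<Sum>h\<in>V. pos_sign V h * \<phi> (V - {h}) (contract (ed p h) c))"
    by (intro sum.cong refl) (simp add: Vh(3))
  ultimately show ?thesis unfolding next_off_def V_def[symmetric] by simp
qed

lemma ex_cyc_off:
  fixes c :: "'e set \<Rightarrow> 'k"
  assumes "W \<subseteq> U" "int (card W) = 3 * k + 4" "q \<in> W" "c \<in> cyc W (k + 1)"
  shows "\<exists>c'. c' \<in> cyc (W - {q}) (k + 1) \<and> c - c' \<in> bnd W (k + 1)"
proof (rule push_off[OF assms(1,3,4)])
  fix a assume a: "a \<in> W" "q \<noteq> a"
  have "3 * (k + 1 - 1) + 2 \<le> int (card (W - {q, a}))"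
    using card_minus[OF assms(1), of "{q, a}" 2] a assms by auto
  then show "cyc (W - {q, a}) (k + 1 - 1) \<subseteq> (bnd (W - {q, a}) (k + 1 - 1) :: ('e set \<Rightarrow> 'k) set)"
    using assms(1) by (intro exact_complete) auto
qed blast

text \<open>Frees a vertex \<open>a\<close> without changing the value of \<open>\<phi>\<close>;
  exchanges of disjoint edges need this room.\<close>

lemma ex_cyc_off_small:
  fixes z :: "'e set \<Rightarrow> 'k"
  assumes "V \<subseteq> U" "int (card V) = 3 * k + 1" "a \<in> V" "z \<in> cyc V k"
  shows "\<exists>z'. z' \<in> cyc (V - {a}) k \<and> z - z' \<in> bnd V k \<and> \<phi> V z = \<phi> V z'"
proof (rule push_off[OF assms(1,3,4)])
  fix x assume x: "x \<in> V" "a \<noteq> x"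
  have "3 * (k - 1) + 2 \<le> int (card (V - {a, x}))"
    using card_minus[OF assms(1), of "{a, x}" 2] x assms by auto
  then show "cyc (V - {a, x}) (k - 1) \<subseteq> (bnd (V - {a, x}) (k - 1) :: ('e set \<Rightarrow> 'k) set)"
    using assms(1) by (intro exact_complete) auto
next
  fix z' :: "'e set \<Rightarrow> 'k"
  assume "z' \<in> cyc (V - {a}) k" "z - z' \<in> bnd V k"
  moreover from this(1) have "z' \<in> cyc V k" by (rule cyc_mono) (use assms in auto)
  ultimately show ?thesis using phi_cong[OF assms(1,2,4)] by blast
qed

text \<open>Extends \<open>next_off\<close> to cycles that may use \<open>q\<close>. By
  \<open>next_off_bnd\<close> every representative off \<open>q\<close> gives the same
  value.\<close>

definition next_fun :: "'v set \<Rightarrow> 'v \<Rightarrow> 'v \<Rightarrow> ('e set \<Rightarrow> 'k) \<Rightarrow> 'k" where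
  "next_fun W p q c = next_off W p q (SOME c'. c' \<in> cyc (W - {q}) (k + 1) \<and> c - c' \<in> bnd W (k + 1))"

lemma next_fun_eq:
  assumes W: "W \<subseteq> U" "int (card W) = 3 * k + 4" and pq: "p \<in> W" "q \<in> W" "p \<noteq> q"
    and c: "c' \<in> cyc (W - {q}) (k + 1)" "c - c' \<in> bnd W (k + 1)"
  shows "next_fun W p q c = next_off W p q c'"
proof -
  define d where "d = (SOME c'. c' \<in> cyc (W - {q}) (k + 1) \<and> c - c' \<in> bnd W (k + 1))"
  have d: "d \<in> cyc (W - {q}) (k + 1)" "c - d \<in> bnd W (k + 1)"
    unfolding d_def using someI[of "\<lambda>c'. c' \<in> cyc (W - {q}) (k + 1) \<and> c - c' \<in> bnd W (k + 1)" c'] c by auto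
  have "d - c' \<in> bnd W (k + 1)" by (rule bnd_trans[OF bnd_sym[OF d(2)] c(2)])
  then have "next_off W p q (d - c') = 0" using d(1) c(1) by (intro next_off_bnd[OF W pq]) auto
  moreover have "next_off W p q ((d - c') + c') = next_off W p q (d - c') + next_off W p q c'"
    by (rule next_off_add[OF W pq]) (use d(1) c(1) in auto)
  ultimately show ?thesis by (simp add: next_fun_def d_def)
qed

lemma next_fun_add:
  assumes W: "W \<subseteq> U" "int (card W) = 3 * k + 4" and pq: "p \<in> W" "q \<in> W" "p \<noteq> q"
    and c: "c \<in> cyc W (k + 1)" "d \<in> cyc W (k + 1)"
  shows "next_fun W p q (c + d) = next_fun W p q c + next_fun W p q d"
proof -
  obtain c' where c': "c' \<in> cyc (W - {q}) (k + 1)" "c - c' \<in> bnd W (k + 1)"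
    using ex_cyc_off[OF W pq(2) c(1)] by blast
  obtain d' where d': "d' \<in> cyc (W - {q}) (k + 1)" "d - d' \<in> bnd W (k + 1)"
    using ex_cyc_off[OF W pq(2) c(2)] by blast
  have "c + d - (c' + d') = (c - c') + (d - d')" by simp
  also have "\<dots> \<in> bnd W (k + 1)" by (rule bnd_add[OF c'(2) d'(2)])
  finally have "next_fun W p q (c + d) = next_off W p q (c' + d')"
    using c'(1) d'(1) by (intro next_fun_eq[OF W pq]) auto
  then show ?thesis
    by (simp add: next_off_add[OF W pq c'(1) d'(1)] next_fun_eq[OF W pq c'] next_fun_eq[OF W pq d'])
qed

lemma next_off_zero: "W \<subseteq> U \<Longrightarrow> int (card W) = 3 * k + 4 \<Longrightarrow> p \<in> W \<Longrightarrow> q \<in> W \<Longrightarrow> p \<noteq> q \<Longrightarrow> next_off W p q 0 = 0"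
  by (rule next_off_bnd) simp_all

lemma next_fun_bnd:
  assumes W: "W \<subseteq> U" "int (card W) = 3 * k + 4" and pq: "p \<in> W" "q \<in> W" "p \<noteq> q"
    and c: "c \<in> bnd W (k + 1)"
  shows "next_fun W p q c = 0"
  using next_fun_eq[OF W pq, of 0 c] c next_off_zero[OF W pq] by simp

lemma next_fun_cong:
  assumes W: "W \<subseteq> U" "int (card W) = 3 * k + 4" and pq: "p \<in> W" "q \<in> W" "p \<noteq> q"
    and c: "c \<in> cyc W (k + 1)" "c - d \<in> bnd W (k + 1)"
  shows "next_fun W p q c = next_fun W p q d"
proof -
  have "d = c - (c - d)" by simp
  then have "d \<in> cyc W (k + 1)" using c bnd_cyc[OF c(2) W(1)] cyc_diff[OF c(1)] by metis
  then have "next_fun W p q ((c - d) + d) = next_fun W p q (c - d) + next_fun W p q d"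
    by (intro next_fun_add[OF W pq] bnd_cyc[OF c(2) W(1)])
  then show ?thesis using next_fun_bnd[OF W pq c(2)] by simp
qed

lemma next_fun_minus:
  assumes W: "W \<subseteq> U" "int (card W) = 3 * k + 4" and pq: "p \<in> W" "q \<in> W" "p \<noteq> q"
    and c: "c \<in> cyc W (k + 1)"
  shows "next_fun W p q (- c) = - next_fun W p q c"
proof -
  have "next_fun W p q (c + - c) = next_fun W p q c + next_fun W p q (- c)"
    by (rule next_fun_add[OF W pq c]) (use c in auto)
  then show ?thesis using next_fun_bnd[OF W pq, of 0] by (simp add: eq_neg_iff_add_eq_0 add.commute)
qed

lemma cherry_cyc':
  assumes "W \<subseteq> U" "{p, h, q} \<subseteq> W" "distinct [p, h, q]" "z \<in> cyc (W - {p, h, q}) k"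
  shows "cherry p h q z \<in> cyc W (k + 1)"
  by (rule cherry_cyc[OF assms(4)]) (use assms in auto)

text \<open>The path \<open>h - p - q\<close> uses \<open>q\<close>, so it is first replaced by
  \<open>p - h - a\<close>, where \<open>a\<close> is a vertex that \<open>z\<close> can be pushed
  off: the edges \<open>ha\<close> and \<open>pq\<close> are disjoint. The new path has
  \<open>ph\<close> as its only edge at \<open>p\<close>, so one term of \<open>next_off\<close>
  survives.\<close>

lemma next_fun_cherry:
  assumes W: "W \<subseteq> U" "int (card W) = 3 * k + 4"
    and phq: "{p, h, q} \<subseteq> W" "distinct [p, h, q]" and z: "z \<in> cyc (W - {p, h, q}) k"
  shows "next_fun W p q (cherry p h q z) = front_sign W q p h * \<phi> (W - {p, h, q}) z"
proof -
  let ?V = "W - {p, h, q}"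
  have V: "?V \<subseteq> U" "int (card ?V) = 3 * k + 1"
    using card_minus[OF W(1) phq(1), of 3] W phq by auto
  then have "?V \<noteq> {}" using k_nonneg by (intro notI) simp
  then obtain a where a: "a \<in> ?V" by blast
  obtain z' where z': "z' \<in> cyc (?V - {a}) k" "z - z' \<in> bnd ?V k" "\<phi> ?V z = \<phi> ?V z'"
    using ex_cyc_off_small[OF V a z] by blast
  have inU: "x \<in> U" if "x \<in> W" for x using that W by auto
  let ?c = "cherry h p a z'"
  have "z' \<in> cyc (W - {q} - {h, p, a}) k" by (rule cyc_mono[OF z'(1)]) (use W in auto)
  then have c: "?c \<in> cyc (W - {q}) (k + 1)"
    by (rule cherry_cyc) (use W phq a in auto)
  have "cherry p h q z - cherry p h q z' \<in> bnd W (k + 1)"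
    unfolding cherry_diff[symmetric] by (rule cherry_bnd[OF z'(2)]) (use W phq in auto)
  moreover have "cherry p h q z' - ?c \<in> bnd W (k + 1)"
  proof -
    have "z' \<in> cyc (W - {h, a, p, q}) k" by (rule cyc_mono[OF z'(1)]) (use W in auto)
    then have "wedge (ed h a) z' - wedge (ed p q) z' \<in> bnd W (k + 1)"
      by (rule disjoint_edges_homologous) (use W phq a in auto)
    then show ?thesis by (simp add: cherry_def ed_commute[of h p])
  qed
  ultimately have "cherry p h q z - ?c \<in> bnd W (k + 1)" by (rule bnd_trans)
  then have next_eq: "next_fun W p q (cherry p h q z) = next_off W p q ?c"
    using phq by (intro next_fun_eq[OF W _ _ _ c]) auto
  have con: "contract (ed p x) ?c = (if x = h then z' else 0)" if x: "x \<in> W - {p, q}" for x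
  proof -
    have U: "p \<in> U" "x \<in> U" "p \<noteq> x" "h \<in> U" "a \<in> U" "p \<noteq> h" "h \<noteq> a" "p \<noteq> a"
      using x phq a inU by auto
    have 0: "contract (ed p x) z' = 0"
      by (rule contract_eq_0[OF cyc_chains[OF z'(1)]]) (use U W in auto)
    have "ed p x \<noteq> ed h a" using ed_eqD[of p x h a] U by (auto simp: doubleton_eq_iff)
    then have 1: "contract (ed p x) (wedge (ed h a) z') = 0" using U 0 by (simp add: contract_wedge ed_in_E)
    show ?thesis
    proof (cases "x = h")
      case True
      then show ?thesis using 0 1 by (simp add: cherry_def ed_commute[of h p] contract_wedge_self)
    next
      case False
      then have "ed p x \<noteq> ed p h" using ed_distinct[of p x h] U by auto
      then show ?thesis using False 0 1 U by (simp add: cherry_def ed_commute[of h p] contract_wedge ed_in_E)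
    qed
  qed
  have "next_off W p q ?c = pos_sign W q * pos_sign (W - {q}) p *
      (\<Sum>x\<in>W - {p, q}. if x = h then pos_sign (W - {p, q}) h * \<phi> ?V z' else 0)"
  proof -
    have "pos_sign (W - {p, q}) x * \<phi> (W - {p, x, q}) (contract (ed p x) ?c)
        = (if x = h then pos_sign (W - {p, q}) h * \<phi> ?V z' else 0)" if x: "x \<in> W - {p, q}" for x
    proof (cases "x = h")
      case False
      have "int (card (W - {p, x, q})) = 3 * k + 1"
        using card_minus[OF W(1), of "{p, x, q}" 3] x phq W by auto
      moreover have "W - {p, x, q} \<subseteq> U" using W(1) by auto
      ultimately have "\<phi> (W - {p, x, q}) 0 = 0" by (intro phi_zero)
      then show ?thesis using False con[OF x] by simp
    qed (use con[OF x] in simp)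
    then have "(\<Sum>x\<in>W - {p, q}. pos_sign (W - {p, q}) x * \<phi> (W - {p, x, q}) (contract (ed p x) ?c))
        = (\<Sum>x\<in>W - {p, q}. if x = h then pos_sign (W - {p, q}) h * \<phi> ?V z' else 0)"
      by (intro sum.cong refl)
    then show ?thesis by (simp only: next_off_def)
  qed
  also have "\<dots> = front_sign W q p h * \<phi> ?V z"
  proof -
    have "h \<in> W - {p, q}" "finite (W - {p, q})" using phq finite_sub[OF W(1)] by auto
    then show ?thesis using z'(3) by (simp add: front_sign_def insert_commute mult.assoc)
  qed
  finally have "next_off W p q ?c = front_sign W q p h * \<phi> ?V z" .
  with next_eq show ?thesis by simp
qed

end

lemma front_sign_swap13:
  assumes "finite V" "{a, b, c} \<subseteq> V" "distinct [a, b, c]"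
  shows "(front_sign V a b c :: 'k::comm_ring_1) = - front_sign V c b a"
proof -
  have "(front_sign V a b c :: 'k) = - front_sign V b a c"
    by (rule front_sign_swap12) (use assms in auto)
  also have "(front_sign V b a c :: 'k) = - front_sign V b c a"
    by (rule front_sign_swap23) (use assms in auto)
  also have "(front_sign V b c a :: 'k) = - front_sign V c b a"
    by (rule front_sign_swap12) (use assms in auto)
  finally show ?thesis by simp
qed

lemma front_sign_rotate:
  assumes "finite V" "{a, b, c} \<subseteq> V" "distinct [a, b, c]"
  shows "(front_sign V a b c :: 'k::comm_ring_1) = front_sign V b c a"
proof -
  have "(front_sign V a b c :: 'k) = - front_sign V b a c"
    by (rule front_sign_swap12) (use assms in auto)
  also have "(front_sign V b a c :: 'k) = - front_sign V b c a"
    by (rule front_sign_swap23) (use assms in auto)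
  finally show ?thesis by simp
qed

context coherent_family
begin

lemma double_eq_minus: "x + x = - (x :: 'k)"
proof -
  have "x + x + x = 3 * x" by simp
  then show ?thesis using char3 by (simp add: eq_neg_iff_add_eq_0)
qed

lemma coherent_front:
  assumes W: "W \<subseteq> U" "int (card W) = 3 * k + 4" and abxy: "{a, b, x, y} \<subseteq> W" "distinct [a, b, x, y]"
    and z: "z \<in> cyc (W - {a, b, x, y}) k"
  shows "front_sign W a b x * \<phi> (W - {a, b, x}) z = - (front_sign W a b y * \<phi> (W - {a, b, y}) z)"
proof -
  have V: "W - {a, b} \<subseteq> U" "int (card (W - {a, b})) = 3 * k + 2"
    using card_minus[OF W(1), of "{a, b}" 2] W abxy by auto
  have eq: "W - {a, b} - {x} = W - {a, b, x}" "W - {a, b} - {y} = W - {a, b, y}"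
    "W - {a, b} - {x, y} = W - {a, b, x, y}" by auto
  have "pos_sign (W - {a, b}) x * \<phi> (W - {a, b, x}) z + pos_sign (W - {a, b}) y * \<phi> (W - {a, b, y}) z = 0"
    using coherent[OF V, of x y z] abxy z unfolding eq by auto
  then have "pos_sign (W - {a, b}) x * \<phi> (W - {a, b, x}) z = - (pos_sign (W - {a, b}) y * \<phi> (W - {a, b, y}) z)"
    by (simp add: eq_neg_iff_add_eq_0)
  then show ?thesis by (simp add: front_sign_def mult.assoc)
qed

lemma next_fun_sum:
  assumes W: "W \<subseteq> U" "int (card W) = 3 * k + 4" and pq: "p \<in> W" "q \<in> W" "p \<noteq> q"
    and "finite A" "\<And>x. x \<in> A \<Longrightarrow> f x \<in> cyc W (k + 1)"
  shows "next_fun W p q (\<Sum>x\<in>A. f x) = (\<Sum>x\<in>A. next_fun W p q (f x))"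
  using assms(6,7)
proof (induction A)
  case empty
  show ?case using next_fun_bnd[OF W pq, of 0] by simp
next
  case (insert x A)
  then have "(\<Sum>x\<in>A. f x) \<in> cyc W (k + 1)" by (intro cyc_sum) auto
  then show ?case using insert by (simp add: next_fun_add[OF W pq])
qed

text \<open>
  This allows the chosen vertices to be exchanged one at a time. The exchange produces a factor
  \<open>1 + 1 = - 1\<close>, which is where characteristic 3 enters.
\<close>

lemma next_fun_agree:
  assumes W: "W \<subseteq> U" "int (card W) = 3 * k + 4" and pq: "p \<in> W" "q \<in> W" "p \<noteq> q"
    and uw: "u \<in> W" "w \<in> W" "u \<noteq> w" and c: "c \<in> cyc W (k + 1)"
    and agree: "\<And>h z. h \<in> W - {u, w} \<Longrightarrow> z \<in> cyc (W - {u, h, w}) k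
      \<Longrightarrow> next_fun W p q (cherry u h w z) = front_sign W w u h * \<phi> (W - {u, h, w}) z"
  shows "next_fun W p q c = next_fun W u w c"
proof -
  have "cyc (W - {w, a}) (k + 1 - 1) \<subseteq> (bnd (W - {w, a}) (k + 1 - 1) :: ('e set \<Rightarrow> 'k) set)"
    if a: "a \<in> W" "w \<noteq> a" for a
  proof -
    have "3 * (k + 1 - 1) + 2 \<le> int (card (W - {w, a}))"
      using card_minus[OF W(1), of "{w, a}" 2] a uw W by auto
    then show ?thesis using W(1) by (intro exact_complete) auto
  qed
  from expand[OF W(1) uw c this] obtain z where
    z: "\<And>h. h \<in> W - {w} \<Longrightarrow> u \<noteq> h \<Longrightarrow> z h \<in> cyc (W - {u, h, w}) k"
    and zc: "c - (\<Sum>h | h \<in> W - {w} \<and> u \<noteq> h. cherry u h w (z h)) \<in> bnd W (k + 1)"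
    by auto
  let ?N = "{h. h \<in> W - {w} \<and> u \<noteq> h}"
  have N: "finite ?N" using finite_sub[OF W(1)] by simp
  have mem: "cherry u h w (z h) \<in> cyc W (k + 1)" if "h \<in> ?N" for h
    by (rule cherry_cyc'[OF W(1)]) (use that z uw in auto)
  have "next_fun W p q c = (\<Sum>h\<in>?N. next_fun W p q (cherry u h w (z h)))"
    by (simp only: next_fun_cong[OF W pq c zc] next_fun_sum[OF W pq N mem])
  also have "\<dots> = (\<Sum>h\<in>?N. next_fun W u w (cherry u h w (z h)))"
  proof (rule sum.cong[OF refl])
    fix h assume h: "h \<in> ?N"
    have "next_fun W u w (cherry u h w (z h)) = front_sign W w u h * \<phi> (W - {u, h, w}) (z h)"
      by (rule next_fun_cherry[OF W]) (use h z uw in auto)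
    then show "next_fun W p q (cherry u h w (z h)) = next_fun W u w (cherry u h w (z h))"
      using agree[of h "z h"] h z by auto
  qed
  also have "\<dots> = next_fun W u w c"
    by (simp only: next_fun_cong[OF W uw c zc] next_fun_sum[OF W uw N mem])
  finally show ?thesis .
qed

text \<open>For \<open>h = q\<close> the path is only reversed. Otherwise \<open>h - p - q'\<close>
  is the difference of the paths \<open>h - p - q\<close> and \<open>q' - p - q\<close>. By
  coherence the two values are opposite, so their difference is a double, which equals a negative in
  characteristic 3; coherence also supplies the sign for replacing \<open>q\<close> by
  \<open>q'\<close>.\<close>

lemma next_fun_change2:
  assumes W: "W \<subseteq> U" "int (card W) = 3 * k + 4" and pqq: "{p, q, q'} \<subseteq> W" "distinct [p, q, q']"
    and c: "c \<in> cyc W (k + 1)"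
  shows "next_fun W p q c = next_fun W p q' c"
proof (rule next_fun_agree[OF W])
  show "p \<in> W" "q \<in> W" "p \<noteq> q" "p \<in> W" "q' \<in> W" "p \<noteq> q'" "c \<in> cyc W (k + 1)" using pqq c by auto
  have fin: "finite W" by (rule finite_sub[OF W(1)])
  have pq: "p \<in> W" "q \<in> W" "p \<noteq> q" using pqq by auto
  fix h and z :: "'e set \<Rightarrow> 'k" assume h: "h \<in> W - {p, q'}" and z: "z \<in> cyc (W - {p, h, q'}) k"
  show "next_fun W p q (cherry p h q' z) = front_sign W q' p h * \<phi> (W - {p, h, q'}) z"
  proof (cases "h = q")
    case True
    have z': "z \<in> cyc (W - {p, q', q}) k" using z True by (simp add: insert_commute)
    have "next_fun W p q (cherry p q' q z) = front_sign W q p q' * \<phi> (W - {p, q', q}) z"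
      by (rule next_fun_cherry[OF W _ _ z']) (use pqq in auto)
    moreover have "cherry p q' q z \<in> cyc W (k + 1)"
      by (rule cherry_cyc'[OF W(1) _ _ z']) (use pqq in auto)
    moreover have "(front_sign W q p q' :: 'k) = - front_sign W q' p q"
      by (rule front_sign_swap13[OF fin]) (use pqq in auto)
    ultimately show ?thesis
      using True next_fun_minus[OF W pq, of "cherry p q' q z"]
      by (simp add: cherry_swap[of p q q'] insert_commute)
  next
    case False
    have V: "W - {p, h, q'} \<subseteq> U" "int (card (W - {p, h, q'})) = 3 * k + 1" "q \<in> W - {p, h, q'}"
      using card_minus[OF W(1), of "{p, h, q'}" 3] W h pqq False by auto
    obtain y where y: "y \<in> cyc (W - {p, h, q'} - {q}) k" "z - y \<in> bnd (W - {p, h, q'}) k"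
      "\<phi> (W - {p, h, q'}) z = \<phi> (W - {p, h, q'}) y"
      using ex_cyc_off_small[OF V z] by blast
    have sub: "W - {p, h, q'} - {q} = W - {p, h, q', q}" by auto
    have y1: "y \<in> cyc (W - {p, h, q}) k" "y \<in> cyc (W - {p, q', q}) k"
      by (rule cyc_mono[OF y(1)]; use W in auto)+
    have y2: "y \<in> cyc (W - {q, p, h, q'}) k" "y \<in> cyc (W - {p, h, q, q'}) k"
      using y(1) unfolding sub by (simp_all add: insert_commute)
    have "cherry p h q' z - cherry p h q' y \<in> bnd W (k + 1)"
      unfolding cherry_diff[symmetric] by (rule cherry_bnd[OF y(2)]) (use W pqq h in auto)
    then have "next_fun W p q (cherry p h q' z) = next_fun W p q (cherry p h q' y)"
      by (intro next_fun_cong[OF W pq] cherry_cyc'[OF W(1) _ _ z]) (use pqq h in auto)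
    also have "cherry p h q' y = cherry p h q y + - cherry p q' q y" by (simp add: cherry_def)
    also have "next_fun W p q \<dots> = next_fun W p q (cherry p h q y) + next_fun W p q (- cherry p q' q y)"
      by (intro next_fun_add[OF W pq] cyc_minus cherry_cyc'[OF W(1)] y1) (use pqq h False in auto)
    also have "next_fun W p q (- cherry p q' q y) = - next_fun W p q (cherry p q' q y)"
      by (intro next_fun_minus[OF W pq] cherry_cyc'[OF W(1)] y1) (use pqq in auto)
    also have "next_fun W p q (cherry p h q y) = front_sign W q p h * \<phi> (W - {p, h, q}) y"
      by (rule next_fun_cherry[OF W _ _ y1(1)]) (use pqq h False in auto)
    also have "next_fun W p q (cherry p q' q y) = front_sign W q p q' * \<phi> (W - {p, q', q}) y"
      by (rule next_fun_cherry[OF W _ _ y1(2)]) (use pqq in auto)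
    also have "front_sign W q p q' * \<phi> (W - {p, q', q}) y = - (front_sign W q p h * \<phi> (W - {p, h, q}) y)"
    proof -
      have "front_sign W q p h * \<phi> (W - {q, p, h}) y = - (front_sign W q p q' * \<phi> (W - {q, p, q'}) y)"
        by (rule coherent_front[OF W _ _ y2(1)]) (use pqq h False in auto)
      then show ?thesis by (simp add: insert_commute)
    qed
    finally have "next_fun W p q (cherry p h q' z) = - (front_sign W q p h * \<phi> (W - {p, h, q}) y)"
      by (simp add: double_eq_minus)
    also have "front_sign W q p h * \<phi> (W - {p, h, q}) y = - (front_sign W q' p h * \<phi> (W - {p, h, q'}) y)"
    proof -
      have "front_sign W p h q * \<phi> (W - {p, h, q}) y = - (front_sign W p h q' * \<phi> (W - {p, h, q'}) y)"
        by (rule coherent_front[OF W _ _ y2(2)]) (use pqq h False in auto)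
      moreover have "(front_sign W q p h :: 'k) = front_sign W p h q"
        "(front_sign W q' p h :: 'k) = front_sign W p h q'"
        by (rule front_sign_rotate[OF fin]; use pqq h False in auto)+
      ultimately show ?thesis by simp
    qed
    finally show ?thesis using y(3) by simp
  qed
qed

text \<open>For \<open>h \<noteq> p\<close> the paths from \<open>h\<close> to \<open>q\<close> over
  \<open>p'\<close> and over \<open>p\<close> add up to two differences of disjoint edges, so they
  are opposite in homology. For \<open>h = p\<close> the path is, up to the disjoint edges
  \<open>pa\<close> and \<open>p'q\<close>, a difference of two paths centred at \<open>p\<close>,
  and the doubling of values occurs again.\<close>

lemma next_fun_change1:
  assumes W: "W \<subseteq> U" "int (card W) = 3 * k + 4" and ppq: "{p, p', q} \<subseteq> W" "distinct [p, p', q]"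
    and c: "c \<in> cyc W (k + 1)"
  shows "next_fun W p q c = next_fun W p' q c"
proof (rule next_fun_agree[OF W])
  show "p \<in> W" "q \<in> W" "p \<noteq> q" "p' \<in> W" "q \<in> W" "p' \<noteq> q" "c \<in> cyc W (k + 1)" using ppq c by auto
  have fin: "finite W" by (rule finite_sub[OF W(1)])
  have pq: "p \<in> W" "q \<in> W" "p \<noteq> q" using ppq by auto
  fix h and z :: "'e set \<Rightarrow> 'k" assume h: "h \<in> W - {p', q}" and z: "z \<in> cyc (W - {p', h, q}) k"
  have V: "W - {p', h, q} \<subseteq> U" "int (card (W - {p', h, q})) = 3 * k + 1"
    using card_minus[OF W(1), of "{p', h, q}" 3] W h ppq by auto
  have lift: "next_fun W p q (cherry p' h q z) = next_fun W p q (cherry p' h q y)"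
    if "z - y \<in> bnd (W - {p', h, q}) k" for y
  proof -
    have "cherry p' h q z - cherry p' h q y \<in> bnd W (k + 1)"
      unfolding cherry_diff[symmetric] by (rule cherry_bnd[OF that]) (use W ppq h in auto)
    then show ?thesis
      by (intro next_fun_cong[OF W pq] cherry_cyc'[OF W(1) _ _ z]) (use ppq h in auto)
  qed
  show "next_fun W p q (cherry p' h q z) = front_sign W q p' h * \<phi> (W - {p', h, q}) z"
  proof (cases "h = p")
    case True
    have "W - {p', h, q} \<noteq> {}" using V(2) k_nonneg by (intro notI) simp
    then obtain a where a: "a \<in> W - {p', h, q}" by blast
    obtain y where y: "y \<in> cyc (W - {p', h, q} - {a}) k" "z - y \<in> bnd (W - {p', h, q}) k"
      "\<phi> (W - {p', h, q}) z = \<phi> (W - {p', h, q}) y"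
      using ex_cyc_off_small[OF V a z] by blast
    have y1: "y \<in> cyc (W - {p, p', q}) k" "y \<in> cyc (W - {p, a, q}) k" "y \<in> cyc (W - {q, p, p', a}) k"
      "y \<in> cyc (W - {p, a, p', q}) k" "y \<in> cyc (W - {p', p, q}) k"
      by (rule cyc_mono[OF y(1)]; use W True in auto)+
    have "cherry p' p q y - (cherry p p' q y + - cherry p a q y) = wedge (ed p a) y - wedge (ed p' q) y"
      by (simp add: cherry_def ed_commute[of p' p])
    also have "\<dots> \<in> bnd W (k + 1)"
      by (rule disjoint_edges_homologous[OF y1(4)]) (use W ppq a True in auto)
    finally have "next_fun W p q (cherry p' p q y) = next_fun W p q (cherry p p' q y + - cherry p a q y)"
      by (intro next_fun_cong[OF W pq] cherry_cyc'[OF W(1) _ _ y1(5)]) (use ppq in auto)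
    also have "\<dots> = next_fun W p q (cherry p p' q y) + next_fun W p q (- cherry p a q y)"
      by (intro next_fun_add[OF W pq] cyc_minus cherry_cyc'[OF W(1)] y1) (use ppq a True in auto)
    also have "next_fun W p q (- cherry p a q y) = - next_fun W p q (cherry p a q y)"
      by (intro next_fun_minus[OF W pq] cherry_cyc'[OF W(1)] y1) (use ppq a True in auto)
    also have "next_fun W p q (cherry p p' q y) = front_sign W q p p' * \<phi> (W - {p, p', q}) y"
      by (rule next_fun_cherry[OF W _ _ y1(1)]) (use ppq in auto)
    also have "next_fun W p q (cherry p a q y) = front_sign W q p a * \<phi> (W - {p, a, q}) y"
      by (rule next_fun_cherry[OF W _ _ y1(2)]) (use ppq a True in auto)
    also have "front_sign W q p a * \<phi> (W - {p, a, q}) y = - (front_sign W q p p' * \<phi> (W - {p, p', q}) y)"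
    proof -
      have "front_sign W q p p' * \<phi> (W - {q, p, p'}) y = - (front_sign W q p a * \<phi> (W - {q, p, a}) y)"
        by (rule coherent_front[OF W _ _ y1(3)]) (use ppq a True in auto)
      then show ?thesis by (simp add: insert_commute)
    qed
    finally have "next_fun W p q (cherry p' p q y) = - (front_sign W q p p' * \<phi> (W - {p, p', q}) y)"
      by (simp add: double_eq_minus)
    moreover have "(front_sign W q p p' :: 'k) = - front_sign W q p' p"
      by (rule front_sign_swap23[OF fin]) (use ppq in auto)
    ultimately show ?thesis using lift[OF y(2)] y(3) True by (simp add: insert_commute)
  next
    case False
    then have p: "p \<in> W - {p', h, q}" using ppq by auto
    obtain y where y: "y \<in> cyc (W - {p', h, q} - {p}) k" "z - y \<in> bnd (W - {p', h, q}) k"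
      "\<phi> (W - {p', h, q}) z = \<phi> (W - {p', h, q}) y"
      using ex_cyc_off_small[OF V p z] by blast
    have y1: "y \<in> cyc (W - {p, h, q}) k" "y \<in> cyc (W - {q, h, p, p'}) k" "y \<in> cyc (W - {p', h, p, q}) k"
      "y \<in> cyc (W - {p, h, p', q}) k" "y \<in> cyc (W - {p', h, q}) k"
      by (rule cyc_mono[OF y(1)]; use W in auto)+
    have "cherry p' h q y - - cherry p h q y
        = (wedge (ed p' h) y - wedge (ed p q) y) + (wedge (ed p h) y - wedge (ed p' q) y)"
      by (simp add: cherry_def)
    also have "\<dots> \<in> bnd W (k + 1)"
      by (intro bnd_add disjoint_edges_homologous[OF y1(3)] disjoint_edges_homologous[OF y1(4)])
        (use W ppq h False in auto)
    finally have "next_fun W p q (cherry p' h q y) = next_fun W p q (- cherry p h q y)"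
      by (intro next_fun_cong[OF W pq] cherry_cyc'[OF W(1) _ _ y1(5)]) (use ppq h in auto)
    also have "\<dots> = - next_fun W p q (cherry p h q y)"
      by (intro next_fun_minus[OF W pq] cherry_cyc'[OF W(1)] y1) (use ppq h False in auto)
    also have "next_fun W p q (cherry p h q y) = front_sign W q p h * \<phi> (W - {p, h, q}) y"
      by (rule next_fun_cherry[OF W _ _ y1(1)]) (use ppq h False in auto)
    finally have *: "next_fun W p q (cherry p' h q y) = - (front_sign W q p h * \<phi> (W - {p, h, q}) y)" .
    have "front_sign W q h p * \<phi> (W - {q, h, p}) y = - (front_sign W q h p' * \<phi> (W - {q, h, p'}) y)"
      by (rule coherent_front[OF W _ _ y1(2)]) (use ppq h False in auto)
    moreover have "(front_sign W q p h :: 'k) = - front_sign W q h p"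
      "(front_sign W q p' h :: 'k) = - front_sign W q h p'"
      by (rule front_sign_swap23[OF fin]; use ppq h False in auto)+
    ultimately have "- (front_sign W q p h * \<phi> (W - {p, h, q}) y) = front_sign W q p' h * \<phi> (W - {p', h, q}) y"
      using ppq h False by (simp add: insert_commute)
    then show ?thesis using * lift[OF y(2)] y(3) by simp
  qed
qed

lemma next_fun_indep:
  assumes W: "W \<subseteq> U" "int (card W) = 3 * k + 4" and pq: "{p, q, p', q'} \<subseteq> W" "p \<noteq> q" "p' \<noteq> q'"
    and c: "c \<in> cyc W (k + 1)"
  shows "next_fun W p q c = next_fun W p' q' c"
proof -
  have 1: "next_fun W u w c = next_fun W u' w c" if "{u, u', w} \<subseteq> W" "u \<noteq> w" "u' \<noteq> w" for u u' w
    using next_fun_change1[OF W, of u u' w c] that c by (cases "u = u'") auto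
  have 2: "next_fun W u w c = next_fun W u w' c" if "{u, w, w'} \<subseteq> W" "u \<noteq> w" "u \<noteq> w'" for u w w'
    using next_fun_change2[OF W, of u w w' c] that c by (cases "w = w'") auto
  show ?thesis
  proof (cases "p = q'")
    \<comment> \<open>Replacing \<open>q\<close> by \<open>q' = p\<close> first would make the two
      vertices coincide, so the exchange takes a detour through a third vertex
      \<open>r\<close>.\<close>
    case True
    have "\<not> W \<subseteq> {p, q}"
    proof
      assume "W \<subseteq> {p, q}"
      then have "card W \<le> card {p, q}" by (intro card_mono) auto
      then show False using W(2) k_nonneg pq by simp
    qed
    then obtain r where r: "r \<in> W" "r \<noteq> p" "r \<noteq> q" by auto
    have "next_fun W p q c = next_fun W r q c" by (rule 1) (use r pq in auto)
    also have "\<dots> = next_fun W r q' c" by (rule 2) (use r pq True in auto)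
    also have "\<dots> = next_fun W p' q' c" by (rule 1) (use r pq True in auto)
    finally show ?thesis .
  next
    case False
    have "next_fun W p q c = next_fun W p q' c" by (rule 2) (use pq False in auto)
    also have "\<dots> = next_fun W p' q' c" by (rule 1) (use pq False in auto)
    finally show ?thesis .
  qed
qed

definition next_phi :: "'v set \<Rightarrow> ('e set \<Rightarrow> 'k) \<Rightarrow> 'k" where
  "next_phi W c = (let (p, q) = SOME (p, q). p \<in> W \<and> q \<in> W \<and> p \<noteq> q in next_fun W p q c)"

lemma next_phi_eq:
  assumes W: "W \<subseteq> U" "int (card W) = 3 * k + 4" and pq: "p \<in> W" "q \<in> W" "p \<noteq> q"
    and c: "c \<in> cyc W (k + 1)"
  shows "next_phi W c = next_fun W p q c"
proof -
  obtain p' q' where eq: "(SOME (p, q). p \<in> W \<and> q \<in> W \<and> p \<noteq> q) = (p', q')"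
    by (rule prod.exhaust)
  have "case (p', q') of (p, q) \<Rightarrow> p \<in> W \<and> q \<in> W \<and> p \<noteq> q"
    unfolding eq[symmetric] by (rule someI[of _ "(p, q)"]) (use pq in simp)
  then have "next_fun W p' q' c = next_fun W p q c"
    using pq by (intro next_fun_indep[OF W _ _ _ c]) auto
  then show ?thesis by (simp add: next_phi_def eq)
qed

lemma ex_two:
  assumes "W \<subseteq> U" "int (card W) = 3 * k + 4"
  obtains p q where "p \<in> W" "q \<in> W" "p \<noteq> q"
proof -
  have "\<not> card W \<le> Suc 0" using assms(2) k_nonneg by simp
  then show ?thesis using card_le_Suc0_iff_eq[OF finite_sub[OF assms(1)]] that by blast
qed

lemma next_phi_cherry:
  assumes W: "W \<subseteq> U" "int (card W) = 3 * k + 4"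
    and phq: "{p, h, q} \<subseteq> W" "distinct [p, h, q]" and z: "z \<in> cyc (W - {p, h, q}) k"
  shows "next_phi W (cherry p h q z) = front_sign W q p h * \<phi> (W - {p, h, q}) z"
  using next_phi_eq[OF W, of p q, OF _ _ _ cherry_cyc'[OF W(1) phq z]] next_fun_cherry[OF W phq z] phq by simp

theorem coherent_next: "coherent_family E U ed (k + 1) next_phi"
proof (unfold_locales, goal_cases)
  case 1
  show ?case by (rule char3)
next
  case 2
  show ?case using k_nonneg by simp
next
  case (3 V c c')
  then have card: "int (card V) = 3 * k + 4" by simp
  obtain p q where pq: "p \<in> V" "q \<in> V" "p \<noteq> q" by (rule ex_two[OF 3(1) card])
  show ?case
    using next_phi_eq[OF 3(1) card pq cyc_add[OF 3(3,4)]] next_phi_eq[OF 3(1) card pq 3(3)]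
      next_phi_eq[OF 3(1) card pq 3(4)] next_fun_add[OF 3(1) card pq 3(3,4)] by simp
next
  case (4 V c)
  then have card: "int (card V) = 3 * k + 4" by simp
  obtain p q where pq: "p \<in> V" "q \<in> V" "p \<noteq> q" by (rule ex_two[OF 4(1) card])
  show ?case
    using next_phi_eq[OF 4(1) card pq bnd_cyc[OF 4(3,1)]] next_fun_bnd[OF 4(1) card pq 4(3)] by simp
next
  case (5 V x y z)
  have card: "int (card V) = 3 * k + 5" using 5(2) by simp
  have eq: "V - {x} - {y} = V - {x, y}" "V - {y} - {x} = V - {x, y}" by auto
  have Vx: "V - {x} \<subseteq> U" "int (card (V - {x})) = 3 * k + 4"
    using card_minus[OF 5(1), of "{x}" 1] 5 card by auto
  have Vy: "V - {y} \<subseteq> U" "int (card (V - {y})) = 3 * k + 4"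
    using card_minus[OF 5(1), of "{y}" 1] 5 card by auto
  have "int (card (V - {x, y})) = 3 * k + 3"
    using card_minus[OF 5(1), of "{x, y}" 2] 5 card by auto
  then have "V - {x, y} \<noteq> {}" using k_nonneg by (intro notI) simp
  then obtain p where p: "p \<in> V" "p \<noteq> x" "p \<noteq> y" by auto
  \<comment> \<open>The cycle \<open>z\<close> avoids both \<open>x\<close> and \<open>y\<close>, so
    \<open>y\<close> can serve as the second auxiliary vertex in \<open>V - {x}\<close> and
    \<open>x\<close> in \<open>V - {y}\<close>. With the same \<open>p\<close> both values contain
    the sum \<open>S\<close>, and only the order in which \<open>x\<close> and \<open>y\<close> are
    removed differs.\<close>
  define S where "S = (\<Sum>h\<in>V - {x, y, p}. pos_sign (V - {x, y, p}) h * \<phi> (V - {x, y, p, h}) (contract (ed p h) z))"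
  have "next_phi (V - {x}) z = next_off (V - {x}) p y z"
  proof -
    have zx: "z \<in> cyc (V - {x} - {y}) (k + 1)" using 5(6) eq by simp
    have "z \<in> cyc (V - {x}) (k + 1)" by (rule cyc_mono[OF zx]) (use Vx in auto)
    then have "next_phi (V - {x}) z = next_fun (V - {x}) p y z"
      by (intro next_phi_eq[OF Vx]) (use p 5 in auto)
    also have "\<dots> = next_off (V - {x}) p y z"
      by (rule next_fun_eq[OF Vx _ _ _ zx]) (use p 5 in auto)
    finally show ?thesis .
  qed
  also have "\<dots> = pos_sign (V - {x}) y * pos_sign (V - {x, y}) p * S"
  proof -
    have "V - {x} - {p, y} = V - {x, y, p}" "V - {x} - {p, h, y} = V - {x, y, p, h}" for h by auto
    then show ?thesis unfolding next_off_def S_def eq by simp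
  qed
  finally have 1: "next_phi (V - {x}) z = pos_sign (V - {x}) y * pos_sign (V - {x, y}) p * S" .
  have "next_phi (V - {y}) z = next_off (V - {y}) p x z"
  proof -
    have zy: "z \<in> cyc (V - {y} - {x}) (k + 1)" using 5(6) eq by simp
    have "z \<in> cyc (V - {y}) (k + 1)" by (rule cyc_mono[OF zy]) (use Vy in auto)
    then have "next_phi (V - {y}) z = next_fun (V - {y}) p x z"
      by (intro next_phi_eq[OF Vy]) (use p 5 in auto)
    also have "\<dots> = next_off (V - {y}) p x z"
      by (rule next_fun_eq[OF Vy _ _ _ zy]) (use p 5 in auto)
    finally show ?thesis .
  qed
  also have "\<dots> = pos_sign (V - {y}) x * pos_sign (V - {x, y}) p * S"
  proof -
    have "V - {y} - {p, x} = V - {x, y, p}" "V - {y} - {p, h, x} = V - {x, y, p, h}" for h by auto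
    then show ?thesis unfolding next_off_def S_def eq by simp
  qed
  finally have 2: "next_phi (V - {y}) z = pos_sign (V - {y}) x * pos_sign (V - {x, y}) p * S" .
  have "(pos_sign V x * pos_sign (V - {x}) y :: 'k) = - (pos_sign V y * pos_sign (V - {y}) x)"
    by (rule pos_sign_swap) (use 5 finite_sub in auto)
  then have "(pos_sign V x * pos_sign (V - {x}) y) * (pos_sign (V - {x, y}) p * S)
      + (pos_sign V y * pos_sign (V - {y}) x) * (pos_sign (V - {x, y}) p * S) = 0" by simp
  then show ?case unfolding 1 2 by (simp only: mult.assoc)
qed

end

text \<open>On one vertex there is only the empty face, and nothing bounds. Coherence on two
  vertices says that their positions have opposite signs.\<close>

lemma (in ordered_matchings) coherent_family_0:
  assumes char3: "(3::'k::comm_ring_1) = 0"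
  shows "coherent_family E U ed 0 (\<lambda>V c. c {} :: 'k)"
proof (unfold_locales, goal_cases)
  case (4 V c)
  then obtain x where V: "V = {x}" by (auto simp: card_1_singleton_iff)
  obtain b where b: "b \<in> chains V (0 + 1)" "c = bd b" using 4(3) by (rule bndE)
  have "b = 0" by (rule chains_no_edges[OF b(1)]) (use V in auto)
  then show ?case using b(2) by (simp add: pointwise)
next
  case (5 V x y z)
  have "finite V" using 5(1) finite_U finite_subset by blast
  moreover have "card V = card {x, y}" using 5 by simp
  ultimately have V: "V = {x, y}" using card_subset_eq[of V "{x, y}"] 5 by auto
  have "pos_sign V x + pos_sign V y = (0 :: 'k)"
  proof (cases "x < y")
    case True
    then have "{z \<in> V. z < x} = {}" "{z \<in> V. z < y} = {x}" unfolding V by auto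
    then have "card {z \<in> V. z < x} = 0" "card {z \<in> V. z < y} = 1"
      by (metis card.empty, metis One_nat_def card_1_singleton_iff)
    then show ?thesis by (simp add: pos_sign_def)
  next
    case False
    then have "{z \<in> V. z < x} = {y}" "{z \<in> V. z < y} = {}" unfolding V using 5(5) by auto
    then have "card {z \<in> V. z < x} = 1" "card {z \<in> V. z < y} = 0"
      by (metis One_nat_def card_1_singleton_iff, metis card.empty)
    then show ?thesis by (simp add: pos_sign_def)
  qed
  then show ?case by (simp flip: distrib_right)
qed (simp_all add: char3 pointwise)

section \<open>Comparison of the board with the complete graph\<close>

locale chessboard_matchings = edge_labelling E U ed +
  K: ordered_matchings E U ed + B: bipartite_matchings E U ed P
  for E :: "'e::linorder set" and U :: "'v::linorder set" and ed :: "'v \<Rightarrow> 'v \<Rightarrow> 'e" and P :: "'v \<Rightarrow> bool"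
begin

lemma faces_complete:
  assumes "\<sigma> \<in> B.faces V" "V \<subseteq> U"
  shows "\<sigma> \<in> K.faces V"
proof (rule K.facesI)
  show "\<exists>x\<in>V. \<exists>y\<in>V. x \<noteq> y \<and> e = ed x y" if e: "e \<in> \<sigma>" for e
  proof -
    obtain x y where "x \<in> V" "y \<in> V" "P x = (\<not> P y)" "e = ed x y"
      by (rule B.faces_edgeE[OF assms(1) e])
    moreover from this(3) have "x \<noteq> y" by auto
    ultimately show ?thesis by (intro bexI[of _ x] bexI[of _ y]) simp_all
  qed
  show "y = z" if xyz: "x \<in> V" "y \<in> V" "z \<in> V" "x \<noteq> y" "x \<noteq> z" "ed x y \<in> \<sigma>" "ed x z \<in> \<sigma>" for x y z
  proof (rule B.faces_unique[OF assms(1) xyz(1-3) _ _ xyz(6,7)])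
    show "P x = (\<not> P y)" by (rule B.ed_face_ends(3)[OF assms xyz(6)]) (use xyz assms(2) in auto)
    show "P x = (\<not> P z)" by (rule B.ed_face_ends(3)[OF assms xyz(7)]) (use xyz assms(2) in auto)
  qed
qed

lemma chains_complete: "c \<in> B.chains V k \<Longrightarrow> V \<subseteq> U \<Longrightarrow> c \<in> K.chains V k"
  by (rule K.chainsI) (auto dest: B.chainsD intro: faces_complete)

lemma cyc_complete: "c \<in> B.cyc V k \<Longrightarrow> V \<subseteq> U \<Longrightarrow> c \<in> K.cyc V k"
  by (simp add: B.cyc_def K.cyc_def chains_complete)

lemma bnd_complete: "c \<in> B.bnd V k \<Longrightarrow> V \<subseteq> U \<Longrightarrow> c \<in> K.bnd V k"
  by (auto elim!: B.bndE intro!: K.bndI chains_complete)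

text \<open>Each side only needs \<open>n\<close> vertices here, so the induction can start from a
  single vertex. In each step a path with both ends on the larger side is joined on, and this
  multiplies the value by a sign, which is a unit. A single family has to serve all
  \<open>V\<close>, as the recursion uses the values on all smaller vertex sets.\<close>

theorem ex_detecting_family:
  assumes char3: "(3::'k::comm_ring_1) = 0"
  shows "\<exists>\<phi>. coherent_family E U ed (int n) (\<phi> :: _ \<Rightarrow> _ \<Rightarrow> 'k) \<and>
    (\<forall>V\<subseteq>U. int n \<le> B.cnt True V \<longrightarrow> int n \<le> B.cnt False V \<longrightarrow>
      B.cnt True V + B.cnt False V = 3 * int n + 1 \<longrightarrow> (\<exists>z\<in>B.cyc V (int n). \<phi> V z \<noteq> 0))"
proof (induction n)
  case 0
  have "one_chain \<in> B.cyc V 0" for V by (rule B.one_cyc)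
  moreover have "(one_chain {} :: 'k) \<noteq> 0" by (simp add: one_chain_def)
  ultimately show ?case using K.coherent_family_0[OF char3] by (intro exI[of _ "\<lambda>V c. c {}"]) auto
next
  case (Suc n)
  then obtain \<phi> where \<phi>: "coherent_family E U ed (int n) (\<phi> :: _ \<Rightarrow> _ \<Rightarrow> 'k)"
    and IH: "\<And>V. \<lbrakk>V \<subseteq> U; int n \<le> B.cnt True V; int n \<le> B.cnt False V;
      B.cnt True V + B.cnt False V = 3 * int n + 1\<rbrakk> \<Longrightarrow> \<exists>z\<in>B.cyc V (int n). \<phi> V z \<noteq> 0"
    by blast
  interpret F: coherent_family E U ed "int n" \<phi> by (rule \<phi>)
  have nonzero: "\<exists>z\<in>B.cyc V (int n + 1). F.next_phi V z \<noteq> 0"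
    if V: "V \<subseteq> U" "int n + 1 \<le> B.cnt True V" "int n + 1 \<le> B.cnt False V"
      "B.cnt True V + B.cnt False V = 3 * int n + 4" for V
  proof -
    \<comment> \<open>Both ends of the path come from \<open>\<not> s\<close>. Two sides of at most
      \<open>n + 1\<close> vertices could not reach the total 3 n + 4.\<close>
    obtain s where s: "int n + 1 \<le> B.cnt s V" "int n + 2 \<le> B.cnt (\<not> s) V"
      "B.cnt s V + B.cnt (\<not> s) V = 3 * int n + 4"
    proof (cases "int n + 2 \<le> B.cnt False V")
      case True
      then show ?thesis using V by (intro that[of True]) simp_all
    next
      case False
      then show ?thesis using V by (intro that[of False]) simp_all
    qed
    obtain p where p: "p \<in> V" "P p = s" using B.cnt_pos_ex[of s V] s by auto
    obtain b where b: "b \<in> V" "P b = (\<not> s)" using B.cnt_pos_ex[of "\<not> s" V] s by auto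
    have "0 < B.cnt (\<not> s) (V - {b})" using B.cnt_Diff[OF _ V(1), of "{b}"] b s by simp
    then obtain q where q: "q \<in> V" "q \<noteq> b" "P q = (\<not> s)" using B.cnt_pos_ex by blast
    let ?W = "V - {p, b, q}"
    have dist: "p \<noteq> b" "p \<noteq> q" "b \<noteq> q" using p b q by auto
    then have W: "B.cnt t ?W = B.cnt t V - (if t = s then 1 else 2)" for t
      using p b q by (simp add: B.cnt_Diff[OF _ V(1)])
    have "int n \<le> B.cnt True ?W" "int n \<le> B.cnt False ?W" "B.cnt True ?W + B.cnt False ?W = 3 * int n + 1"
      using W s by (cases s; simp)+
    then obtain z where z: "z \<in> B.cyc ?W (int n)" "\<phi> ?W z \<noteq> 0"
      using IH[of ?W] V(1) by auto
    have cherry: "B.cherry p b q z \<in> B.cyc V (int n + 1)"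
      by (rule B.cherry_cyc[OF z(1)]) (use p b q V in auto)
    have "int (card V) = B.cnt True V + B.cnt False V"
    proof -
      have "V = {x \<in> V. P x = True} \<union> {x \<in> V. P x = False}" by auto
      moreover have "finite V" by (rule F.finite_sub[OF V(1)])
      ultimately show ?thesis unfolding B.cnt_def
        by (subst card_Un_disjoint[symmetric, THEN arg_cong[where f = int], simplified]) auto
    qed
    then have card: "int (card V) = 3 * int n + 4" using V(4) by simp
    have "z \<in> K.cyc ?W (int n)" by (rule cyc_complete[OF z(1)]) (use V(1) in auto)
    then have "F.next_phi V (K.cherry p b q z) = front_sign V q p b * \<phi> ?W z"
      by (intro F.next_phi_cherry[OF V(1) card]) (use p b q dist in auto)
    moreover have "front_sign V q p b * \<phi> ?W z \<noteq> 0"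
    proof
      assume "front_sign V q p b * \<phi> ?W z = 0"
      then have "(front_sign V q p b * front_sign V q p b) * \<phi> ?W z = 0" by (simp only: mult.assoc mult_zero_right)
      then show False using z(2) by (simp only: front_sign_square mult_1)
    qed
    moreover have "K.cherry p b q z = B.cherry p b q z" by (simp add: K.cherry_def B.cherry_def)
    ultimately have "F.next_phi V (B.cherry p b q z) \<noteq> 0" by simp
    then show ?thesis using cherry by (rule bexI)
  qed
  have "int (Suc n) = int n + 1" "3 * (int n + 1) + 1 = 3 * int n + 4" by simp_all
  then show ?case using F.coherent_next nonzero by (intro exI[of _ F.next_phi]) (simp only:, blast)
qed

end

section \<open>Betti numbers\<close>

text \<open>Works with the type class operations on functions, so that the module axioms of the
  quotient reduce to arithmetic with representatives.\<close>

locale linear_quotient =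
  fixes C N :: "('a \<Rightarrow> 'k::field) set"
  assumes sub: "N \<subseteq> C" and zero: "0 \<in> N"
    and C_add: "x \<in> C \<Longrightarrow> y \<in> C \<Longrightarrow> x + y \<in> C"
    and C_scale: "x \<in> C \<Longrightarrow> scale a x \<in> C"
    and N_add: "x \<in> N \<Longrightarrow> y \<in> N \<Longrightarrow> x + y \<in> N"
    and N_scale: "x \<in> N \<Longrightarrow> scale a x \<in> N"
begin

text \<open>The fields are those of \<open>chain_space\<close>, so that the homology module of the
  definitions is literally \<open>Q\<close> for cycles \<open>C\<close> and boundaries
  \<open>N\<close>.\<close>

definition M :: "('k, 'a \<Rightarrow> 'k) module" where
  "M = \<lparr>carrier = C, mult = undefined, one = undefined, zero = (\<lambda>\<sigma>. 0),
    add = (\<lambda>c c' \<sigma>. c \<sigma> + c' \<sigma>), smult = (\<lambda>a c \<sigma>. a * c \<sigma>)\<rparr>"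

definition Q :: "('k, ('a \<Rightarrow> 'k) set) module" where
  "Q = quotient_module M N"

definition cls :: "('a \<Rightarrow> 'k) \<Rightarrow> ('a \<Rightarrow> 'k) set" where
  "cls x = {y. y - x \<in> N}"

lemma scale_minus_one: "scale (- 1) x = - x"
  by (simp add: scale_def fun_eq_iff pointwise)

lemma N_diff: "x \<in> N \<Longrightarrow> y \<in> N \<Longrightarrow> x - y \<in> N"
  using N_add[of x "- y"] N_scale[of y "- 1"] by (simp add: scale_minus_one)

lemma cls_self: "x \<in> cls x"
  using zero by (simp add: cls_def)

lemma cls_eq_iff: "cls x = cls y \<longleftrightarrow> x - y \<in> N"
proof
  assume "cls x = cls y"
  then have "x \<in> cls y" using cls_self by blast
  then show "x - y \<in> N" by (simp add: cls_def)
next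
  assume xy: "x - y \<in> N"
  have "z - x \<in> N \<longleftrightarrow> z - y \<in> N" for z
    using N_add[OF _ xy, of "z - x"] N_diff[OF _ xy, of "z - y"] by auto
  then show "cls x = cls y" by (simp add: cls_def)
qed

lemma coset_eq: "N +>\<^bsub>M\<^esub> x = cls x"
proof -
  have "N +>\<^bsub>M\<^esub> x = (\<lambda>h. h + x) ` N"
    by (auto simp: a_r_coset_def r_coset_def M_def plus_fun_def)
  also have "\<dots> = cls x"
    unfolding cls_def by (auto simp: image_iff intro!: bexI[where x = "_ - x"])
  finally show ?thesis .
qed

lemma carrier_Q: "carrier Q = cls ` C"
proof -
  have "carrier Q = a_rcosets\<^bsub>M\<^esub> N" by (simp add: Q_def quotient_module_def)
  also have "\<dots> = cls ` carrier M" unfolding A_RCOSETS_def' coset_eq by auto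
  finally show ?thesis by (simp add: M_def)
qed

lemma zero_Q: "\<zero>\<^bsub>Q\<^esub> = cls 0"
  by (simp add: Q_def quotient_module_def cls_def)

lemma add_Q: "cls x \<oplus>\<^bsub>Q\<^esub> cls y = cls (x + y)"
proof -
  have "cls x \<oplus>\<^bsub>Q\<^esub> cls y = {a + b |a b. a \<in> cls x \<and> b \<in> cls y}"
    by (auto simp: Q_def quotient_module_def set_add_def set_mult_def M_def plus_fun_def)
  also have "\<dots> = cls (x + y)"
  proof (rule equalityI; rule subsetI)
    fix z assume "z \<in> {a + b |a b. a \<in> cls x \<and> b \<in> cls y}"
    then obtain a b where "z = a + b" "a - x \<in> N" "b - y \<in> N" by (auto simp: cls_def)
    moreover from this have "z - (x + y) = (a - x) + (b - y)" by simp
    ultimately have "z - (x + y) \<in> N" using N_add by (simp only:)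
    then show "z \<in> cls (x + y)" unfolding cls_def by (simp only: mem_Collect_eq)
  next
    fix z assume "z \<in> cls (x + y)"
    then have "z - y \<in> cls x" by (simp add: cls_def algebra_simps)
    moreover have "z = (z - y) + y" by simp
    ultimately show "z \<in> {a + b |a b. a \<in> cls x \<and> b \<in> cls y}" using cls_self by blast
  qed
  finally show ?thesis .
qed

lemma smult_Q: "a \<odot>\<^bsub>Q\<^esub> cls x = cls (scale a x)"
proof -
  have "a \<odot>\<^bsub>Q\<^esub> cls x = (\<Union>y\<in>cls x. cls (scale a y))"
    by (simp add: Q_def quotient_module_def coset_eq) (simp add: M_def scale_def)
  also have "\<dots> = cls (scale a x)"
  proof -
    have "cls (scale a y) = cls (scale a x)" if "y \<in> cls x" for y
    proof -
      have "y - x \<in> N" using that by (simp add: cls_def)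
      then have "scale a (y - x) \<in> N" by (rule N_scale)
      then show ?thesis unfolding cls_eq_iff by (simp only: scale_diff_right)
    qed
    then have "(\<Union>y\<in>cls x. cls (scale a y)) = (\<Union>y\<in>cls x. cls (scale a x))"
      by (rule SUP_cong[OF refl])
    also have "\<dots> = cls (scale a x)"
    proof (rule equalityI)
      show "cls (scale a x) \<subseteq> (\<Union>y\<in>cls x. cls (scale a x))" by (rule UN_upper[OF cls_self])
    qed (rule UN_least, rule subset_refl)
    finally show ?thesis .
  qed
  finally show ?thesis .
qed

lemma scale_assoc: "scale a (scale b x) = scale (a * b) x"
  and scale_one: "scale 1 x = (x :: 'a \<Rightarrow> 'k)"
  by (simp_all add: scale_def mult.assoc)

lemma vectorspace_Q: "vectorspace class_ring Q"
proof -
  have C0: "0 \<in> C" using sub zero by auto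
  have "module class_ring Q"
  proof (rule module_criteria, goal_cases)
    case 1 show ?case by (rule class_cring.cring_axioms)
  next
    case 2 show ?case using C0 by (auto simp: carrier_Q zero_Q)
  next
    case 3 show ?case using C_add by (auto simp: carrier_Q add_Q)
  next
    case 4
    show ?case
    proof
      fix v assume "v \<in> carrier Q"
      then obtain x where x: "x \<in> C" "v = cls x" by (auto simp: carrier_Q)
      then have "v \<oplus>\<^bsub>Q\<^esub> cls (- x) = \<zero>\<^bsub>Q\<^esub>" by (simp add: add_Q zero_Q)
      moreover have "cls (- x) \<in> carrier Q"
        using C_scale[OF x(1), of "- 1"] by (simp add: carrier_Q scale_minus_one)
      ultimately show "\<exists>w\<in>carrier Q. v \<oplus>\<^bsub>Q\<^esub> w = \<zero>\<^bsub>Q\<^esub>" by blast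
    qed
  next
    case 5 show ?case using C_scale by (auto simp: carrier_Q smult_Q)
  next
    case 6 show ?case by (auto simp: carrier_Q add_Q add.commute)
  next
    case 7 show ?case by (auto simp: carrier_Q add_Q add.assoc)
  next
    case 8 show ?case by (auto simp: carrier_Q add_Q zero_Q)
  next
    case 9 show ?case by (auto simp: carrier_Q smult_Q scale_assoc)
  next
    case 10 show ?case by (auto simp: carrier_Q smult_Q scale_one)
  next
    case 11 show ?case by (auto simp: carrier_Q smult_Q add_Q scale_add_left)
  next
    case 12 show ?case by (auto simp: carrier_Q smult_Q add_Q scale_add_right)
  qed
  then show ?thesis unfolding vectorspace_def using class_field by blast
qed

lemma dim_eq_0:
  assumes "C \<subseteq> N"
  shows "vectorspace.dim class_ring Q = 0"
proof -
  interpret vectorspace class_ring Q by (rule vectorspace_Q)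
  have eq: "cls x = cls 0" if "x \<in> C" for x
    using that assms by (simp add: cls_eq_iff subset_iff)
  have "carrier Q = {\<zero>\<^bsub>Q\<^esub>}"
    unfolding carrier_Q zero_Q using eq sub zero by auto
  then have "span {\<zero>\<^bsub>Q\<^esub>} = carrier Q"
    using span_is_subset2[of "{\<zero>\<^bsub>Q\<^esub>}"] in_own_span[of "{\<zero>\<^bsub>Q\<^esub>}"] by auto
  then show ?thesis by (rule dim0I)
qed

lemma dim_eq_1:
  assumes g: "g \<in> C" "g \<notin> N" and gen: "\<And>c. c \<in> C \<Longrightarrow> \<exists>a. c - scale a g \<in> N"
  shows "vectorspace.dim class_ring Q = 1"
proof -
  interpret vectorspace class_ring Q by (rule vectorspace_Q)
  have g_in: "cls g \<in> carrier Q" using g by (simp add: carrier_Q)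
  have "carrier Q \<subseteq> span {cls g}"
  proof
    fix v assume "v \<in> carrier Q"
    then obtain c where c: "c \<in> C" "v = cls c" by (auto simp: carrier_Q)
    then obtain a where "c - scale a g \<in> N" using gen by blast
    then have "v = a \<odot>\<^bsub>Q\<^esub> cls g" by (simp add: c smult_Q cls_eq_iff)
    moreover have "submodule class_ring (span {cls g}) Q" using g_in by (intro span_is_submodule) simp
    moreover have "cls g \<in> span {cls g}" using in_own_span[of "{cls g}"] g_in by simp
    ultimately show "v \<in> span {cls g}" by (simp add: submodule_def)
  qed
  then have "span {cls g} = carrier Q" using span_is_subset2[of "{cls g}"] g_in by auto
  moreover have "cls g \<noteq> \<zero>\<^bsub>Q\<^esub>" using g(2) by (simp add: zero_Q cls_eq_iff)
  ultimately show ?thesis using g_in by (intro dim1I)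
qed

end

text \<open>
  Row \<open>i\<close> of the chessboard is the vertex \<open>i\<close> and column \<open>j\<close> is the vertex \<open>- j\<close>. The label of
  an edge between a row and a column is its square; the first coordinate \<open>0\<close> is free for the
  remaining edges of the complete graph.
\<close>

definition vertices :: "nat \<Rightarrow> nat \<Rightarrow> int set" where
  "vertices m n = {1..int m} \<union> {- int n..- 1}"

definition label :: "int \<Rightarrow> int \<Rightarrow> nat \<times> nat" where
  "label x y = (if 0 < x \<and> y < 0 then (nat x, nat (- y))
    else if 0 < y \<and> x < 0 then (nat y, nat (- x))
    else (0, prod_encode (int_encode (min x y), int_encode (max x y))))"

definition all_edges :: "nat \<Rightarrow> nat \<Rightarrow> (nat \<times> nat) set" where
  "all_edges m n = (\<lambda>(x, y). label x y) ` (vertices m n \<times> vertices m n)"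

lemma label_eqD:
  assumes "label x y = label x' y'" "x \<noteq> 0" "y \<noteq> 0" "x' \<noteq> 0" "y' \<noteq> 0"
  shows "{x, y} = {x', y'}"
proof -
  define mixed where "mixed x y \<longleftrightarrow> 0 < x \<and> y < 0 \<or> 0 < y \<and> x < 0" for x y :: int
  have mixed: "label x y = (nat (max x y), nat (- min x y))" "fst (label x y) \<noteq> 0" if "mixed x y" for x y
    using that by (auto simp: mixed_def label_def)
  have other: "label x y = (0, prod_encode (int_encode (min x y), int_encode (max x y)))" if "\<not> mixed x y" for x y
    using that by (auto simp: mixed_def label_def)
  have "mixed x y \<longleftrightarrow> mixed x' y'"
    using assms(1) mixed(2) other by (metis fst_conv)
  moreover have "max x y = max x' y' \<and> min x y = min x' y'" if "mixed x y" "mixed x' y'"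
    using assms(1) that unfolding mixed(1)[OF that(1)] mixed(1)[OF that(2)] by (auto simp: mixed_def)
  moreover have "max x y = max x' y' \<and> min x y = min x' y'" if "\<not> mixed x y" "\<not> mixed x' y'"
    using assms(1) that unfolding other[OF that(1)] other[OF that(2)]
    by (simp add: prod_encode_eq int_encode_eq)
  ultimately have "max x y = max x' y' \<and> min x y = min x' y'" by blast
  then show ?thesis by (auto simp: max_def min_def split: if_splits)
qed

interpretation chessboard: chessboard_matchings "all_edges m n" "vertices m n" label "\<lambda>x. 0 < x" for m n
proof unfold_locales
  show "label x y = label y x" for x y by (auto simp: label_def min.commute max.commute)
  show "{x, y} = {x', y'}" if "label x y = label x' y'" "x \<in> vertices m n" "y \<in> vertices m n"
    "x' \<in> vertices m n" "y' \<in> vertices m n" for x y x' y'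
    using that by (intro label_eqD) (auto simp: vertices_def)
qed (auto simp: all_edges_def vertices_def)

lemma cnt_vertices:
  "chessboard.B.cnt True (vertices m n) = int m" "chessboard.B.cnt False (vertices m n) = int n"
proof -
  have "{x \<in> vertices m n. (0 < x) = True} = {1..int m}" "{x \<in> vertices m n. (0 < x) = False} = {- int n..- 1}"
    by (auto simp: vertices_def)
  then show "chessboard.B.cnt True (vertices m n) = int m" "chessboard.B.cnt False (vertices m n) = int n"
    unfolding chessboard.B.cnt_def by simp_all
qed

section \<open>Identification with the chain complex of the definitions\<close>

lemma faces_chessboard: "chessboard.B.faces (vertices m n) = chessboard_complex m n"
proof (rule equalityI; rule subsetI)
  fix \<sigma> assume \<sigma>: "\<sigma> \<in> chessboard.B.faces (vertices m n)"
  have form: "\<exists>i j. i \<in> {1..m} \<and> j \<in> {1..n} \<and> e = (i, j)" if e: "e \<in> \<sigma>" for e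
  proof -
    obtain x y where "x \<in> vertices m n" "y \<in> vertices m n" "(0 < x) = (\<not> 0 < y)" "e = label x y"
      by (rule chessboard.B.faces_edgeE[OF \<sigma> e])
    then show ?thesis by (cases "0 < x") (auto simp: vertices_def label_def)
  qed
  have sq: "label (int i) (- int j) = (i, j)" if "i \<in> {1..m}" "j \<in> {1..n}" for i j
    using that by (simp add: label_def)
  have sq': "label (- int j) (int i) = (i, j)" if "i \<in> {1..m}" "j \<in> {1..n}" for i j
    using that by (simp add: label_def)
  have "fst e \<noteq> fst f \<and> snd e \<noteq> snd f" if ef: "e \<in> \<sigma>" "f \<in> \<sigma>" "e \<noteq> f" for e f
  proof -
    obtain i j where e: "i \<in> {1..m}" "j \<in> {1..n}" "e = (i, j)" using form[OF ef(1)] by blast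
    obtain k l where f: "k \<in> {1..m}" "l \<in> {1..n}" "f = (k, l)" using form[OF ef(2)] by blast
    have "j = l" if "i = k"
      using chessboard.B.faces_unique[OF \<sigma>, of "int i" "- int j" "- int l"] sq[OF e(1,2)] sq[OF f(1,2)]
        that e f ef by (simp add: vertices_def)
    moreover have "i = k" if "j = l"
      using chessboard.B.faces_unique[OF \<sigma>, of "- int j" "int i" "int k"] sq'[OF e(1,2)] sq'[OF f(1,2)]
        that e f ef by (simp add: vertices_def)
    ultimately show ?thesis using e f ef(3) by auto
  qed
  then show "\<sigma> \<in> chessboard_complex m n"
    using form by (auto simp: chessboard_complex_def complete_bipartite_edges_def matching_def)
next
  fix \<sigma> assume "\<sigma> \<in> chessboard_complex m n"
  then have \<sigma>: "\<sigma> \<subseteq> {1..m} \<times> {1..n}" "matching \<sigma>"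
    by (auto simp: chessboard_complex_def complete_bipartite_edges_def)
  have inj: "e = f" if "e \<in> \<sigma>" "f \<in> \<sigma>" "fst e = fst f \<or> snd e = snd f" for e f
    using that \<sigma>(2) unfolding matching_def by blast
  show "\<sigma> \<in> chessboard.B.faces (vertices m n)"
  proof (rule chessboard.B.facesI)
    fix e assume "e \<in> \<sigma>"
    then obtain i j where "i \<in> {1..m}" "j \<in> {1..n}" "e = (i, j)" using \<sigma>(1) by blast
    then show "\<exists>x\<in>vertices m n. \<exists>y\<in>vertices m n. (0 < x) = (\<not> 0 < y) \<and> e = label x y"
      by (intro bexI[of _ "int i"] bexI[of _ "- int j"]) (auto simp: vertices_def label_def)
  next
    fix x y z
    assume xyz: "x \<in> vertices m n" "y \<in> vertices m n" "z \<in> vertices m n"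
      "(0 < x) = (\<not> 0 < y)" "(0 < x) = (\<not> 0 < z)" "label x y \<in> \<sigma>" "label x z \<in> \<sigma>"
    have "fst (label x y) = fst (label x z) \<or> snd (label x y) = snd (label x z)"
      using xyz(1-5) by (cases "0 < x") (auto simp: vertices_def label_def)
    then have "label x y = label x z" using inj xyz(6,7) by blast
    then have "{x, y} = {x, z}" by (rule label_eqD) (use xyz in \<open>auto simp: vertices_def\<close>)
    then show "y = z" by (auto simp: doubleton_eq_iff)
  qed
qed

lemma chain_space_chessboard:
  "carrier (chain_space (chessboard_complex m n) d) = chessboard.B.chains (vertices m n) (d + 1)"
proof -
  have "finite (chessboard_complex m n)"
    by (rule finite_subset[of _ "Pow ({1..m} \<times> {1..n})"])
      (auto simp: chessboard_complex_def complete_bipartite_edges_def)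
  moreover have "finite \<sigma>" if "\<sigma> \<in> chessboard_complex m n" for \<sigma>
    using that by (auto simp: chessboard_complex_def complete_bipartite_edges_def intro: finite_subset)
  ultimately have "c \<in> carrier (chain_space (chessboard_complex m n) d) \<longleftrightarrow>
      (\<forall>\<sigma>. c \<sigma> \<noteq> 0 \<longrightarrow> \<sigma> \<in> chessboard_complex m n \<and> int (card \<sigma>) = d + 1)" for c :: "_ \<Rightarrow> 'a::field"
    by (auto simp: chain_space_def faces_of_dim_def intro: finite_subset)
  then show ?thesis unfolding chessboard.B.chains_def faces_chessboard by blast
qed

lemma lex_less_eq: "lex_less = (<)"
  by (intro ext) (simp add: lex_less_def less_prod_def')

text \<open>One side sums over faces, the other over edges. After the exchange of sums,
  \<open>insert x \<tau>\<close> is the only face that contributes for the edge \<open>x\<close>;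
  the signs agree because \<open>lex_less\<close> is the order of the labels.\<close>

lemma boundary_eq_bd:
  assumes c: "c \<in> chessboard.B.chains (vertices m n) k"
  shows "boundary lex_less c = chessboard.bd m n c"
proof
  fix \<tau>
  let ?E = "all_edges m n"
  define S where "S = {\<sigma>. c \<sigma> \<noteq> 0}"
  have finE: "finite ?E" by (simp add: all_edges_def vertices_def)
  have S: "\<sigma> \<subseteq> ?E" if "\<sigma> \<in> S" for \<sigma>
    using chessboard.B.chainsD[OF c, of \<sigma>] chessboard.B.faces_subset_E[where m = m and n = n, of \<sigma> "vertices m n"] that
    by (simp add: S_def)
  have finS: "finite S" using finite_subset[of S "Pow ?E"] S finE by auto
  have "boundary lex_less c \<tau> = (\<Sum>\<sigma>\<in>S. \<Sum>x\<in>?E. if x \<in> \<sigma> \<and> \<sigma> - {x} = \<tau>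
      then (- 1) ^ card {y \<in> \<sigma>. y < x} * c \<sigma> else 0)"
    unfolding boundary_def S_def[symmetric] lex_less_eq
    by (intro sum.cong[OF refl] sum.mono_neutral_cong_left) (use S finE in auto)
  also have "\<dots> = (\<Sum>x\<in>?E. \<Sum>\<sigma>\<in>S. if x \<in> \<sigma> \<and> \<sigma> - {x} = \<tau>
      then (- 1) ^ card {y \<in> \<sigma>. y < x} * c \<sigma> else 0)"
    by (rule sum.swap)
  also have "\<dots> = (\<Sum>x\<in>?E. chessboard.contract m n x c \<tau>)"
  proof (rule sum.cong[OF refl])
    fix x assume x: "x \<in> ?E"
    have "(\<Sum>\<sigma>\<in>S. if x \<in> \<sigma> \<and> \<sigma> - {x} = \<tau> then (- 1) ^ card {y \<in> \<sigma>. y < x} * c \<sigma> else 0)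
        = (\<Sum>\<sigma>\<in>S. if \<sigma> = insert x \<tau> then chessboard.contract m n x c \<tau> else 0)"
    proof (rule sum.cong[OF refl])
      fix \<sigma> assume \<sigma>: "\<sigma> \<in> S"
      have "{y \<in> insert x \<tau>. y < x} = {y \<in> \<tau> \<inter> ?E. y < x}" if "\<sigma> = insert x \<tau>"
        using S[OF \<sigma>] that by auto
      then show "(if x \<in> \<sigma> \<and> \<sigma> - {x} = \<tau> then (- 1) ^ card {y \<in> \<sigma>. y < x} * c \<sigma> else 0)
          = (if \<sigma> = insert x \<tau> then chessboard.contract m n x c \<tau> else 0)"
        by (auto simp: chessboard.contract_def chessboard.sg_def)
    qed
    also have "\<dots> = chessboard.contract m n x c \<tau>"
      using finS by (auto simp: S_def chessboard.contract_def)
    finally show "(\<Sum>\<sigma>\<in>S. if x \<in> \<sigma> \<and> \<sigma> - {x} = \<tau> then (- 1) ^ card {y \<in> \<sigma>. y < x} * c \<sigma> else 0)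
        = chessboard.contract m n x c \<tau>" .
  qed
  also have "\<dots> = chessboard.bd m n c \<tau>" by (simp add: chessboard.bd_def sum_fun_apply)
  finally show "boundary lex_less c \<tau> = chessboard.bd m n c \<tau>" .
qed

lemma cycles_chessboard:
  "cycles lex_less (chessboard_complex m n) d = chessboard.B.cyc m n (vertices m n) (d + 1)"
  unfolding cycles_def chain_space_chessboard chessboard.B.cyc_def
  by (auto simp: boundary_eq_bd zero_fun_def)

lemma boundaries_chessboard:
  "boundaries lex_less (chessboard_complex m n) d = chessboard.B.bnd m n (vertices m n) (d + 1)"
  unfolding boundaries_def chain_space_chessboard chessboard.B.bnd_def
  by (intro image_cong refl boundary_eq_bd)

lemma betti_quotient:
  fixes m n :: nat and d :: int
  defines "C \<equiv> (chessboard.B.cyc m n (vertices m n) (d + 1) :: (_ \<Rightarrow> Enum.finite_3) set)"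
    and "N \<equiv> (chessboard.B.bnd m n (vertices m n) (d + 1) :: (_ \<Rightarrow> Enum.finite_3) set)"
  shows "linear_quotient C N" "betti m n d = vectorspace.dim class_ring (linear_quotient.Q C N)"
proof -
  show *: "linear_quotient C N"
    unfolding C_def N_def
    by unfold_locales (auto intro: chessboard.B.bnd_cyc)
  show "betti m n d = vectorspace.dim class_ring (linear_quotient.Q C N)"
    unfolding linear_quotient.Q_def[OF *] linear_quotient.M_def[OF *] betti_def reduced_homology_def
      cycles_chessboard boundaries_chessboard C_def[symmetric] N_def[symmetric]
    by (simp add: chain_space_def)
qed

lemma betti_eq_0:
  assumes "d + 2 \<le> int m" "d + 2 \<le> int n" "3 * d + 5 \<le> int m + int n"
  shows "betti m n d = 0"
  unfolding betti_quotient(2)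
proof (rule linear_quotient.dim_eq_0[OF betti_quotient(1)])
  show "chessboard.B.cyc m n (vertices m n) (d + 1) \<subseteq> (chessboard.B.bnd m n (vertices m n) (d + 1) :: (_ \<Rightarrow> Enum.finite_3) set)"
    using assms by (intro chessboard.B.exact_bipartite) (simp_all add: cnt_vertices)
qed

lemma finite_3_char: "(3 :: Enum.finite_3) = 0"
proof -
  have "(3 :: Enum.finite_3) = 1 + 1 + 1" by (simp only: numeral.simps)
  also have "\<dots> = 0" by (simp add: one_finite_3_def plus_finite_3_def zero_finite_3_def)
  finally show ?thesis .
qed

lemma betti_eq_1:
  assumes "0 \<le> d" "d + 3 \<le> int m" "d + 3 \<le> int n" "int m + int n = 3 * d + 4"
  shows "betti m n d = 1"
proof -
  let ?V = "vertices m n" and ?k = "d + 1"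
  have "\<exists>g\<in>chessboard.B.cyc m n ?V ?k. \<forall>c\<in>chessboard.B.cyc m n ?V ?k.
      \<exists>\<alpha>. c - scale \<alpha> g \<in> (chessboard.B.bnd m n ?V ?k :: (_ \<Rightarrow> Enum.finite_3) set)"
    using assms by (intro chessboard.B.cyclic finite_3_char) (simp_all add: cnt_vertices)
  then obtain g :: "_ \<Rightarrow> Enum.finite_3" where g: "g \<in> chessboard.B.cyc m n ?V ?k"
    "\<forall>c\<in>chessboard.B.cyc m n ?V ?k. \<exists>\<alpha>. c - scale \<alpha> g \<in> chessboard.B.bnd m n ?V ?k"
    by (rule bexE)
  obtain \<phi> :: "_ \<Rightarrow> _ \<Rightarrow> Enum.finite_3" where
    \<phi>: "coherent_family (all_edges m n) ?V label (int (nat ?k)) \<phi>"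
    and nz: "\<forall>V\<subseteq>?V. int (nat ?k) \<le> chessboard.B.cnt True V \<longrightarrow> int (nat ?k) \<le> chessboard.B.cnt False V \<longrightarrow>
      chessboard.B.cnt True V + chessboard.B.cnt False V = 3 * int (nat ?k) + 1 \<longrightarrow>
      (\<exists>z\<in>chessboard.B.cyc m n V (int (nat ?k)). \<phi> V z \<noteq> 0)"
    using chessboard.ex_detecting_family[OF finite_3_char, of m n "nat ?k"] by blast
  have k: "int (nat ?k) = ?k" using assms by simp
  obtain z where z: "z \<in> chessboard.B.cyc m n ?V ?k" "\<phi> ?V z \<noteq> 0"
    using nz[rule_format, OF subset_refl] assms unfolding k by (auto simp: cnt_vertices)
  interpret F: coherent_family "all_edges m n" ?V label ?k \<phi> using \<phi> unfolding k .
  have card: "int (card ?V) = 3 * ?k + 1"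
  proof -
    have "card ?V = card {1..int m} + card {- int n..- 1}"
      unfolding vertices_def by (rule card_Un_disjoint) auto
    then show ?thesis using assms(4) by simp
  qed
  \<comment> \<open>Up to boundaries \<open>z\<close> is a multiple of \<open>g\<close>. If
    \<open>g\<close> were a boundary, then so would be \<open>z\<close>, also in the complete graph,
    where \<open>\<phi>\<close> vanishes on boundaries.\<close>
  have "g \<notin> chessboard.B.bnd m n ?V ?k"
  proof
    assume bnd: "g \<in> chessboard.B.bnd m n ?V ?k"
    obtain \<alpha> where "z - scale \<alpha> g \<in> chessboard.B.bnd m n ?V ?k" using g(2) z(1) by blast
    from chessboard.B.bnd_add[OF this chessboard.B.bnd_scale[OF bnd, of \<alpha>]]
    have "z \<in> chessboard.B.bnd m n ?V ?k" by simp
    then have "z \<in> chessboard.K.bnd m n ?V ?k" by (rule chessboard.bnd_complete) simp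
    then show False using F.vanish[OF _ card] z(2) by simp
  qed
  then show ?thesis
    unfolding betti_quotient(2) using g by (intro linear_quotient.dim_eq_1[OF betti_quotient(1)]) auto
qed

theorem theorem4p10:
  fixes m n :: nat and d :: int
  assumes "m \<le> n"
    and "int n \<le> 2 * int m - 5"
    and "(m + n) mod 3 = 1"
    and "(m, n) \<noteq> (5, 5)"
    and "d = nu m n"
  shows "betti m n d =
    betti (m - 1) (n - 2) (d - 1)
    + (n - 2) * betti (m - 1) (n - 1) (d - 1)
    + 2 * ((m - 1) choose 2) * betti (m - 3) (n - 2) (d - 2)"
proof -
  define q where "q = (m + n) div 3"
  have q: "m + n = 3 * q + 1" using assms(3) unfolding q_def by presburger
  \<comment> \<open>Substituting n = 3 q + 1 - m into n \<le> 2 m - 5 gives 3 m \<ge> 3 q + 6. Hence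
    the ceiling \<open>q - 1\<close>, and not \<open>m - 1\<close>, is the minimum in
    \<open>nu\<close>.\<close>
  have m: "int m \<ge> int q + 2" using q assms(1,2) by linarith
  have "(real m + real n - 4) / 3 = of_int (int q - 1)" using q by (simp add: field_simps flip: of_nat_add)
  then have "\<lceil>(real m + real n - 4) / 3\<rceil> = int q - 1" by (simp only: ceiling_of_int)
  then have d: "d = int q - 1" using assms(5) m by (simp add: nu_def)
  have q4: "q \<ge> 4"
  proof (rule ccontr)
    assume "\<not> q \<ge> 4"
    then have "m = 5 \<and> n = 5" using q m assms(1) by linarith
    then show False using assms(4) by simp
  qed
  \<comment> \<open>Otherwise both sides would be \<open>q + 2\<close>, which forces
    \<open>q = 3\<close>. The extra column keeps the board of size \<open>m - 1\<close> by
    \<open>n - 2\<close> within the range of \<open>betti_eq_1\<close>.\<close>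
  have n: "n \<ge> q + 3" using q q4 assms(1) by linarith
  have sub: "int (m - 1) = int m - 1" "int (m - 3) = int m - 3" "int (n - 1) = int n - 1" "int (n - 2) = int n - 2"
    using m n q4 by auto
  have qi: "int m + int n = 3 * int q + 1" using q by linarith
  have n': "int n \<ge> int q + 3" "int q \<ge> 4" using n q4 by linarith+
  have total: "int m - 1 + (int n - 2) = 3 * (d - 1) + 4"
  proof -
    have "int m - 1 + (int n - 2) = (int m + int n) - 3" by simp
    then show ?thesis unfolding qi d by simp
  qed
  have "betti m n d = 1"
    by (rule betti_eq_1) (use d m n' qi in auto)
  moreover have "betti (m - 1) (n - 2) (d - 1) = 1"
    by (rule betti_eq_1; (unfold sub)?) (use d m n' total in auto)
  \<comment> \<open>For this board and the next one the condition on the total number of vertices in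
    \<open>betti_eq_0\<close> holds with equality.\<close>
  moreover have "betti (m - 1) (n - 1) (d - 1) = 0"
    by (rule betti_eq_0; (unfold sub)?) (use d m n' total in auto)
  moreover have "betti (m - 3) (n - 2) (d - 2) = 0"
    by (rule betti_eq_0; (unfold sub)?) (use d m n' total in auto)
  ultimately show ?thesis by simp
qed

end
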